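(* Let $K$ be a finite simplicial complex, and let $g \colon V(K) \to \mathbb{R}$ be a real-valued function on the vertex set $V(K)$ of $K$. Then $K$ is homotopy equivalent to a regular CW-complex, denoted $\mathrm{core}_g(K)$, whose cells are in one-to-one correspondence with the simplices in the descending open stars of the strong critical vertices of $g$ (that is, with the elements of $\bigcup \{\mathrm{st}^{\downarrow}(w,K) : w \text{ a strong critical vertex of } g\}$). Moreover, if $\dim(K)=N$, then there is an $(N+1)$-deformation from $K$ to $\mathrm{core}_g(K)$.
   Context: For a simplicial complex $K$ and a vertex $v$ of $K$, the open star $\mathrm{st}(v,K)$ is the set of simplices of $K$ containing $v$; $K\smallsetminus v$ is the subcomplex of simplices not containing $v$; the link $\mathrm{lk}(v,K)$ is the subcomplex of $K\smallsetminus v$ consisting of the simplices $\sigma$ with $\sigma\cup\{v\}\in K$. A simplicial cone $a*K_0$ with apex $a$ (a vertex not in $K_0$) consists of the simplices of $K_0$, the vertex $\{a\}$, and all $\sigma\cup\{a\}$ with $\sigma\in K_0$. A vertex $v$ of $K$ is dominated by a vertex $a$ if $\mathrm{lk}(v,K)=a*K_0$ for some subcomplex $K_0$ of $K$. For $g\colon V(K)\to\mathbb{R}$ and $\alpha\in\mathbb{R}$, $K_\alpha$ is the subcomplex of $K$ consisting of all simplices all of whose vertices $x$ satisfy $g(x)\le\alpha$. The descending open star of $v$ is $\mathrm{st}^{\downarrow}(v,K)=\mathrm{st}(v,K_{g(v)})$. A vertex $v$ is descending dominated if it is dominated in $K_{g(v)}$ by a vertex $a$ with $g(a)<g(v)$;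 otherwise $v$ is a strong critical vertex of $g$. A CW-complex is regular if the attaching map $S^{n-1}\to X^{(n-1)}$ of each $n$-cell is a homeomorphism onto its image. Deformations: simplicial complexes are regarded as CW-complexes via geometric realization. A finite CW-complex $X$ collapses elementarily to a subcomplex $Y$ if $X=Y\cup e^{n-1}\cup e^n$, where $e^{n-1},e^n$ are two cells not in $Y$ and there is a map $\psi\colon I^n\to X$ that is a characteristic map of $e^n$, whose restriction to a face $I^{n-1}\subset \partial I^n$ is a characteristic map of $e^{n-1}$, and such that $\psi(\overline{\partial I^n\smallsetminus I^{n-1}})\subseteq Y^{(n-1)}$. A collapse is a finite sequence of elementary collapses (up to isomorphism of CW-complexes); an expansion is the inverse of a collapse. An $m$-deformation from $X$ to $Y$ is a finite sequence of complexes starting at $X$ and ending at $Y$, all of dimension at most $m$, in which each complex is obtained from the previous one by a collapse or an expansion. *)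

theory Defs
  imports "HOL-Analysis.Analysis" "HOL-Analysis.Abstract_Euclidean_Space"
begin

section \<open>Abstract simplicial complexes\<close>

text \<open>The empty set is not counted as a simplex. Hence the empty complex is allowed, and the cone
  over it consists of the apex alone.\<close>

definition simplicial_cpx :: "'v set set \<Rightarrow> bool" where
  "simplicial_cpx K \<longleftrightarrow>
     (\<forall>\<sigma>\<in>K. finite \<sigma> \<and> \<sigma> \<noteq> {}) \<and> (\<forall>\<sigma>\<in>K. \<forall>\<tau>. \<tau> \<noteq> {} \<and> \<tau> \<subseteq> \<sigma> \<longrightarrow> \<tau> \<in> K)"

definition vertices :: "'v set set \<Rightarrow> 'v set" where
  "vertices K = {v. {v} \<in> K}"

definition simplicial_dim :: "'v set set \<Rightarrow> int" where
  "simplicial_dim K = (if K = {} then -1 else Max ((\<lambda>\<sigma>. int (card \<sigma>) - 1) ` K))"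

definition open_star :: "'v \<Rightarrow> 'v set set \<Rightarrow> 'v set set" where
  "open_star v K = {\<sigma>\<in>K. v \<in> \<sigma>}"

definition delete_vertex :: "'v set set \<Rightarrow> 'v \<Rightarrow> 'v set set" where
  "delete_vertex K v = {\<sigma>\<in>K. v \<notin> \<sigma>}"

definition link :: "'v \<Rightarrow> 'v set set \<Rightarrow> 'v set set" where
  "link v K = {\<sigma>\<in>delete_vertex K v. \<sigma> \<union> {v} \<in> K}"

definition simplicial_cone :: "'v \<Rightarrow> 'v set set \<Rightarrow> 'v set set" where
  "simplicial_cone a K0 = K0 \<union> {{a}} \<union> {\<sigma> \<union> {a} |\<sigma>. \<sigma> \<in> K0}"

definition dominated_by :: "'v set set \<Rightarrow> 'v \<Rightarrow> 'v \<Rightarrow> bool" where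
  "dominated_by K v a \<longleftrightarrow> v \<in> vertices K \<and>
     (\<exists>K0. simplicial_cpx K0 \<and> K0 \<subseteq> K \<and> a \<notin> vertices K0 \<and> link v K = simplicial_cone a K0)"

definition sublevel :: "('v \<Rightarrow> real) \<Rightarrow> 'v set set \<Rightarrow> real \<Rightarrow> 'v set set" where
  "sublevel g K \<alpha> = {\<sigma>\<in>K. \<forall>x\<in>\<sigma>. g x \<le> \<alpha>}"

definition descending_star :: "('v \<Rightarrow> real) \<Rightarrow> 'v \<Rightarrow> 'v set set \<Rightarrow> 'v set set" where
  "descending_star g v K = open_star v (sublevel g K (g v))"

definition descending_dominated :: "('v \<Rightarrow> real) \<Rightarrow> 'v set set \<Rightarrow> 'v \<Rightarrow> bool" where
  "descending_dominated g K v \<longleftrightarrow> (\<exists>a. dominated_by (sublevel g K (g v)) v a \<and> g a < g v)"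

definition strong_critical :: "('v \<Rightarrow> real) \<Rightarrow> 'v set set \<Rightarrow> 'v \<Rightarrow> bool" where
  "strong_critical g K v \<longleftrightarrow> v \<in> vertices K \<and> \<not> descending_dominated g K v"


section \<open>CW-complexes\<close>

text \<open>Model balls in \<^term>\<open>Euclidean_space n\<close>, whose points are the functions \<^typ>\<open>nat \<Rightarrow> real\<close>
  vanishing from index \<open>n\<close> on. Note the indexing: \<open>bdisk n\<close> is the sphere of dimension \<open>n - 1\<close>,
  which is empty for \<open>n = 0\<close>.\<close>

definition disk :: "nat \<Rightarrow> (nat \<Rightarrow> real) set" where
  "disk n = {x \<in> topspace (Euclidean_space n). (\<Sum>i<n. (x i)\<^sup>2) \<le> 1}"

definition bdisk :: "nat \<Rightarrow> (nat \<Rightarrow> real) set" where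
  "bdisk n = {x \<in> topspace (Euclidean_space n). (\<Sum>i<n. (x i)\<^sup>2) = 1}"

definition cube :: "nat \<Rightarrow> (nat \<Rightarrow> real) set" where
  "cube n = {x \<in> topspace (Euclidean_space n). \<forall>i<n. 0 \<le> x i \<and> x i \<le> 1}"

definition bcube :: "nat \<Rightarrow> (nat \<Rightarrow> real) set" where
  "bcube n = {x \<in> cube n. \<exists>i<n. x i = 0 \<or> x i = 1}"

text \<open>A space together with its open \<open>n\<close>-cells for every \<open>n\<close>. Characteristic maps are not part of
  the data; their existence is required in \<open>cw_complex\<close>.\<close>

record 'a cw =
  cw_space :: "'a topology"
  cw_ncells :: "nat \<Rightarrow> 'a set set"

definition cw_cells :: "'a cw \<Rightarrow> 'a set set" where
  "cw_cells X = (\<Union>n. cw_ncells X n)"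

text \<open>\<open>skel_below X n\<close> is the \<open>(n-1)\<close>-skeleton.\<close>

definition skel_below :: "'a cw \<Rightarrow> nat \<Rightarrow> 'a set" where
  "skel_below X n = \<Union>(\<Union>m<n. cw_ncells X m)"

text \<open>\<open>\<phi>\<close>, defined on an \<open>n\<close>-ball \<open>B\<close> with boundary sphere \<open>S\<close>, is a characteristic map of \<open>e\<close>.\<close>

definition characteristic_map ::
  "'a cw \<Rightarrow> nat \<Rightarrow> 'a set \<Rightarrow> (nat \<Rightarrow> real) set \<Rightarrow> (nat \<Rightarrow> real) set \<Rightarrow> ((nat \<Rightarrow> real) \<Rightarrow> 'a) \<Rightarrow> bool" where
  "characteristic_map X n e B S \<phi> \<longleftrightarrow>
     continuous_map (subtopology (Euclidean_space n) B) (cw_space X) \<phi> \<and>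
     homeomorphic_map (subtopology (Euclidean_space n) (B - S)) (subtopology (cw_space X) e) \<phi> \<and>
     \<phi> ` S \<subseteq> skel_below X n"

text \<open>The last two conjuncts are closure finiteness and the weak topology.\<close>

definition cw_complex :: "'a cw \<Rightarrow> bool" where
  "cw_complex X \<longleftrightarrow>
     Hausdorff_space (cw_space X) \<and>
     topspace (cw_space X) = \<Union>(cw_cells X) \<and>
     (\<forall>m n. \<forall>d\<in>cw_ncells X m. \<forall>e\<in>cw_ncells X n. (m, d) \<noteq> (n, e) \<longrightarrow> d \<inter> e = {}) \<and>
     (\<forall>n. \<forall>e\<in>cw_ncells X n. \<exists>\<phi>. characteristic_map X n e (disk n) (bdisk n) \<phi>) \<and>
     (\<forall>e\<in>cw_cells X. \<exists>F. finite F \<and> F \<subseteq> cw_cells X \<and> cw_space X closure_of e \<subseteq> \<Union>F) \<and>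
     (\<forall>A. A \<subseteq> topspace (cw_space X) \<and>
          (\<forall>e\<in>cw_cells X. closedin (cw_space X) (A \<inter> (cw_space X closure_of e)))
          \<longrightarrow> closedin (cw_space X) A)"

definition regular_cw_complex :: "'a cw \<Rightarrow> bool" where
  "regular_cw_complex X \<longleftrightarrow>
     cw_complex X \<and>
     (\<forall>n. \<forall>e\<in>cw_ncells X n. \<exists>\<phi>.
        characteristic_map X n e (disk n) (bdisk n) \<phi> \<and>
        embedding_map (subtopology (Euclidean_space n) (bdisk n))
          (subtopology (cw_space X) (skel_below X n)) \<phi>)"

definition finite_cw_complex :: "'a cw \<Rightarrow> bool" where
  "finite_cw_complex X \<longleftrightarrow> cw_complex X \<and> finite (cw_cells X)"

definition cw_dim_le :: "'a cw \<Rightarrow> int \<Rightarrow> bool" where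
  "cw_dim_le X m \<longleftrightarrow> (\<forall>n. cw_ncells X n \<noteq> {} \<longrightarrow> int n \<le> m)"

definition cw_subcomplex :: "'a cw \<Rightarrow> 'a cw \<Rightarrow> bool" where
  "cw_subcomplex Y X \<longleftrightarrow>
     (\<forall>n. cw_ncells Y n \<subseteq> cw_ncells X n) \<and>
     cw_space Y = subtopology (cw_space X) (\<Union>(cw_cells Y)) \<and>
     (\<forall>e\<in>cw_cells Y. cw_space X closure_of e \<subseteq> \<Union>(cw_cells Y))"

definition cw_isomorphic :: "'a cw \<Rightarrow> 'b cw \<Rightarrow> bool" where
  "cw_isomorphic X Y \<longleftrightarrow>
     (\<exists>h. homeomorphic_map (cw_space X) (cw_space Y) h \<and>
          (\<forall>n. cw_ncells Y n = (\<lambda>e. h ` e) ` cw_ncells X n))"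


section \<open>Geometric realization\<close>

definition open_simplex :: "'v set \<Rightarrow> ('v \<Rightarrow> real) set" where
  "open_simplex \<sigma> = {x. (\<forall>v\<in>\<sigma>. 0 < x v) \<and> (\<forall>v. v \<notin> \<sigma> \<longrightarrow> x v = 0) \<and> (\<Sum>v\<in>\<sigma>. x v) = 1}"

text \<open>Barycentric coordinates. The product topology is the right one for finite complexes, the only
  ones to which this is applied.\<close>

definition realization :: "'v set set \<Rightarrow> ('v \<Rightarrow> real) cw" where
  "realization K =
     \<lparr>cw_space = subtopology (powertop_real UNIV) (\<Union>\<sigma>\<in>K. open_simplex \<sigma>),
      cw_ncells = (\<lambda>n. {open_simplex \<sigma> |\<sigma>. \<sigma> \<in> K \<and> card \<sigma> = n + 1})\<rparr>"


section \<open>Collapses and deformations\<close>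

text \<open>The parametrization by the \<open>(n-1)\<close>-cube of the face of the \<open>n\<close>-cube on which coordinate \<open>j\<close>
  equals \<open>c\<close>.\<close>

definition cube_face_map :: "nat \<Rightarrow> real \<Rightarrow> (nat \<Rightarrow> real) \<Rightarrow> (nat \<Rightarrow> real)" where
  "cube_face_map j c x = (\<lambda>i. if i < j then x i else if i = j then c else x (i - 1))"

text \<open>Here \<open>k\<close> is \<open>n - 1\<close>: the cell \<open>e\<close> has dimension \<open>n = Suc k\<close> and its free face \<open>f\<close> has
  dimension \<open>k\<close>.\<close>

definition elementary_collapse :: "'a cw \<Rightarrow> 'a cw \<Rightarrow> bool" where
  "elementary_collapse X Y \<longleftrightarrow>
     finite_cw_complex X \<and> cw_subcomplex Y X \<and>
     (\<exists>k f e \<psi> j c.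
        f \<in> cw_ncells X k \<and> f \<notin> cw_cells Y \<and>
        e \<in> cw_ncells X (Suc k) \<and> e \<notin> cw_cells Y \<and>
        cw_cells X = cw_cells Y \<union> {f, e} \<and>
        j < Suc k \<and> (c = 0 \<or> c = 1) \<and>
        characteristic_map X (Suc k) e (cube (Suc k)) (bcube (Suc k)) \<psi> \<and>
        characteristic_map X k f (cube k) (bcube k) (\<psi> \<circ> cube_face_map j c) \<and>
        \<psi> ` (Euclidean_space (Suc k) closure_of (bcube (Suc k) - cube_face_map j c ` cube k))
          \<subseteq> skel_below Y (Suc k))"

definition collapses_to :: "'a cw \<Rightarrow> 'a cw \<Rightarrow> bool" where
  "collapses_to = (\<lambda>X Y. elementary_collapse X Y \<or> cw_isomorphic X Y)\<^sup>*\<^sup>*"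

text \<open>The complexes of the sequence are carried by \<^typ>\<open>nat \<Rightarrow> real\<close>. As collapses are taken up to
  isomorphism and every finite CW-complex embeds in some Euclidean space, this is no restriction;
  the complexes \<open>X\<close> and \<open>Y\<close> at the ends may have other carrier types.\<close>

definition deformation :: "int \<Rightarrow> 'a cw \<Rightarrow> 'b cw \<Rightarrow> bool" where
  "deformation m X Y \<longleftrightarrow>
     (\<exists>Zs :: (nat \<Rightarrow> real) cw list.
        Zs \<noteq> [] \<and> cw_isomorphic X (hd Zs) \<and> cw_isomorphic (last Zs) Y \<and>
        (\<forall>Z\<in>set Zs. finite_cw_complex Z \<and> cw_dim_le Z m) \<and>
        successively (\<lambda>Z Z'. collapses_to Z Z' \<or> collapses_to Z' Z) Zs)"

end

theory Submission
  imports Defs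
begin

text \<open>Order the vertices by \<open>g\<close>, on each level the descending dominated ones first. Then a vertex \<open>v\<close> that is not
  strong critical is dominated by an earlier vertex \<open>\<alpha> v\<close> in the subcomplex spanned by the vertices up to \<open>v\<close>.
  Peel off vertices from the top: a point of the realization passes the mass of such a \<open>v\<close> on to \<open>\<alpha> v\<close> and
  stops at the first strong critical vertex of positive mass. The core is the quotient of the realization by
  this process, realized as the image of a quadratic map \<open>F\<close>, and its cells are the open simplices with a
  strong critical top vertex.

  The mapping cylinder of \<open>F\<close> is a finite complex of dimension \<open>N + 1\<close>. Removing prisms together with their tops
  collapses it onto the core. Removing the prism over a critical simplex together with its bottom, and the prism
  over \<open>\<sigma> \<union> {\<alpha> v}\<close> together with the prism over \<open>\<sigma>\<close>, where \<open>v\<close> is the top vertex of a noncritical \<open>\<sigma>\<close>,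
  collapses it onto the complex.

  The core is regular: adding one vertex to a simplex changes the associated closed cell from a ball to the region
  under a function on this ball that is positive in the interior, and such a region is again a ball.\<close>

section \<open>Balls\<close>

text \<open>Removing dominated vertices from the complex one after another is awkward: once a
  critical vertex is attached to what the earlier vertices have been retracted to, the result is in
  general not simplicial, and every later attaching map has to be composed with the retractions made
  so far. Peeling points instead of cells avoids this. All identifications are the fibres of a
  single continuous map on a compact set, so the core is a set of real vectors, Hausdorff without
  further argument, and an injective continuous map from a disk into it is an embedding.

  A critical top vertex of a simplex acts on the opposite face as the cylinder parameter acts on the
  complex: where its mass is positive nothing is identified, and where it is 0 the identifications
  below it apply. So the closed cells of the core and the mapping cylinder are images of the same
  map, the cylinder with one more critical vertex on top of all others. The two collapses become
  statements on finite sets of labels: a matching of cells together with a rank that shows it to be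
  acyclic.\<close>

text \<open>A squeeze settles the points where \<open>b\<close> vanishes, and the other points form
  a relatively open set. The lemma serves for fractions whose denominator has the same zeros as
  \<open>b\<close>.\<close>

lemma continuous_on_dominated:
  fixes q b :: "'a::t2_space \<Rightarrow> real"
  assumes b: "continuous_on S b" and q: "continuous_on {x\<in>S. b x \<noteq> 0} q"
    and le: "\<And>x. x \<in> S \<Longrightarrow> \<bar>q x\<bar> \<le> b x"
  shows "continuous_on S q"
proof -
  have "continuous (at x within S) q" if x: "x \<in> S" for x
  proof (cases "b x = 0")
    case True
    then have "q x = 0" using le[OF x] by simp
    moreover have "(q \<longlongrightarrow> 0) (at x within S)"
    proof (rule Lim_null_comparison)
      show "\<forall>\<^sub>F y in at x within S. norm (q y) \<le> b y"
        using le by (auto simp: eventually_at_filter)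
      show "(b \<longlongrightarrow> 0) (at x within S)"
        using b x True by (metis continuous_on)
    qed
    ultimately show ?thesis by (simp add: continuous_within)
  next
    case False
    have "openin (top_of_set S) (S \<inter> b -` (-{0}))"
      by (rule continuous_openin_preimage_gen[OF b]) auto
    then obtain T where T: "open T" "S \<inter> b -` (-{0}) = S \<inter> T" by (auto simp: openin_open)
    have eq: "{x\<in>S. b x \<noteq> 0} = S \<inter> T" using T(2) by auto
    have "x \<in> T" using False x eq by auto
    have "continuous (at x within (S \<inter> T)) q"
      using q x False unfolding eq[symmetric] continuous_on_eq_continuous_within by auto
    moreover have "at x within (S \<inter> T) = at x within S"
      using \<open>x \<in> T\<close> \<open>open T\<close> by (intro at_within_nhd[of _ T]) auto
    ultimately show ?thesis by (simp add: continuous_within)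
  qed
  then show ?thesis by (simp add: continuous_on_eq_continuous_within)
qed

section \<open>Gauges, star bodies and the region under a function on a disk\<close>

definition Rn :: "nat \<Rightarrow> (nat \<Rightarrow> real) set" where
  "Rn n = {x. \<forall>i\<ge>n. x i = 0}"

abbreviation enorm :: "nat \<Rightarrow> (nat \<Rightarrow> real) \<Rightarrow> real" where
  "enorm n x \<equiv> L2_set x {..<n}"

lemma disk_eq: "disk n = {x \<in> Rn n. enorm n x \<le> 1}"
  by (auto simp: disk_def topspace_Euclidean_space L2_set_def Rn_def)

lemma bdisk_eq: "bdisk n = {x \<in> Rn n. enorm n x = 1}"
  by (auto simp: bdisk_def topspace_Euclidean_space L2_set_def Rn_def)

lemma enorm_eq_0: "x \<in> Rn n \<Longrightarrow> enorm n x = 0 \<longleftrightarrow> x = (\<lambda>_. 0)"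
  by (auto simp: L2_set_eq_0_iff fun_eq_iff Rn_def) (metis lessThan_iff not_le)

lemma enorm_pos: "x \<in> Rn n \<Longrightarrow> x \<noteq> (\<lambda>_. 0) \<Longrightarrow> 0 < enorm n x"
  using enorm_eq_0[of x n] L2_set_nonneg[of x "{..<n}"] by linarith

lemma enorm_scale: "0 \<le> r \<Longrightarrow> enorm n (\<lambda>i. r * x i) = r * enorm n x"
  by (simp add: L2_set_right_distrib)

lemma abs_le_enorm: "x \<in> Rn n \<Longrightarrow> \<bar>x i\<bar> \<le> enorm n x"
proof (cases "i < n")
  case True
  then have "\<bar>x i\<bar> \<le> sqrt (\<Sum>i<n. (x i)\<^sup>2)"
    by (metis finite_lessThan lessThan_iff member_le_sum real_sqrt_abs real_sqrt_le_iff zero_le_power2)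
  then show ?thesis by (simp add: L2_set_def)
qed (auto simp: Rn_def)

lemma continuous_on_enorm [continuous_intros]:
  "continuous_on S f \<Longrightarrow> continuous_on S (\<lambda>x. enorm n (f x))"
  unfolding L2_set_def
  by (intro continuous_on_real_sqrt continuous_on_sum continuous_on_power)
     (rule continuous_on_product_then_coordinatewise)

lemma continuous_on_coord [continuous_intros]:
  "continuous_on S (\<lambda>x. x i)"
  by (rule continuous_on_product_then_coordinatewise) (rule continuous_on_id)

text \<open>Such \<open>p\<close> are the gauges of star bodies around the origin, like norms but
  without symmetry and the triangle inequality; the body itself is the set where \<open>p\<close> is
  at most 1.\<close>

definition gauge_fun :: "nat \<Rightarrow> ((nat \<Rightarrow> real) \<Rightarrow> real) \<Rightarrow> bool" where
  "gauge_fun n p \<longleftrightarrow> continuous_on (Rn n) p \<and> (\<forall>x\<in>Rn n. 0 \<le> p x \<and> (p x = 0 \<longrightarrow> x = (\<lambda>_. 0))) \<and>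
     (\<forall>x\<in>Rn n. \<forall>r\<ge>0. p (\<lambda>i. r * x i) = r * p x)"

text \<open>Rescaling \<open>x\<close> along its ray to the Euclidean length \<open>p x\<close>
  turns the star body of \<open>p\<close> into the disk and its boundary into the sphere. A
  continuous bijection is enough, as continuity of inverses later comes from compactness.\<close>

lemma gauge_fun_radial:
  assumes "gauge_fun n p"
  obtains \<Psi> where "continuous_on (Rn n) \<Psi>" "bij_betw \<Psi> (Rn n) (Rn n)"
    "\<And>x. x \<in> Rn n \<Longrightarrow> enorm n (\<Psi> x) = p x"
proof -
  define \<Psi> where "\<Psi> = (\<lambda>x i. p x / enorm n x * x i)"
  have pc: "continuous_on (Rn n) p" and p0: "\<And>x. x \<in> Rn n \<Longrightarrow> 0 \<le> p x"
    and pz: "\<And>x. x \<in> Rn n \<Longrightarrow> p x = 0 \<Longrightarrow> x = (\<lambda>_. 0)"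
    and ph: "\<And>x r. x \<in> Rn n \<Longrightarrow> 0 \<le> r \<Longrightarrow> p (\<lambda>i. r * x i) = r * p x"
    using assms unfolding gauge_fun_def by blast+
  have pzero: "p (\<lambda>_. 0) = 0" using ph[of "\<lambda>_. 0" 0] by (simp add: Rn_def)
  have en: "enorm n (\<Psi> x) = p x" if "x \<in> Rn n" for x
  proof -
    have "enorm n (\<Psi> x) = p x / enorm n x * enorm n x"
      unfolding \<Psi>_def using p0[OF that] by (intro enorm_scale) (auto simp: L2_set_nonneg)
    then show ?thesis using enorm_eq_0[OF that] pzero by (cases "enorm n x = 0") auto
  qed
  have vec: "\<Psi> x \<in> Rn n" if "x \<in> Rn n" for x using that by (auto simp: \<Psi>_def Rn_def)
  have cont: "continuous_on (Rn n) \<Psi>"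
  proof (rule continuous_on_coordinatewise_then_product)
    fix i
    show "continuous_on (Rn n) (\<lambda>x. \<Psi> x i)"
    proof (rule continuous_on_dominated[OF pc])
      have "continuous_on {x \<in> Rn n. p x \<noteq> 0} (\<lambda>x. p x / enorm n x * x i)"
      proof (intro continuous_on_mult continuous_on_divide continuous_on_coord ballI)
        show "enorm n x \<noteq> 0" if "x \<in> {x \<in> Rn n. p x \<noteq> 0}" for x
        proof
          assume "enorm n x = 0"
          then have "x = (\<lambda>_. 0)" using that enorm_eq_0 by simp
          then show False using that pzero by simp
        qed
      qed (auto intro!: continuous_on_enorm continuous_on_id continuous_on_subset[OF pc])
      then show "continuous_on {x \<in> Rn n. p x \<noteq> 0} (\<lambda>x. \<Psi> x i)" by (simp add: \<Psi>_def)
      show "\<bar>\<Psi> x i\<bar> \<le> p x" if "x \<in> Rn n" for x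
        using abs_le_enorm[OF vec[OF that]] en[OF that] by simp
    qed
  qed
  have inj: "inj_on \<Psi> (Rn n)"
  proof
    fix x y assume x: "x \<in> Rn n" and y: "y \<in> Rn n" and e: "\<Psi> x = \<Psi> y"
    have pe: "p x = p y" using en[OF x] en[OF y] e by simp
    show "x = y"
    proof (cases "p x = 0")
      case True
      then have "x = (\<lambda>_. 0)" "y = (\<lambda>_. 0)" using pz[OF x] pz[OF y] pe by simp_all
      then show ?thesis by simp
    next
      case False
      have nx: "enorm n x > 0" "enorm n y > 0"
        using False pe pzero by (auto intro!: enorm_pos[OF x] enorm_pos[OF y])
      have xy: "x i = enorm n x / enorm n y * y i" for i
        using fun_cong[OF e, of i] False pe nx unfolding \<Psi>_def by (simp add: field_simps)
      have "x = (\<lambda>i. enorm n x / enorm n y * y i)" using xy by blast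
      then have "p x = p (\<lambda>i. enorm n x / enorm n y * y i)" by (rule arg_cong)
      also have "\<dots> = enorm n x / enorm n y * p y"
        using nx by (intro ph[OF y]) simp
      finally have "p x = enorm n x / enorm n y * p y" .
      then have "enorm n x = enorm n y" using False pe nx by (simp add: field_simps)
      then have "x i = y i" for i using xy[of i] nx by simp
      then show ?thesis by blast
    qed
  qed
  have surj: "y \<in> \<Psi> ` Rn n" if y: "y \<in> Rn n" for y
  proof (cases "p y = 0")
    case True
    then have "y = (\<lambda>_. 0)" using pz y by blast
    then show ?thesis using y by (intro image_eqI[of _ _ "\<lambda>_. 0"]) (auto simp: \<Psi>_def Rn_def)
  next
    case False
    have ny: "enorm n y > 0" using False pzero by (auto intro!: enorm_pos[OF y])
    have py: "p y > 0" using False p0[OF y] by simp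
    \<comment> \<open>By homogeneity \<open>r * y\<close> is sent to a vector of length
      \<open>r * p y\<close> on the ray of \<open>y\<close>, and this length has to be
      \<open>enorm n y\<close>.\<close>
    define r where "r = enorm n y / p y"
    have r: "r > 0" using ny py by (simp add: r_def)
    have "\<Psi> (\<lambda>i. r * y i) = (\<lambda>i. r * p y / (r * enorm n y) * (r * y i))"
      unfolding \<Psi>_def using r by (simp only: ph[OF y] enorm_scale less_imp_le)
    also have "\<dots> = y" using ny py by (simp add: r_def)
    finally have "\<Psi> (\<lambda>i. r * y i) = y" .
    then show ?thesis using y by (intro image_eqI[of _ _ "\<lambda>i. r * y i"]) (auto simp: Rn_def)
  qed
  show ?thesis
  proof (rule that[of \<Psi>])
    show "bij_betw \<Psi> (Rn n) (Rn n)"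
      unfolding bij_betw_def
    proof (intro conjI inj equalityI subsetI)
      show "y \<in> Rn n" if "y \<in> \<Psi> ` Rn n" for y using that vec by blast
    qed (rule surj)
    show "continuous_on (Rn n) \<Psi>" by (rule cont)
    show "enorm n (\<Psi> x) = p x" if "x \<in> Rn n" for x by (rule en[OF that])
  qed
qed

lemma Rn_fun_upd: "x \<in> Rn (Suc n) \<Longrightarrow> x(n := 0) \<in> Rn n" "z \<in> Rn n \<Longrightarrow> z(n := u) \<in> Rn (Suc n)"
  by (auto simp: Rn_def)

lemma enorm_fun_upd [simp]: "enorm n (x(n := u)) = enorm n x"
  by (simp add: L2_set_def)

lemma continuous_on_fun_upd [continuous_intros]:
  fixes f :: "'b::topological_space \<Rightarrow> 'i \<Rightarrow> 'c::topological_space"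
  assumes "continuous_on S f" "continuous_on S g"
  shows "continuous_on S (\<lambda>x. (f x)(j := g x))"
proof (rule continuous_on_coordinatewise_then_product)
  fix i show "continuous_on S (\<lambda>x. ((f x)(j := g x)) i)"
    using assms continuous_on_product_then_coordinatewise[OF assms(1), of i] by (cases "i = j") auto
qed

definition subgraph :: "'a set \<Rightarrow> ('a \<Rightarrow> real) \<Rightarrow> ('a \<times> real) set" where
  "subgraph D h = {(z, f). z \<in> D \<and> 0 \<le> f \<and> f \<le> h z}"

text \<open>Only the zero set of \<open>h\<close> matters: \<open>h\<close> may be replaced by a function \<open>ht\<close> with the same zeros that is affine
  on radii. The region between \<open>- ht\<close> and \<open>ht\<close> is a star body, and its gauge \<open>p\<close> maps it radially to the disk.\<close>

lemma subgraph_disk: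
  assumes hc: "continuous_on (disk n) h" and h0: "\<And>z. z \<in> disk n \<Longrightarrow> 0 \<le> h z"
    and hpos: "\<And>z. z \<in> disk n - bdisk n \<Longrightarrow> 0 < h z"
  obtains \<Psi> where "continuous_on (subgraph (disk n) h) \<Psi>"
    "bij_betw \<Psi> (subgraph (disk n) h) (disk (Suc n))"
    "\<And>z f. (z, f) \<in> subgraph (disk n) h \<Longrightarrow>
       \<Psi> (z, f) \<in> bdisk (Suc n) \<longleftrightarrow> z \<in> bdisk n \<or> f = 0 \<or> f = h z"
proof -
  \<comment> \<open>The values of \<open>h\<close> on the unit sphere, cut off at 1 and extended
    linearly to the rays. The cut-off bounds \<open>m\<close> by \<open>enorm n\<close>, which gives
    continuity at the origin.\<close>
  define m where "m z = enorm n z * min 1 (h (\<lambda>i. inverse (enorm n z) * z i))" for z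
  have unit: "(\<lambda>i. inverse (enorm n z) * z i) \<in> disk n" if "z \<in> Rn n" "enorm n z \<noteq> 0" for z
    using that by (auto simp: disk_eq Rn_def enorm_scale L2_set_nonneg)
  have m_bd: "0 \<le> m z" "m z \<le> enorm n z" if "z \<in> Rn n" for z
  proof -
    show "0 \<le> m z" unfolding m_def using h0[OF unit[OF that]]
      by (cases "enorm n z = 0") (auto intro!: mult_nonneg_nonneg simp: L2_set_nonneg)
    show "m z \<le> enorm n z" unfolding m_def
      by (intro mult_left_le) (auto simp: L2_set_nonneg)
  qed
  have m_c: "continuous_on (Rn n) m"
  proof (rule continuous_on_dominated)
    show "continuous_on (Rn n) (enorm n)"
      by (intro continuous_on_enorm continuous_on_id)
    show "\<bar>m z\<bar> \<le> enorm n z" if "z \<in> Rn n" for z using m_bd[OF that] by simp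
    let ?S = "{z \<in> Rn n. enorm n z \<noteq> 0}"
    have e: "continuous_on ?S (enorm n)"
      by (intro continuous_on_enorm continuous_on_id)
    have "continuous_on ?S (\<lambda>z i. inverse (enorm n z) * z i)"
      by (intro continuous_on_coordinatewise_then_product continuous_on_mult continuous_on_coord
          continuous_on_inverse e) auto
    then have "continuous_on ?S (\<lambda>z. h (\<lambda>i. inverse (enorm n z) * z i))"
      by (rule continuous_on_compose2[OF hc]) (use unit in auto)
    then show "continuous_on ?S m"
      unfolding m_def by (intro continuous_on_mult e continuous_on_min continuous_on_const)
  qed
  have m_h: "m (\<lambda>i. r * z i) = r * m z" if "0 \<le> r" for r z
  proof (cases "r = 0")
    case True then show ?thesis by (simp add: m_def L2_set_def)
  next
    case False
    then have "(\<lambda>i. inverse (r * enorm n z) * (r * z i)) = (\<lambda>i. inverse (enorm n z) * z i)"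
      by (auto simp: field_simps)
    then show ?thesis using that by (simp add: m_def enorm_scale)
  qed
  \<comment> \<open>On each radius this runs linearly from 1 at the centre to the value of
    \<open>m\<close> on the sphere. So it can vanish only on the sphere, and there exactly where
    \<open>h\<close> does.\<close>
  define ht where "ht z = 1 - enorm n z + m z" for z
  have ht_c: "continuous_on (disk n) ht"
    unfolding ht_def
    by (intro continuous_on_add continuous_on_diff continuous_on_const continuous_on_enorm
        continuous_on_id continuous_on_subset[OF m_c]) (auto simp: disk_eq)
  have ht0: "0 \<le> ht z" if "z \<in> disk n" for z using that m_bd[of z] by (auto simp: ht_def disk_eq)
  have ht_h: "ht z = 0 \<longleftrightarrow> h z = 0" if z: "z \<in> disk n" for z
  proof (cases "z \<in> bdisk n")
    case True
    then have "enorm n z = 1" by (simp add: bdisk_eq)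
    then have "ht z = min 1 (h z)" by (simp add: ht_def m_def)
    then show ?thesis by auto
  next
    case False
    then have "enorm n z < 1" using z by (auto simp: bdisk_eq disk_eq)
    then have "ht z > 0" using m_bd[of z] z by (simp add: ht_def disk_eq)
    then show ?thesis using hpos[of z] z False by auto
  qed
  \<comment> \<open>With this \<open>ht\<close>, the condition that the last coordinate is at most
    \<open>ht\<close> in absolute value says that the second argument of the maximum is at most 1,
    and that argument is homogeneous. Together with \<open>enorm n x \<le> 1\<close> this makes the
    maximum the gauge of the body.\<close>
  define p where "p x = max (enorm n x) (\<bar>x n\<bar> + (enorm n x - m (x(n := 0))))" for x
  have p: "gauge_fun (Suc n) p"
    unfolding gauge_fun_def
  proof (intro conjI ballI allI impI)
    have "continuous_on (Rn (Suc n)) (\<lambda>x. m (x(n := 0)))"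
      by (rule continuous_on_compose2[OF m_c])
        (auto intro!: continuous_on_fun_upd continuous_on_id continuous_on_const Rn_fun_upd)
    then show "continuous_on (Rn (Suc n)) p"
      unfolding p_def
      by (intro continuous_on_max continuous_on_add continuous_on_diff continuous_on_enorm
          continuous_on_id continuous_on_rabs continuous_on_coord)
    fix x assume x: "x \<in> Rn (Suc n)"
    show "0 \<le> p x" by (simp add: p_def L2_set_nonneg le_max_iff_disj)
    show "x = (\<lambda>_. 0)" if "p x = 0"
    proof -
      have e: "enorm n x = 0" using that L2_set_nonneg[of x "{..<n}"] unfolding p_def by linarith
      have "x(n := 0) = (\<lambda>_. 0)"
        using enorm_eq_0[OF Rn_fun_upd(1)[OF x]] e by simp
      then have "x i = 0" if "i \<noteq> n" for i using that by (metis fun_upd_other)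
      moreover have "m (x(n:=0)) = 0" by (simp add: m_def e)
      then have "x n = 0" using that e by (simp add: p_def)
      ultimately have "x i = 0" for i by (cases "i = n") auto
      then show ?thesis by blast
    qed
    fix r :: real assume r: "0 \<le> r"
    have "(\<lambda>i. r * x i)(n := 0) = (\<lambda>i. r * (x(n := 0)) i)" by auto
    then have "m ((\<lambda>i. r * x i)(n := 0)) = m (\<lambda>i. r * (x(n := 0)) i)" by (rule arg_cong)
    also have "\<dots> = r * m (x(n := 0))" by (rule m_h[OF r])
    finally have "m ((\<lambda>i. r * x i)(n := 0)) = r * m (x(n := 0))" .
    then have "p (\<lambda>i. r * x i) = max (r * enorm n x) (r * (\<bar>x n\<bar> + (enorm n x - m (x(n := 0)))))"
      using r by (simp add: p_def enorm_scale abs_mult algebra_simps)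
    then show "p (\<lambda>i. r * x i) = r * p x"
      using r by (simp add: p_def max_mult_distrib_left)
  qed
  obtain \<Phi> where \<Phi>: "continuous_on (Rn (Suc n)) \<Phi>" "bij_betw \<Phi> (Rn (Suc n)) (Rn (Suc n))"
    "\<And>x. x \<in> Rn (Suc n) \<Longrightarrow> enorm (Suc n) (\<Phi> x) = p x"
    using gauge_fun_radial[OF p] by blast
  let ?SG = "subgraph (disk n) h"
  \<comment> \<open>Stretches the fibre from 0 to \<open>h z\<close> affinely to the one from
    \<open>- ht z\<close> to \<open>ht z\<close>. Where \<open>h z = 0\<close>, both are single
    points and the fraction has the value 0.\<close>
  define u where "u = (\<lambda>(z, f). (2 * f - h z) / h z * ht z)"
  define q where "q = (\<lambda>w. (fst w)(n := u w))"
  have SGD: "fst w \<in> disk n" "0 \<le> snd w" "snd w \<le> h (fst w)" "fst w \<in> Rn n" "fst w n = 0"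
    if "w \<in> ?SG" for w
    using that by (auto simp: subgraph_def disk_eq Rn_def)
  have u_bd: "\<bar>u w\<bar> \<le> ht (fst w)" if w: "w \<in> ?SG" for w
  proof -
    have "\<bar>(2 * snd w - h (fst w)) / h (fst w)\<bar> \<le> 1"
      using SGD(2,3)[OF w] by (auto simp: divide_le_eq_1 abs_le_iff)
    then have "\<bar>(2 * snd w - h (fst w)) / h (fst w)\<bar> * ht (fst w) \<le> 1 * ht (fst w)"
      using ht0[OF SGD(1)[OF w]] by (rule mult_right_mono)
    moreover have "\<bar>u w\<bar> = \<bar>(2 * snd w - h (fst w)) / h (fst w)\<bar> * ht (fst w)"
      using ht0[OF SGD(1)[OF w]] by (simp only: u_def split_beta abs_mult abs_of_nonneg)
    ultimately show ?thesis by simp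
  qed
  have u_c: "continuous_on ?SG u"
  proof (rule continuous_on_dominated)
    have fst: "continuous_on T (\<lambda>w. h (fst w))" "continuous_on T (\<lambda>w. ht (fst w))" if "T \<subseteq> ?SG" for T
      using that SGD(1) by (auto intro!: continuous_on_compose2[OF hc] continuous_on_compose2[OF ht_c]
            continuous_on_fst continuous_on_id)
    show "continuous_on ?SG (\<lambda>w. ht (fst w))" by (rule fst) simp
    show "\<bar>u w\<bar> \<le> ht (fst w)" if "w \<in> ?SG" for w using that by (rule u_bd)
    show "continuous_on {w \<in> ?SG. ht (fst w) \<noteq> 0} u"
      unfolding u_def split_beta
      using ht_h SGD(1)
      by (intro continuous_on_mult continuous_on_divide continuous_on_diff continuous_on_const
          continuous_on_snd continuous_on_id fst) auto
  qed
  have q_R: "q w \<in> Rn (Suc n)" if "w \<in> ?SG" for w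
    using SGD[OF that] by (auto simp: q_def intro: Rn_fun_upd)
  have q_c: "continuous_on ?SG q"
    unfolding q_def by (intro continuous_on_fun_upd u_c continuous_on_fst continuous_on_id)
  have pq: "p (q w) = max (enorm n (fst w)) (\<bar>u w\<bar> + 1 - ht (fst w))" if "w \<in> ?SG" for w
    using SGD(5)[OF that] by (simp add: p_def q_def ht_def fun_upd_idem)
  have q_inj: "inj_on q ?SG"
  proof
    fix v w assume v: "v \<in> ?SG" and w: "w \<in> ?SG" and e: "q v = q w"
    have "fst v i = fst w i" for i
      using fun_cong[OF e, of i] SGD(5)[OF v] SGD(5)[OF w] by (cases "i = n") (auto simp: q_def)
    then have f: "fst v = fst w" by blast
    have ue: "u v = u w" using fun_cong[OF e, of n] by (simp add: q_def)
    have "snd v = snd w"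
    proof (cases "h (fst w) = 0")
      case True then show ?thesis using SGD[OF v] SGD[OF w] f by simp
    next
      case False
      then have "ht (fst w) \<noteq> 0" using ht_h SGD(1)[OF w] by blast
      then show ?thesis using ue f False by (simp add: u_def split_beta)
    qed
    then show "v = w" using f by (simp add: prod_eq_iff)
  qed
  have q_surj: "x \<in> q ` ?SG" if x: "x \<in> Rn (Suc n)" "p x \<le> 1" for x
  proof -
    define z where "z = x(n := 0)"
    have zR: "z \<in> Rn n" using Rn_fun_upd(1)[OF x(1)] by (simp add: z_def)
    have z: "z \<in> disk n" using x zR by (simp add: disk_eq p_def z_def)
    have b: "\<bar>x n\<bar> \<le> ht z" using x(2) by (simp add: ht_def p_def z_def)
    define f where "f = h z * (1 + x n / ht z) / 2"
    have "\<bar>x n / ht z\<bar> \<le> 1" using b by (auto simp: divide_le_eq_1)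
    then have "0 \<le> 1 + x n / ht z" "1 + x n / ht z \<le> 2" unfolding abs_le_iff by linarith+
    then have f: "0 \<le> f" "f \<le> h z" unfolding f_def
      using h0[OF z] mult_left_mono[of "1 + x n / ht z" 2 "h z"] by auto
    have "u (z, f) = x n"
    proof (cases "h z = 0")
      case True then show ?thesis using b ht_h[OF z] by (simp add: u_def)
    next
      case False
      then have "ht z \<noteq> 0" using ht_h[OF z] by simp
      then show ?thesis using False by (simp add: u_def f_def field_simps)
    qed
    then have "q (z, f) = x" by (auto simp: q_def z_def)
    then show ?thesis using f z by (intro image_eqI[of _ _ "(z, f)"]) (auto simp: subgraph_def)
  qed
  have q_le: "p (q w) \<le> 1" if "w \<in> ?SG" for w
    using u_bd[OF that] SGD(1)[OF that] by (simp add: pq[OF that] disk_eq)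
  have q_bij: "bij_betw q ?SG {x \<in> Rn (Suc n). p x \<le> 1}"
    unfolding bij_betw_def using q_inj q_surj q_le q_R by auto
  have \<Phi>_bij: "bij_betw \<Phi> {x \<in> Rn (Suc n). p x \<le> 1} (disk (Suc n))"
    unfolding bij_betw_def
  proof (intro conjI equalityI subsetI)
    show "inj_on \<Phi> {x \<in> Rn (Suc n). p x \<le> 1}"
      using \<Phi>(2) by (auto simp: bij_betw_def intro: inj_on_subset)
    show "y \<in> disk (Suc n)" if "y \<in> \<Phi> ` {x \<in> Rn (Suc n). p x \<le> 1}" for y
      using that \<Phi>(2,3) by (auto simp: disk_eq bij_betw_def)
    fix y assume y: "y \<in> disk (Suc n)"
    then obtain x where "x \<in> Rn (Suc n)" "y = \<Phi> x" using \<Phi>(2) by (auto simp: disk_eq bij_betw_def)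
    then show "y \<in> \<Phi> ` {x \<in> Rn (Suc n). p x \<le> 1}" using y \<Phi>(3) by (auto simp: disk_eq)
  qed
  show ?thesis
  proof (rule that[of "\<Phi> \<circ> q"])
    show "continuous_on ?SG (\<Phi> \<circ> q)"
      by (rule continuous_on_compose[OF q_c continuous_on_subset[OF \<Phi>(1)]]) (use q_R in auto)
    show "bij_betw (\<Phi> \<circ> q) ?SG (disk (Suc n))" by (rule bij_betw_trans[OF q_bij \<Phi>_bij])
    fix z f assume zf: "(z, f) \<in> ?SG"
    have "\<Phi> (q (z, f)) \<in> Rn (Suc n)" using \<Phi>(2) q_R[OF zf] by (auto simp: bij_betw_def)
    then have "(\<Phi> \<circ> q) (z, f) \<in> bdisk (Suc n) \<longleftrightarrow> p (q (z, f)) = 1"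
      using \<Phi>(3)[OF q_R[OF zf]] by (simp add: bdisk_eq)
    also have "\<dots> \<longleftrightarrow> enorm n z = 1 \<or> \<bar>u (z, f)\<bar> = ht z"
      using u_bd[OF zf] SGD(1)[OF zf] by (auto simp: pq[OF zf] disk_eq max_def)
    also have "\<bar>u (z, f)\<bar> = ht z \<longleftrightarrow> f = 0 \<or> f = h z"
    proof (cases "h z = 0")
      case True
      then show ?thesis using SGD[OF zf] ht_h[of z] by (simp add: u_def)
    next
      case False
      then have hz: "h z > 0" "ht z > 0" using ht_h[of z] ht0[of z] h0[of z] SGD(1)[OF zf] by force+
      have "\<bar>u (z, f)\<bar> = \<bar>2 * f - h z\<bar> / h z * ht z"
        using hz by (simp add: u_def abs_mult)
      moreover have "a / b * c = c \<longleftrightarrow> a = b" if "0 < b" "0 < c" for a b c :: real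
        using that by (simp add: field_simps)
      ultimately have "\<bar>u (z, f)\<bar> = ht z \<longleftrightarrow> \<bar>2 * f - h z\<bar> = h z" using hz by simp
      then show ?thesis using SGD[OF zf] by auto
    qed
    also have "enorm n z = 1 \<longleftrightarrow> z \<in> bdisk n" using SGD[OF zf] by (simp add: bdisk_eq)
    finally show "(\<Phi> \<circ> q) (z, f) \<in> bdisk (Suc n) \<longleftrightarrow> z \<in> bdisk n \<or> f = 0 \<or> f = h z" .
  qed
qed

section \<open>Disks as quotients of compact sets\<close>

text \<open>A continuous map from a compact space to a Hausdorff space is a quotient map onto its
  image, so whatever is constant on its fibres factors through it continuously.\<close>

lemma compact_continuous_factor:
  fixes f :: "'a::topological_space \<Rightarrow> 'b::t2_space" and g :: "'a \<Rightarrow> 'c::topological_space"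
  assumes S: "compact S" and f: "continuous_on S f" and g: "continuous_on S g"
    and eq: "\<And>x y. x \<in> S \<Longrightarrow> y \<in> S \<Longrightarrow> f x = f y \<Longrightarrow> g x = g y"
  obtains h where "continuous_on (f ` S) h" "\<And>x. x \<in> S \<Longrightarrow> h (f x) = g x"
proof -
  define h where "h z = g (SOME x. x \<in> S \<and> f x = z)" for z
  have h: "h (f x) = g x" if "x \<in> S" for x
  proof -
    have "\<exists>y. y \<in> S \<and> f y = f x" using that by blast
    from someI_ex[OF this] show ?thesis unfolding h_def by (intro eq that) auto
  qed
  have "continuous_on (f ` S) h"
    unfolding continuous_on_closed_invariant
  proof (intro allI impI)
    fix B :: "'c set" assume B: "closed B"
    then obtain C where C: "closed C" "C \<inter> S = g -` B \<inter> S"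
      using g unfolding continuous_on_closed_invariant by blast
    have "compact (f ` (C \<inter> S))"
      using C(1) S by (intro compact_continuous_image continuous_on_subset[OF f]) auto
    then have "closed (f ` (C \<inter> S))" by (rule compact_imp_closed)
    moreover have "f ` (C \<inter> S) \<inter> f ` S = h -` B \<inter> f ` S" unfolding C(2) using h by auto
    ultimately show "\<exists>A. closed A \<and> A \<inter> f ` S = h -` B \<inter> f ` S" by blast
  qed
  with h show ?thesis by (rule that[rotated])
qed

text \<open>Adds one dimension to a disk that is known only as a quotient. \<open>\<Theta>\<close>
  presents the disk as a quotient of \<open>S0\<close>, and \<open>A\<close> together with
  \<open>f\<close> maps \<open>S\<close> onto the region under \<open>h\<close>. As \<open>h\<close>
  is constant on the fibres of \<open>\<Theta>\<close>, it descends to the disk, and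
  \<open>subgraph_disk\<close> turns the region under it into a disk again. The conclusions record
  the fibres and the boundary, from which the next step of an induction can continue.\<close>

lemma thicken_disk:
  fixes \<Theta> :: "'a::topological_space \<Rightarrow> nat \<Rightarrow> real" and A :: "'b::topological_space \<Rightarrow> 'a"
  assumes "compact S0" and \<Theta>: "continuous_on S0 \<Theta>" "\<Theta> ` S0 = disk n"
    and A: "continuous_on S A" and f: "continuous_on S f" and h: "continuous_on S0 h"
    and h_fib: "\<And>p q. p \<in> S0 \<Longrightarrow> q \<in> S0 \<Longrightarrow> \<Theta> p = \<Theta> q \<Longrightarrow> h p = h q"
    and h_pos: "\<And>p. p \<in> S0 \<Longrightarrow> \<Theta> p \<notin> bdisk n \<Longrightarrow> 0 < h p"
    and img: "(\<lambda>s. (A s, f s)) ` S = subgraph S0 h"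
    and h_nonneg: "\<And>p. p \<in> S0 \<Longrightarrow> 0 \<le> h p"
  obtains \<Theta>' where "continuous_on S \<Theta>'" "\<Theta>' ` S = disk (Suc n)"
    "\<And>s t. s \<in> S \<Longrightarrow> t \<in> S \<Longrightarrow> \<Theta>' s = \<Theta>' t \<longleftrightarrow> \<Theta> (A s) = \<Theta> (A t) \<and> f s = f t"
    "\<And>s. s \<in> S \<Longrightarrow> \<Theta>' s \<in> bdisk (Suc n) \<longleftrightarrow> \<Theta> (A s) \<in> bdisk n \<or> f s = 0 \<or> f s = h (A s)"
proof -
  obtain k where k: "continuous_on (\<Theta> ` S0) k" "\<And>p. p \<in> S0 \<Longrightarrow> k (\<Theta> p) = h p"
    using compact_continuous_factor[OF assms(1) \<Theta>(1) h h_fib] by blast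
  have k0: "0 \<le> k z" if "z \<in> disk n" for z
    using that k(2) h_nonneg unfolding \<Theta>(2)[symmetric] by auto
  have kpos: "0 < k z" if "z \<in> disk n - bdisk n" for z
    using that k(2) h_pos unfolding \<Theta>(2)[symmetric] by auto
  obtain \<Psi> where \<Psi>: "continuous_on (subgraph (disk n) k) \<Psi>"
    "bij_betw \<Psi> (subgraph (disk n) k) (disk (Suc n))"
    "\<And>z f. (z, f) \<in> subgraph (disk n) k \<Longrightarrow>
       \<Psi> (z, f) \<in> bdisk (Suc n) \<longleftrightarrow> z \<in> bdisk n \<or> f = 0 \<or> f = k z"
    using subgraph_disk[OF k(1)[unfolded \<Theta>(2)] k0 kpos] by metis
  have As: "A s \<in> S0" "0 \<le> f s" "f s \<le> h (A s)" if "s \<in> S" for s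
    using imageI[OF that, of "\<lambda>s. (A s, f s)"] unfolding img by (auto simp: subgraph_def)
  let ?B = "\<lambda>s. (\<Theta> (A s), f s)"
  have sub: "?B s \<in> subgraph (disk n) k" if "s \<in> S" for s
    using As[OF that] \<Theta>(2) k(2) by (auto simp: subgraph_def)
  have B_img: "?B ` S = subgraph (disk n) k"
  proof (intro equalityI subsetI)
    fix w assume w: "w \<in> subgraph (disk n) k"
    then have "fst w \<in> \<Theta> ` S0" using \<Theta>(2) by (auto simp: subgraph_def)
    then obtain p where p: "p \<in> S0" "fst w = \<Theta> p" by blast
    then have "(p, snd w) \<in> (\<lambda>s. (A s, f s)) ` S" using w k(2) unfolding img by (auto simp: subgraph_def)
    then show "w \<in> ?B ` S" using p(2) by (force simp: prod_eq_iff)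
  qed (use sub in auto)
  have B_c: "continuous_on S ?B"
    using As by (intro continuous_on_Pair f continuous_on_compose2[OF \<Theta>(1) A]) auto
  show ?thesis
  proof (rule that[of "\<lambda>s. \<Psi> (?B s)"])
    show "continuous_on S (\<lambda>s. \<Psi> (?B s))"
      by (rule continuous_on_compose2[OF \<Psi>(1) B_c]) (use sub in auto)
    have "(\<lambda>s. \<Psi> (?B s)) ` S = \<Psi> ` (?B ` S)" by auto
    then show "(\<lambda>s. \<Psi> (?B s)) ` S = disk (Suc n)"
      unfolding B_img using \<Psi>(2) by (simp add: bij_betw_def)
    show "\<Psi> (?B s) = \<Psi> (?B t) \<longleftrightarrow> \<Theta> (A s) = \<Theta> (A t) \<and> f s = f t" if "s \<in> S" "t \<in> S" for s t
      using inj_on_eq_iff[OF bij_betw_imp_inj_on[OF \<Psi>(2)] sub[OF that(1)] sub[OF that(2)]] by simp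
    show "\<Psi> (?B s) \<in> bdisk (Suc n) \<longleftrightarrow> \<Theta> (A s) \<in> bdisk n \<or> f s = 0 \<or> f s = h (A s)" if "s \<in> S" for s
      using \<Psi>(3)[OF sub[OF that]] k(2)[OF As(1)[OF that]] by simp
  qed
qed

lemma compact_box: "compact {x :: 'i \<Rightarrow> real. \<forall>i. x i \<in> {0..1}}"
proof -
  have "compactin (product_topology (\<lambda>_::'i. euclidean) UNIV) (Pi\<^sub>E UNIV (\<lambda>_. {0..1::real}))"
    unfolding compactin_PiE by simp
  moreover have "Pi\<^sub>E UNIV (\<lambda>_::'i. {0..1::real}) = {x. \<forall>i. x i \<in> {0..1}}" by auto
  ultimately show ?thesis by (simp add: euclidean_product_topology)
qed

text \<open>A closed simplex with vertices \<open>\<sigma>\<close> and an apex. The mass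
  \<open>T\<close> of the apex is kept apart from \<open>y\<close>, so that the apex has no number
  and \<open>F i\<close> acts on \<open>y\<close> alone.\<close>

definition cone_simplex :: "'v set \<Rightarrow> (real \<times> ('v \<Rightarrow> real)) set" where
  "cone_simplex \<sigma> = {(T, y). 0 \<le> T \<and> (\<forall>v. 0 \<le> y v) \<and> (\<forall>v. v \<notin> \<sigma> \<longrightarrow> y v = 0) \<and> T + sum y \<sigma> = 1}"

lemma compact_cone_simplex:
  fixes \<sigma> :: "'v set"
  assumes "finite \<sigma>"
  shows "compact (cone_simplex \<sigma>)"
proof -
  let ?box = "{0..1::real} \<times> {x :: 'v \<Rightarrow> real. \<forall>i. x i \<in> {0..1}}"
  have box: "compact ?box" by (intro compact_Times compact_box) simp
  have c: "continuous_on UNIV (\<lambda>p::real \<times> ('v \<Rightarrow> real). snd p v)" for v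
    by (rule continuous_on_product_then_coordinatewise) (intro continuous_on_snd continuous_on_id)
  have f: "continuous_on UNIV (\<lambda>p::real \<times> ('v \<Rightarrow> real). fst p)"
    by (intro continuous_on_fst continuous_on_id)
  have 1: "closed {p::real \<times> ('v \<Rightarrow> real). 0 \<le> fst p}" "closed {p::real \<times> ('v \<Rightarrow> real). fst p + sum (snd p) \<sigma> = 1}"
    by (intro closed_Collect_le closed_Collect_eq continuous_on_add continuous_on_sum continuous_on_const c f)+
  have 2: "closed {p::real \<times> ('v \<Rightarrow> real). \<forall>v. 0 \<le> snd p v}"
    by (intro closed_Collect_all closed_Collect_le continuous_on_const c)
  have 3: "closed {p::real \<times> ('v \<Rightarrow> real). v \<notin> \<sigma> \<longrightarrow> snd p v = 0}" for v
    by (cases "v \<in> \<sigma>") (auto intro!: closed_Collect_eq continuous_on_const c)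
  have "closed {p::real \<times> ('v \<Rightarrow> real). 0 \<le> fst p \<and> (\<forall>v. 0 \<le> snd p v) \<and> (\<forall>v. v \<notin> \<sigma> \<longrightarrow> snd p v = 0) \<and>
      fst p + sum (snd p) \<sigma> = 1}"
    by (intro closed_Collect_conj closed_Collect_all 1 2 3)
  moreover have "cone_simplex \<sigma> = {p. 0 \<le> fst p \<and> (\<forall>v. 0 \<le> snd p v) \<and> (\<forall>v. v \<notin> \<sigma> \<longrightarrow> snd p v = 0) \<and>
      fst p + sum (snd p) \<sigma> = 1}"
    by (auto simp: cone_simplex_def)
  ultimately have "closed (cone_simplex \<sigma>)" by simp
  moreover have "cone_simplex \<sigma> \<subseteq> ?box"
  proof
    fix p assume p: "p \<in> cone_simplex \<sigma>"
    then have s: "0 \<le> sum (snd p) \<sigma>" by (auto simp: cone_simplex_def intro: sum_nonneg)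
    have "snd p v \<le> 1" for v
    proof (cases "v \<in> \<sigma>")
      case True
      then have "snd p v \<le> sum (snd p) \<sigma>"
        using p assms by (intro member_le_sum) (auto simp: cone_simplex_def)
      then show ?thesis using p by (auto simp: cone_simplex_def)
    qed (use p in \<open>auto simp: cone_simplex_def\<close>)
    then show "p \<in> ?box" using p s by (auto simp: cone_simplex_def)
  qed
  ultimately have "?box \<inter> cone_simplex \<sigma> = cone_simplex \<sigma>" "closed (cone_simplex \<sigma>)" by blast+
  then show ?thesis using compact_Int_closed[OF box, of "cone_simplex \<sigma>"] by simp
qed

section \<open>Cells of the core\<close>

text \<open>Which points of one closed simplex get identified does not depend on the complex around
  it. So balls can be treated here for arbitrary finite sets of vertices, including those that are
  no simplices of the given complex.\<close>

locale peeling =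
  fixes crit :: "nat set" and \<alpha> :: "nat \<Rightarrow> nat"
  assumes \<alpha>_less: "i \<notin> crit \<Longrightarrow> \<alpha> i < i"
begin

definition push :: "nat \<Rightarrow> (nat \<Rightarrow> real) \<Rightarrow> nat \<Rightarrow> real" where
  "push i y = (y(i := 0))(\<alpha> i := y (\<alpha> i) + y i)"

text \<open>\<open>F i y\<close> processes the masses \<open>y\<close> from vertex \<open>i - 1\<close> downwards. At a critical vertex it records the vector
  \<open>y i * y\<close>, which vanishes if \<open>y i = 0\<close> and determines \<open>y\<close> (and hence all later records) otherwise. So the
  fibres of \<open>F\<close> are the identifications that define the core.\<close>

primrec F :: "nat \<Rightarrow> (nat \<Rightarrow> real) \<Rightarrow> nat \<Rightarrow> real" where
  "F 0 y = (\<lambda>_. 0)"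
| "F (Suc i) y = (\<lambda>k. if i \<in> crit
     then if fst (prod_decode k) = i then y i * y (snd (prod_decode k)) else F i (y(i := 0)) k
     else F i (push i y) k)"

lemma continuous_push: "continuous_on UNIV (push i)"
  unfolding push_def
  by (intro continuous_on_fun_upd continuous_on_add continuous_on_id continuous_on_const continuous_on_coord)

lemma continuous_F: "continuous_on UNIV (F i)"
proof (induction i)
  case (Suc i)
  show ?case
  proof (rule continuous_on_coordinatewise_then_product)
    fix k
    have 1: "continuous_on UNIV (\<lambda>y. F i (y(i := 0)))"
      by (rule continuous_on_compose2[OF Suc continuous_on_fun_upd[OF continuous_on_id continuous_on_const]]) simp
    have 2: "continuous_on UNIV (\<lambda>y. F i (push i y))"
      by (rule continuous_on_compose2[OF Suc continuous_push]) auto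
    show "continuous_on UNIV (\<lambda>y. F (Suc i) y k)"
      using continuous_on_product_then_coordinatewise[OF 1] continuous_on_product_then_coordinatewise[OF 2]
      by (cases "i \<in> crit"; cases "fst (prod_decode k) = i")
        (auto intro!: continuous_on_mult continuous_on_coord)
  qed
qed auto

text \<open>Coordinates come in blocks by their first index, and block \<open>i\<close> holds the
  record of vertex \<open>i\<close>. Lower stages leave it empty, so a record of zeros is the same
  as no record.\<close>

lemma F_eq_0: "i \<le> fst (prod_decode k) \<Longrightarrow> F i y k = 0"
  by (induction i arbitrary: y) auto

lemma push_idem: "y i = 0 \<Longrightarrow> push i y = y"
  by (auto simp: push_def)

lemma F_Suc_zero: "y i = 0 \<Longrightarrow> F (Suc i) y = F i y"
  by (auto simp: push_idem fun_eq_iff F_eq_0 fun_upd_idem)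

text \<open>The diagonal entry \<open>y i * y i\<close> of the record gives \<open>y i\<close>, and
  the other entries then give all of \<open>y\<close> unless \<open>y i\<close> is 0. This is the
  recursion for the fibres that the construction of balls follows.\<close>

lemma F_Suc_crit:
  assumes "i \<in> crit" "0 \<le> y i" "0 \<le> y' i"
  shows "F (Suc i) y = F (Suc i) y' \<longleftrightarrow>
    y i = y' i \<and> (0 < y i \<longrightarrow> y = y') \<and> (y i = 0 \<longrightarrow> F i y = F i y')" (is "?L \<longleftrightarrow> ?R")
proof
  assume L: ?L
  have rec: "y i * y j = y' i * y' j" for j
    using fun_cong[OF L, of "prod_encode (i, j)"] assms(1) by simp
  from rec[of i] have yi: "y i = y' i" using assms(2,3)
    by (metis power2_eq_square power2_eq_imp_eq)
  moreover have "y = y'" if "0 < y i"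
  proof
    fix j show "y j = y' j" using rec[of j] yi that by simp
  qed
  moreover have "F i y = F i y'" if "y i = 0" using L that yi F_Suc_zero by metis
  ultimately show ?R by blast
next
  assume ?R then show ?L using F_Suc_zero[of y i] F_Suc_zero[of y' i] assms(2)
    by (cases "y i = 0") auto
qed

lemma F_supported:
  assumes "\<And>v. j \<le> v \<Longrightarrow> y v = 0" "j \<le> i"
  shows "F i y = F j y"
  using assms(2)
proof (induction i rule: dec_induct)
  case (step i)
  then show ?case using F_Suc_zero[of y i] assms(1)[of i] by metis
qed (rule refl)

text \<open>The first component of a point of \<open>cone_simplex \<sigma>\<close> is the mass of an additional critical vertex on top of
  \<open>\<sigma>\<close>. Thus \<open>cell_ball\<close> says that the closed cell of the core given by this larger simplex is a ball.\<close>

definition cell_ball :: "nat \<Rightarrow> nat set \<Rightarrow> (real \<times> (nat \<Rightarrow> real) \<Rightarrow> nat \<Rightarrow> real) \<Rightarrow> bool" where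
  "cell_ball i \<sigma> \<Theta> \<longleftrightarrow> continuous_on (cone_simplex \<sigma>) \<Theta> \<and> \<Theta> ` cone_simplex \<sigma> = disk (card \<sigma>) \<and>
    (\<forall>p\<in>cone_simplex \<sigma>. \<Theta> p \<in> bdisk (card \<sigma>) \<longleftrightarrow> fst p = 0 \<or> (\<exists>v\<in>\<sigma>. snd p v = 0)) \<and>
    (\<forall>p\<in>cone_simplex \<sigma>. \<forall>q\<in>cone_simplex \<sigma>. \<Theta> p = \<Theta> q \<longleftrightarrow>
       fst p = fst q \<and> (0 < fst p \<longrightarrow> snd p = snd q) \<and> (fst p = 0 \<longrightarrow> F i (snd p) = F i (snd q)))"

lemma cell_ballD:
  assumes "cell_ball i \<sigma> \<Theta>"
  shows "continuous_on (cone_simplex \<sigma>) \<Theta>" "\<Theta> ` cone_simplex \<sigma> = disk (card \<sigma>)"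
    "\<And>p. p \<in> cone_simplex \<sigma> \<Longrightarrow>
      \<Theta> p \<in> bdisk (card \<sigma>) \<longleftrightarrow> fst p = 0 \<or> (\<exists>v\<in>\<sigma>. snd p v = 0)"
    "\<And>p q. p \<in> cone_simplex \<sigma> \<Longrightarrow> q \<in> cone_simplex \<sigma> \<Longrightarrow> \<Theta> p = \<Theta> q \<longleftrightarrow>
       fst p = fst q \<and> (0 < fst p \<longrightarrow> snd p = snd q) \<and> (fst p = 0 \<longrightarrow> F i (snd p) = F i (snd q))"
proof -
  note a = assms[unfolded cell_ball_def]
  note b = a[THEN conjunct2, THEN conjunct2]
  show "continuous_on (cone_simplex \<sigma>) \<Theta>" by (rule a[THEN conjunct1])
  show "\<Theta> ` cone_simplex \<sigma> = disk (card \<sigma>)" by (rule a[THEN conjunct2, THEN conjunct1])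
  show "\<Theta> p \<in> bdisk (card \<sigma>) \<longleftrightarrow> fst p = 0 \<or> (\<exists>v\<in>\<sigma>. snd p v = 0)" if "p \<in> cone_simplex \<sigma>" for p
    by (rule b[THEN conjunct1, rule_format, OF that])
  show "\<Theta> p = \<Theta> q \<longleftrightarrow>
       fst p = fst q \<and> (0 < fst p \<longrightarrow> snd p = snd q) \<and> (fst p = 0 \<longrightarrow> F i (snd p) = F i (snd q))"
    if "p \<in> cone_simplex \<sigma>" "q \<in> cone_simplex \<sigma>" for p q
    by (rule b[THEN conjunct2, rule_format, OF that])
qed

text \<open>Induction on \<open>i\<close>, where a top vertex \<open>i\<close> of
  \<open>\<sigma>\<close> adds one dimension to the ball of the smaller simplex. If \<open>i\<close>
  is critical, that ball is thickened by the ways of dividing a mass between the apex and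
  \<open>i\<close>. If \<open>i\<close> passes its mass on to a vertex of \<open>\<sigma>\<close>,
  it is thickened by the ways of dividing the mass found there after the push. If the receiver is
  not in \<open>\<sigma>\<close>, the push is a bijection onto a simplex of the same dimension with
  all vertices below \<open>i\<close>. Each case reproduces the recursion for the fibres of
  \<open>F\<close>.\<close>

lemma cell_ball_exists:
  assumes "finite \<sigma>" "\<sigma> \<subseteq> {..<i}"
  shows "\<exists>\<Theta>. cell_ball i \<sigma> \<Theta>"
  using assms
proof (induction i arbitrary: \<sigma>)
  case 0
  then have "\<sigma> = {}" by auto
  then have C: "cone_simplex \<sigma> = {(1, \<lambda>_. 0)}" by (auto simp: cone_simplex_def)
  have "disk 0 = {\<lambda>_. 0}" "bdisk 0 = {}" by (auto simp: disk_eq bdisk_eq Rn_def)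
  then show ?case unfolding cell_ball_def C using \<open>\<sigma> = {}\<close> by (intro exI[of _ "\<lambda>_ _. 0"]) auto
next
  case (Suc i)
  note fin = \<open>finite \<sigma>\<close>
  define C where "C = cone_simplex \<sigma>"
  define \<tau> where "\<tau> = \<sigma> - {i}"
  have \<tau>: "finite \<tau>" "\<tau> \<subseteq> {..<i}" "i \<notin> \<tau>" using Suc.prems by (auto simp: \<tau>_def less_Suc_eq)
  have Cp: "0 \<le> fst p" "0 \<le> snd p v" "v \<notin> \<sigma> \<Longrightarrow> snd p v = 0" "fst p + sum (snd p) \<sigma> = 1" if "p \<in> C" for p v
    using that by (auto simp: C_def cone_simplex_def)
  have memC: "p \<in> cone_simplex \<rho> \<longleftrightarrow> 0 \<le> fst p \<and> (\<forall>v. 0 \<le> snd p v) \<and> (\<forall>v. v \<notin> \<rho> \<longrightarrow> snd p v = 0) \<and> fst p + sum (snd p) \<rho> = 1" for p and \<rho> :: "nat set"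
    by (auto simp: cone_simplex_def)
  have cfst: "continuous_on T fst" and csnd: "continuous_on T snd" and cc: "continuous_on T (\<lambda>p. snd p v)"
    for T :: "(real \<times> (nat \<Rightarrow> real)) set" and v
    by (intro continuous_on_fst continuous_on_snd continuous_on_id)
      (intro continuous_on_snd continuous_on_id, rule continuous_on_product_then_coordinatewise, intro continuous_on_snd continuous_on_id)
  show ?case
  proof (cases "i \<in> \<sigma>")
    case False
    then have "\<sigma> \<subseteq> {..<i}" using Suc.prems by (auto simp: less_Suc_eq)
    then obtain \<Theta> where "cell_ball i \<sigma> \<Theta>" using Suc.IH[OF fin] \<open>\<sigma> \<subseteq> {..<i}\<close> by blast
    note \<Theta> = cell_ballD[OF this, folded C_def]
    have "F (Suc i) (snd p) = F i (snd p)" if "p \<in> C" for p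
      by (rule F_Suc_zero) (rule Cp(3)[OF that False])
    then show ?thesis unfolding cell_ball_def C_def[symmetric]
      by (intro exI[of _ \<Theta>] conjI \<Theta>(1,2) ballI) (simp_all only: \<Theta>(3,4))
  next
    case True
    have \<sigma>: "\<sigma> = insert i \<tau>" using True by (auto simp: \<tau>_def)
    have card: "card \<sigma> = Suc (card \<tau>)" unfolding \<sigma> using \<tau> by simp
    have sum\<sigma>: "sum y \<sigma> = y i + sum y \<tau>" for y :: "nat \<Rightarrow> real" unfolding \<sigma> using \<tau> by simp
    have sum_upd: "(\<Sum>x\<in>\<tau>. if x = i then c else y x) = sum y \<tau>" for y and c :: real
      using \<tau>(3) by (intro sum.cong) auto
    define D where "D = cone_simplex \<tau>"
    have Dcomp: "compact D" unfolding D_def by (rule compact_cone_simplex) (rule \<tau>)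
    obtain \<Theta> where "cell_ball i \<tau> \<Theta>" using Suc.IH[OF \<tau>(1,2)] by blast
    note \<Theta> = cell_ballD[OF this, folded D_def]
    have Dp: "0 \<le> fst p" "0 \<le> snd p v" "v \<notin> \<tau> \<Longrightarrow> snd p v = 0" "fst p + sum (snd p) \<tau> = 1" if "p \<in> D" for p v
      using that by (auto simp: D_def cone_simplex_def)
    show ?thesis
    proof (cases "i \<in> crit")
      case crit: True
      \<comment> \<open>Positive mass of the apex or of the critical vertex \<open>i\<close> forbids
        identifications. So what matters below \<open>i\<close> is the sum of both masses, and
        \<open>fst p\<close> tells how the sum is divided.\<close>
      define A where "A = (\<lambda>p::real \<times> (nat \<Rightarrow> real). (fst p + snd p i, (snd p)(i := 0)))"
      have AD: "A p \<in> D" if "p \<in> C" for p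
        unfolding D_def memC using Cp[OF that] \<tau>
        by (auto simp: A_def sum\<sigma> \<sigma> sum_upd intro!: add_nonneg_nonneg)
      have img: "(\<lambda>p. (A p, fst p)) ` C = subgraph D fst"
      proof (intro equalityI subsetI)
        fix w assume "w \<in> (\<lambda>p. (A p, fst p)) ` C"
        then show "w \<in> subgraph D fst" using AD Cp by (auto simp: subgraph_def A_def)
      next
        fix w assume "w \<in> subgraph D fst"
        then obtain p f where w: "w = (p, f)" "p \<in> D" "0 \<le> f" "f \<le> fst p" by (auto simp: subgraph_def)
        define p' where "p' = (f, (snd p)(i := fst p - f))"
        have "p' \<in> C" unfolding C_def memC using Dp[OF w(2)] w \<tau>
          by (auto simp: p'_def sum\<sigma> \<sigma> sum_upd)
        moreover have "(A p', fst p') = w" using w Dp(3)[OF w(2) \<tau>(3)]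
          by (auto simp: A_def p'_def prod_eq_iff fun_upd_idem)
        ultimately show "w \<in> (\<lambda>p. (A p, fst p)) ` C" by blast
      qed
      have Ac: "continuous_on C A" unfolding A_def
        by (intro continuous_on_Pair continuous_on_add continuous_on_fun_upd cfst csnd cc continuous_on_const)
      obtain \<Theta>' where \<Theta>': "continuous_on C \<Theta>'" "\<Theta>' ` C = disk (Suc (card \<tau>))"
        "\<And>s t. s \<in> C \<Longrightarrow> t \<in> C \<Longrightarrow> \<Theta>' s = \<Theta>' t \<longleftrightarrow> \<Theta> (A s) = \<Theta> (A t) \<and> fst s = fst t"
        "\<And>s. s \<in> C \<Longrightarrow> \<Theta>' s \<in> bdisk (Suc (card \<tau>)) \<longleftrightarrow> \<Theta> (A s) \<in> bdisk (card \<tau>) \<or> fst s = 0 \<or> fst s = fst (A s)"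
      proof (rule thicken_disk[OF Dcomp \<Theta>(1,2) Ac cfst cfst _ _ img])
        show "fst p = fst q" if "p \<in> D" "q \<in> D" "\<Theta> p = \<Theta> q" for p q using that \<Theta>(4) by blast
        show "0 < fst p" if "p \<in> D" "\<Theta> p \<notin> bdisk (card \<tau>)" for p
          using that \<Theta>(3) Dp(1)[OF that(1)] by (metis less_eq_real_def)
      qed (use Dp in auto)
      show ?thesis unfolding cell_ball_def C_def[symmetric] card
      proof (intro exI[of _ \<Theta>'] conjI \<Theta>'(1,2) ballI)
        fix p assume p: "p \<in> C"
        show "\<Theta>' p \<in> bdisk (Suc (card \<tau>)) \<longleftrightarrow> fst p = 0 \<or> (\<exists>v\<in>\<sigma>. snd p v = 0)"
          unfolding \<Theta>'(4)[OF p] \<Theta>(3)[OF AD[OF p]] using Cp(1,2)[OF p] \<tau>(3)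
          by (auto simp: A_def \<sigma> add_nonneg_eq_0_iff)
        fix q assume q: "q \<in> C"
        have "(snd p)(i := 0) = (snd q)(i := 0) \<and> snd p i = snd q i \<longleftrightarrow> snd p = snd q"
          by (metis fun_upd_triv fun_upd_upd)
        moreover have "0 < fst p + snd p i \<longleftrightarrow> 0 < fst p \<or> 0 < snd p i" "fst p + snd p i = 0 \<longleftrightarrow> fst p = 0 \<and> snd p i = 0"
          using Cp(1)[OF p] Cp(2)[OF p, of i] by auto
        moreover have "snd p i = 0 \<longleftrightarrow> \<not> 0 < snd p i" "fst p = 0 \<longleftrightarrow> \<not> 0 < fst p" using Cp(1)[OF p] Cp(2)[OF p, of i] by auto
        moreover have "(snd p)(i := 0) = snd p" if "snd p i = 0" using that by auto
        moreover have "(snd q)(i := 0) = snd q" if "snd q i = 0" using that by auto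
        ultimately show "\<Theta>' p = \<Theta>' q \<longleftrightarrow>
          fst p = fst q \<and> (0 < fst p \<longrightarrow> snd p = snd q) \<and> (fst p = 0 \<longrightarrow> F (Suc i) (snd p) = F (Suc i) (snd q))"
          unfolding \<Theta>'(3)[OF p q] \<Theta>(4)[OF AD[OF p] AD[OF q]] F_Suc_crit[of i "snd p" "snd q", OF crit Cp(2)[OF p] Cp(2)[OF q]]
          unfolding A_def by (smt (verit) fst_conv snd_conv)
      qed
    next
      case ncrit: False
      define a where "a = \<alpha> i"
      have ai: "a < i" using \<alpha>_less[OF ncrit] by (simp add: a_def)
      define A where "A = (\<lambda>p::real \<times> (nat \<Rightarrow> real). (fst p, push i (snd p)))"
      have Ac: "continuous_on T A" for T unfolding A_def
        by (intro continuous_on_Pair cfst continuous_on_compose2[OF continuous_push csnd]) auto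
      have push: "push i y v = (if v = a then y a + y i else if v = i then 0 else y v)" for y v
        by (simp add: push_def a_def)
      have FS: "F (Suc i) y = F i (push i y)" for y using ncrit by auto
      have push_eq: "push i y = push i y' \<and> y i = y' i \<longleftrightarrow> y = y'" for y y'
      proof (intro iffI conjI)
        assume e: "push i y = push i y' \<and> y i = y' i"
        have "y v = y' v" for v using e fun_cong[of "push i y" "push i y'" v] push[of y v] push[of y' v]
          by (cases "v = a"; cases "v = i") auto
        then show "y = y'" by blast
      qed auto
      show ?thesis
      proof (cases "a \<in> \<sigma>")
        case True
        then have a\<tau>: "a \<in> \<tau>" using ai by (auto simp: \<tau>_def)
        have sum_push: "sum (push i y) \<tau> = sum y \<tau> + y i" for y
        proof -
          have "sum (push i y) \<tau> = push i y a + sum (push i y) (\<tau> - {a})" using a\<tau> \<tau>(1) by (simp add: sum.remove)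
          also have "sum (push i y) (\<tau> - {a}) = sum y (\<tau> - {a})" using \<tau>(3) by (intro sum.cong) (auto simp: push)
          also have "push i y a + sum y (\<tau> - {a}) = sum y \<tau> + y i" using a\<tau> \<tau>(1) by (simp add: push sum.remove[of \<tau> a])
          finally show ?thesis .
        qed
        \<comment> \<open>Where the apex has no mass, only the value of \<open>F\<close> is kept.
          The factor \<open>fst p\<close> makes the height 0 there, so that it is constant on the
          fibres of \<open>\<Theta>\<close> and the mass of \<open>i\<close> is forgotten together
          with the rest.\<close>
        define h where "h = (\<lambda>p::real \<times> (nat \<Rightarrow> real). fst p * snd p a)"
        define f where "f = (\<lambda>p::real \<times> (nat \<Rightarrow> real). fst p * snd p i)"
        have hc: "continuous_on T h" "continuous_on T f" for T unfolding h_def f_def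
          by (intro continuous_on_mult cfst cc)+
        have AD: "A p \<in> D" if "p \<in> C" for p
          unfolding D_def memC using Cp[OF that] \<tau> a\<tau>
          by (simp only: A_def fst_conv snd_conv sum_push) (auto simp: sum\<sigma> \<sigma> push intro!: add_nonneg_nonneg)
        have img: "(\<lambda>p. (A p, f p)) ` C = subgraph D h"
        proof (intro equalityI subsetI)
          fix w assume "w \<in> (\<lambda>p. (A p, f p)) ` C"
          then show "w \<in> subgraph D h" using AD Cp(1,2)
            by (auto simp: subgraph_def A_def f_def h_def push intro!: mult_nonneg_nonneg mult_left_mono)
        next
          fix w assume "w \<in> subgraph D h"
          then obtain p g where w: "w = (p, g)" "p \<in> D" "0 \<le> g" "g \<le> h p" by (auto simp: subgraph_def)
          \<comment> \<open>If the apex has no mass, then \<open>g\<close> is 0 and so is the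
            fraction, which is still an admissible share of the mass of \<open>a\<close>.\<close>
          define r where "r = g / fst p"
          have r: "0 \<le> r" "r \<le> snd p a" "fst p * r = g"
            using w Dp(1,2)[OF w(2)] by (auto simp: r_def h_def divide_le_eq mult.commute)
          define p' where "p' = (fst p, (snd p)(i := r, a := snd p a - r))"
          have pi: "snd p i = 0" by (rule Dp(3)[OF w(2) \<tau>(3)])
          have "push i (snd p') = snd p"
            using ai pi by (auto simp: fun_eq_iff push p'_def)
          moreover have "p' \<in> C"
          proof -
            have "sum (snd p') \<tau> + snd p' i = sum (snd p) \<tau>"
              using sum_push[of "snd p'"] \<open>push i (snd p') = snd p\<close> by simp
            then show ?thesis unfolding C_def memC sum\<sigma> using Dp[OF w(2)] r ai a\<tau>
              by (auto simp: p'_def \<sigma>)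
          qed
          ultimately show "w \<in> (\<lambda>p. (A p, f p)) ` C"
            using w(1) r(3) ai by (intro image_eqI[of _ _ p']) (auto simp: A_def f_def p'_def)
        qed
        obtain \<Theta>' where \<Theta>': "continuous_on C \<Theta>'" "\<Theta>' ` C = disk (Suc (card \<tau>))"
          "\<And>s t. s \<in> C \<Longrightarrow> t \<in> C \<Longrightarrow> \<Theta>' s = \<Theta>' t \<longleftrightarrow> \<Theta> (A s) = \<Theta> (A t) \<and> f s = f t"
          "\<And>s. s \<in> C \<Longrightarrow> \<Theta>' s \<in> bdisk (Suc (card \<tau>)) \<longleftrightarrow> \<Theta> (A s) \<in> bdisk (card \<tau>) \<or> f s = 0 \<or> f s = h (A s)"
        proof (rule thicken_disk[OF Dcomp \<Theta>(1,2) Ac hc(2) hc(1) _ _ img])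
          show "h p = h q" if "p \<in> D" "q \<in> D" "\<Theta> p = \<Theta> q" for p q
          proof -
            have "fst p = fst q" "0 < fst p \<longrightarrow> snd p = snd q" using that \<Theta>(4) by blast+
            then show ?thesis using Dp(1)[OF that(1)] by (cases "fst p = 0") (auto simp: h_def)
          qed
          show "0 < h p" if "p \<in> D" "\<Theta> p \<notin> bdisk (card \<tau>)" for p
          proof -
            have "fst p \<noteq> 0" "snd p a \<noteq> 0" using that \<Theta>(3) a\<tau> by blast+
            then have "0 < fst p" "0 < snd p a"
              using Dp(1)[OF that(1)] Dp(2)[OF that(1), of a] by simp_all
            then show ?thesis by (simp add: h_def)
          qed
          show "0 \<le> h p" if "p \<in> D" for p using Dp[OF that] by (simp add: h_def)
        qed auto
        show ?thesis unfolding cell_ball_def C_def[symmetric] card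
        proof (intro exI[of _ \<Theta>'] conjI \<Theta>'(1,2) ballI)
          fix p assume p: "p \<in> C"
          have "(\<exists>v\<in>\<tau>. push i (snd p) v = 0) \<or> snd p i = 0 \<or> snd p a = 0 \<longleftrightarrow> (\<exists>v\<in>\<sigma>. snd p v = 0)"
            using a\<tau> \<tau>(3) Cp(2)[OF p] unfolding \<sigma> by (auto simp: push add_nonneg_eq_0_iff)
          then show "\<Theta>' p \<in> bdisk (Suc (card \<tau>)) \<longleftrightarrow> fst p = 0 \<or> (\<exists>v\<in>\<sigma>. snd p v = 0)"
            unfolding \<Theta>'(4)[OF p] \<Theta>(3)[OF AD[OF p]]
            using push[of "snd p" a] by (simp add: A_def f_def h_def) blast
          fix q assume q: "q \<in> C"
          have "fst p = 0 \<longleftrightarrow> \<not> 0 < fst p" using Cp(1)[OF p] by auto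
          then show "\<Theta>' p = \<Theta>' q \<longleftrightarrow>
            fst p = fst q \<and> (0 < fst p \<longrightarrow> snd p = snd q) \<and> (fst p = 0 \<longrightarrow> F (Suc i) (snd p) = F (Suc i) (snd q))"
            unfolding \<Theta>'(3)[OF p q] \<Theta>(4)[OF AD[OF p] AD[OF q]] FS push_eq[of "snd p" "snd q", symmetric]
            by (auto simp: A_def f_def)
        qed
      next
        case False
        \<comment> \<open>Here \<open>push i\<close> only moves the mass from \<open>i\<close> to
          \<open>a\<close>. The induction hypothesis applies because it ranges over all finite sets
          below \<open>i\<close> and not only over faces of \<open>\<sigma>\<close>.\<close>
        define \<rho> where "\<rho> = insert a \<tau>"
        have a\<tau>: "a \<notin> \<tau>" using False by (simp add: \<tau>_def)
        have \<rho>: "finite \<rho>" "\<rho> \<subseteq> {..<i}" "card \<rho> = card \<sigma>" using \<tau> ai a\<tau> by (auto simp: \<rho>_def card)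
        define E where "E = cone_simplex \<rho>"
        obtain \<Xi> where "cell_ball i \<rho> \<Xi>" using Suc.IH[OF \<rho>(1,2)] by blast
    note \<Xi> = cell_ballD[OF this, folded E_def]
        have sum\<rho>: "sum y \<rho> = y a + sum y \<tau>" for y :: "nat \<Rightarrow> real" using \<tau>(1) a\<tau> by (simp add: \<rho>_def)
        have ya: "snd p a = 0" if "p \<in> C" for p by (rule Cp(3)[OF that False])
        have sum_push: "sum (push i y) \<tau> = sum y \<tau>" for y
          using \<tau>(3) a\<tau> by (intro sum.cong) (auto simp: push)
        have AE: "A p \<in> E" if "p \<in> C" for p
          unfolding E_def memC sum\<rho> using Cp[OF that] \<tau> a\<tau> ya[OF that]
          by (simp only: A_def fst_conv snd_conv sum_push) (auto simp: sum\<sigma> \<sigma> push \<rho>_def)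
        have A_img: "A ` C = E"
        proof (intro equalityI subsetI)
          fix p assume "p \<in> E"
          then have p: "0 \<le> fst p" "\<And>v. 0 \<le> snd p v" "\<And>v. v \<notin> \<rho> \<Longrightarrow> snd p v = 0" "fst p + (snd p a + sum (snd p) \<tau>) = 1"
            unfolding E_def memC sum\<rho> by blast+
          have pi: "snd p i = 0" using p(3)[of i] \<rho>(2) by auto
          define p' where "p' = (fst p, (snd p)(i := snd p a, a := 0))"
          have "push i (snd p') = snd p"
            using ai pi by (auto simp: fun_eq_iff push p'_def)
          moreover have "p' \<in> C"
          proof -
            have "sum (snd p') \<tau> = sum (snd p) \<tau>"
              using sum_push[of "snd p'"] \<open>push i (snd p') = snd p\<close> by simp
            then show ?thesis unfolding C_def memC sum\<sigma> using p ai
              by (auto simp: p'_def \<sigma> \<rho>_def)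
          qed
          ultimately show "p \<in> A ` C" by (intro image_eqI[of _ _ p']) (auto simp: A_def p'_def)
        qed (use AE in auto)
        show ?thesis unfolding cell_ball_def C_def[symmetric] \<rho>(3)[symmetric]
        proof (intro exI[of _ "\<lambda>p. \<Xi> (A p)"] conjI ballI)
          show "continuous_on C (\<lambda>p. \<Xi> (A p))"
            by (rule continuous_on_compose2[OF \<Xi>(1) Ac]) (use AE in auto)
          show "(\<lambda>p. \<Xi> (A p)) ` C = disk (card \<rho>)" using \<Xi>(2) unfolding A_img[symmetric] by (simp add: image_image)
          fix p assume p: "p \<in> C"
          have "(\<exists>v\<in>\<rho>. push i (snd p) v = 0) \<longleftrightarrow> (\<exists>v\<in>\<sigma>. snd p v = 0)"
            using a\<tau> \<tau>(3) ya[OF p] unfolding \<sigma> \<rho>_def by (auto simp: push)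
          then show "\<Xi> (A p) \<in> bdisk (card \<rho>) \<longleftrightarrow> fst p = 0 \<or> (\<exists>v\<in>\<sigma>. snd p v = 0)"
            unfolding \<Xi>(3)[OF AE[OF p]] by (simp add: A_def)
          fix q assume q: "q \<in> C"
          have "push i (snd p) = push i (snd q) \<longrightarrow> snd p i = snd q i"
            using ya[OF p] ya[OF q] by (metis (full_types) add_0 push)
          then have "push i (snd p) = push i (snd q) \<longleftrightarrow> snd p = snd q"
            using push_eq[of "snd p" "snd q"] by blast
          then show "\<Xi> (A p) = \<Xi> (A q) \<longleftrightarrow>
            fst p = fst q \<and> (0 < fst p \<longrightarrow> snd p = snd q) \<and> (fst p = 0 \<longrightarrow> F (Suc i) (snd p) = F (Suc i) (snd q))"
            unfolding \<Xi>(4)[OF AE[OF p] AE[OF q]] FS by (simp add: A_def)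
        qed
      qed
    qed
  qed
qed

end

section \<open>Finite complexes of parametrized cells\<close>

lemma Euclidean_space_eq: "Euclidean_space n = top_of_set (Rn n)"
  by (simp add: Euclidean_space_def Rn_def euclidean_product_topology)

lemma subtopology_Euclidean_space: "D \<subseteq> Rn n \<Longrightarrow> subtopology (Euclidean_space n) D = top_of_set D"
  by (simp add: Euclidean_space_eq subtopology_subtopology Int_absorb1)

lemma cube_eq: "cube n = {x \<in> Rn n. \<forall>i<n. 0 \<le> x i \<and> x i \<le> 1}"
  by (auto simp: cube_def topspace_Euclidean_space Rn_def)

lemma bcube_eq: "bcube n = {x \<in> cube n. \<exists>i<n. x i = 0 \<or> x i = 1}"
  by (auto simp: bcube_def)

lemma cube_sub_Rn: "cube n \<subseteq> Rn n"
  by (auto simp: cube_eq)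

lemma disk_sub_Rn: "disk n \<subseteq> Rn n"
  by (auto simp: disk_eq)

lemma closed_Rn: "closed (Rn n)"
proof -
  have "closed {x. n \<le> i \<longrightarrow> x i = (0::real)}" for i
    by (cases "n \<le> i") (auto intro!: closed_Collect_eq continuous_on_const continuous_on_coord)
  then show ?thesis unfolding Rn_def by (intro closed_Collect_all)
qed

lemma compact_cube: "compact (cube n)"
proof -
  have "cube n = {x :: nat \<Rightarrow> real. \<forall>i. x i \<in> {0..1}} \<inter> Rn n"
    by (auto simp: cube_eq Rn_def) (metis le0 linorder_not_le zero_le_one order_refl)+
  then show ?thesis using compact_Int_closed[OF compact_box closed_Rn] by simp
qed

text \<open>The cube is a product of intervals, and \<open>thicken_disk\<close> with constant height
  1 adds one factor to the product.\<close>

lemma cube_disk_homeo: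
  "\<exists>\<Theta>. continuous_on (cube n) \<Theta> \<and> bij_betw \<Theta> (cube n) (disk n) \<and>
     (\<forall>x\<in>cube n. \<Theta> x \<in> bdisk n \<longleftrightarrow> x \<in> bcube n)"
proof (induction n)
  case 0
  have "cube 0 = {\<lambda>_. 0}" "disk 0 = {\<lambda>_. 0}" "bdisk 0 = {}" "bcube 0 = {}"
    by (auto simp: disk_eq bdisk_eq cube_eq bcube_eq Rn_def)
  then show ?case by (intro exI[of _ id]) (auto simp: bij_betw_def)
next
  case (Suc n)
  then obtain \<Theta> where \<Theta>: "continuous_on (cube n) \<Theta>" "bij_betw \<Theta> (cube n) (disk n)"
    "\<And>x. x \<in> cube n \<Longrightarrow> \<Theta> x \<in> bdisk n \<longleftrightarrow> x \<in> bcube n" by blast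
  define A where "A = (\<lambda>x::nat \<Rightarrow> real. x(n := 0))"
  have A: "A x \<in> cube n" "0 \<le> x n" "x n \<le> 1" if "x \<in> cube (Suc n)" for x
    using that by (auto simp: A_def cube_eq Rn_def)
  have img: "(\<lambda>x. (A x, x n)) ` cube (Suc n) = subgraph (cube n) (\<lambda>_. 1)"
  proof (intro equalityI subsetI)
    fix w assume "w \<in> subgraph (cube n) (\<lambda>_. 1)"
    then obtain z t where w: "w = (z, t)" "z \<in> cube n" "0 \<le> t" "t \<le> 1" by (auto simp: subgraph_def)
    then have "z n = 0" by (simp add: cube_eq Rn_def)
    then have "(A (z(n := t)), (z(n := t)) n) = w" by (auto simp: A_def w(1))
    moreover have "z(n := t) \<in> cube (Suc n)" using w by (auto simp: cube_eq Rn_def)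
    ultimately show "w \<in> (\<lambda>x. (A x, x n)) ` cube (Suc n)" by blast
  qed (use A in \<open>auto simp: subgraph_def\<close>)
  obtain \<Theta>' where \<Theta>': "continuous_on (cube (Suc n)) \<Theta>'" "\<Theta>' ` cube (Suc n) = disk (Suc n)"
    "\<And>s t. s \<in> cube (Suc n) \<Longrightarrow> t \<in> cube (Suc n) \<Longrightarrow> \<Theta>' s = \<Theta>' t \<longleftrightarrow> \<Theta> (A s) = \<Theta> (A t) \<and> s n = t n"
    "\<And>s. s \<in> cube (Suc n) \<Longrightarrow> \<Theta>' s \<in> bdisk (Suc n) \<longleftrightarrow> \<Theta> (A s) \<in> bdisk n \<or> s n = 0 \<or> s n = 1"
  proof (rule thicken_disk[of "cube n" \<Theta> n "cube (Suc n)" A "\<lambda>x. x n" "\<lambda>_. 1"])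
    show "\<Theta> ` cube n = disk n" using \<Theta>(2) by (simp add: bij_betw_def)
    show "continuous_on (cube (Suc n)) A" unfolding A_def
      by (intro continuous_on_fun_upd continuous_on_id continuous_on_const)
  qed (use img in \<open>auto intro: compact_cube \<Theta>(1) continuous_on_coord\<close>)
  have inj: "inj_on \<Theta>' (cube (Suc n))"
  proof
    fix x y assume x: "x \<in> cube (Suc n)" and y: "y \<in> cube (Suc n)" and "\<Theta>' x = \<Theta>' y"
    then have e: "\<Theta> (A x) = \<Theta> (A y)" "x n = y n" using \<Theta>'(3) by blast+
    then have "A x = A y" using inj_onD[OF bij_betw_imp_inj_on[OF \<Theta>(2)]] A(1)[OF x] A(1)[OF y] by blast
    then have "(A x)(n := x n) = (A y)(n := y n)" using e(2) by simp
    then show "x = y" by (simp add: A_def)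
  qed
  have "A x \<in> bcube n \<or> x n = 0 \<or> x n = 1 \<longleftrightarrow> x \<in> bcube (Suc n)" if "x \<in> cube (Suc n)" for x
    using that A(1)[OF that] by (auto simp: bcube_eq A_def less_Suc_eq)
  then show ?case using \<Theta>' inj \<Theta>(3) A(1) by (intro exI[of _ \<Theta>']) (simp add: bij_betw_def)
qed

lemma disk_cube_homeo:
  "\<exists>\<xi>. continuous_on (disk n) \<xi> \<and> bij_betw \<xi> (disk n) (cube n) \<and>
     (\<forall>x\<in>disk n. \<xi> x \<in> bcube n \<longleftrightarrow> x \<in> bdisk n)"
proof -
  obtain \<Theta> where \<Theta>: "continuous_on (cube n) \<Theta>" "bij_betw \<Theta> (cube n) (disk n)"
    "\<And>x. x \<in> cube n \<Longrightarrow> \<Theta> x \<in> bdisk n \<longleftrightarrow> x \<in> bcube n" using cube_disk_homeo by blast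
  have im: "\<Theta> ` cube n = disk n" and inj: "inj_on \<Theta> (cube n)" using \<Theta>(2) by (auto simp: bij_betw_def)
  obtain \<xi> where \<xi>: "continuous_on (\<Theta> ` cube n) \<xi>" "\<And>x. x \<in> cube n \<Longrightarrow> \<xi> (\<Theta> x) = x"
    using compact_continuous_factor[OF compact_cube \<Theta>(1) continuous_on_id inj_onD[OF inj]] by metis
  show ?thesis
  proof (intro exI[of _ \<xi>] conjI ballI)
    show "continuous_on (disk n) \<xi>" using \<xi>(1) im by simp
    show "bij_betw \<xi> (disk n) (cube n)"
      unfolding im[symmetric] by (rule bij_betw_byWitness[of _ \<Theta>]) (use \<xi>(2) in auto)
    show "\<xi> x \<in> bcube n \<longleftrightarrow> x \<in> bdisk n" if "x \<in> disk n" for x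
      using that \<Theta>(3) \<xi>(2) unfolding im[symmetric] by auto
  qed
qed

lemma compact_disk: "compact (disk n)"
proof -
  obtain \<Theta> where "continuous_on (cube n) \<Theta>" "bij_betw \<Theta> (cube n) (disk n)" using cube_disk_homeo by blast
  then show ?thesis using compact_continuous_image[OF _ compact_cube] by (metis bij_betw_imp_surj_on)
qed

text \<open>The inverse is continuous because a closed subset of \<open>D\<close> has a compact
  image, and inside the image of \<open>D - S\<close> only its points from \<open>D - S\<close>
  contribute, as \<open>S\<close> is sent elsewhere. With \<open>S\<close> empty the lemma gives the
  embedding of a compact set.\<close>

lemma compact_homeomorphic_map_interior:
  fixes \<psi> :: "'a::topological_space \<Rightarrow> 'b::t2_space"
  assumes "compact D" "continuous_on D \<psi>" "inj_on \<psi> (D - S)" "\<psi> ` S \<inter> \<psi> ` (D - S) = {}"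
  shows "homeomorphic_map (top_of_set (D - S)) (top_of_set (\<psi> ` (D - S))) \<psi>"
proof -
  define g where "g = the_inv_into (D - S) \<psi>"
  have g: "g (\<psi> x) = x" if "x \<in> D - S" for x
    unfolding g_def using the_inv_into_f_f[OF assms(3) that] .
  have "continuous_on (\<psi> ` (D - S)) g"
    unfolding continuous_on_closed_invariant
  proof (intro allI impI)
    fix B :: "'a set" assume "closed B"
    then have "compact (\<psi> ` (D \<inter> B))"
      using assms(1) by (intro compact_continuous_image continuous_on_subset[OF assms(2)]) auto
    then have "closed (\<psi> ` (D \<inter> B))" by (rule compact_imp_closed)
    moreover have "\<psi> ` (D \<inter> B) \<inter> \<psi> ` (D - S) = g -` B \<inter> \<psi> ` (D - S)"
    proof (intro equalityI subsetI)
      fix y assume y: "y \<in> \<psi> ` (D \<inter> B) \<inter> \<psi> ` (D - S)"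
      then obtain x where x: "x \<in> D" "x \<in> B" "y = \<psi> x" by auto
      then have "x \<in> D - S" using y assms(4) by auto
      then show "y \<in> g -` B \<inter> \<psi> ` (D - S)" using x g by auto
    next
      fix y assume "y \<in> g -` B \<inter> \<psi> ` (D - S)"
      then show "y \<in> \<psi> ` (D \<inter> B) \<inter> \<psi> ` (D - S)" using g by auto
    qed
    ultimately show "\<exists>A. closed A \<and> A \<inter> \<psi> ` (D - S) = g -` B \<inter> \<psi> ` (D - S)" by blast
  qed
  then show ?thesis
    unfolding homeomorphic_map_maps homeomorphic_maps_def
    using g continuous_on_subset[OF assms(2)]
    by (intro exI[of _ g]) (auto simp: continuous_map_in_subtopology)
qed

lemma characteristic_mapI:
  fixes X :: "'a::metric_space cw"
  assumes X: "cw_space X = top_of_set T" and D: "D \<subseteq> Rn n" "compact D" and S: "S \<subseteq> D"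
    and c: "continuous_on D \<psi>" and inj: "inj_on \<psi> (D - S)" and e: "\<psi> ` (D - S) = e"
    and T: "e \<subseteq> T" "skel_below X n \<subseteq> T" and bd: "\<psi> ` S \<subseteq> skel_below X n" and disj: "e \<inter> skel_below X n = {}"
  shows "characteristic_map X n e D S \<psi>"
  unfolding characteristic_map_def
proof (intro conjI)
  have DS: "subtopology (Euclidean_space n) (D - S) = top_of_set (D - S)"
    using D by (intro subtopology_Euclidean_space) auto
  have "\<psi> x \<in> T" if "x \<in> D" for x
  proof (cases "x \<in> S")
    case True then show ?thesis using bd T by auto
  next
    case False then show ?thesis using that e T by auto
  qed
  then show "continuous_map (subtopology (Euclidean_space n) D) (cw_space X) \<psi>"
    unfolding X subtopology_Euclidean_space[OF D(1)] using c by (auto simp: continuous_map_in_subtopology)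
  have "subtopology (top_of_set T) e = top_of_set e" using T by (simp add: subtopology_subtopology Int_absorb1)
  then show "homeomorphic_map (subtopology (Euclidean_space n) (D - S)) (subtopology (cw_space X) e) \<psi>"
    using compact_homeomorphic_map_interior[OF D(2) c inj] bd disj e unfolding X DS by auto
qed (rule bd)

section \<open>Complexes given by labelled cells\<close>

text \<open>Cubes are taken because an elementary collapse asks for maps of cubes. \<open>B\<close>
  stands for the union of the boundary cells; once it is disjoint from \<open>e\<close>, the
  homeomorphism onto the open cell follows from compactness.\<close>

definition cell_param :: "nat \<Rightarrow> ((nat \<Rightarrow> real) \<Rightarrow> 'a::topological_space) \<Rightarrow> 'a set \<Rightarrow> 'a set \<Rightarrow> bool" where
  "cell_param n \<psi> e B \<longleftrightarrow> continuous_on (cube n) \<psi> \<and> inj_on \<psi> (cube n - bcube n) \<and>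
     \<psi> ` (cube n - bcube n) = e \<and> \<psi> ` bcube n \<subseteq> B"

lemma bcube_sub: "bcube n \<subseteq> cube n" by (auto simp: bcube_def)

lemma bdisk_sub: "bdisk n \<subseteq> disk n" by (auto simp: bdisk_eq disk_eq)

lemma cube_interior_nonempty: "cube n - bcube n \<noteq> {}"
proof -
  have "(\<lambda>i. if i < n then 1/2 else 0) \<in> cube n - bcube n" by (auto simp: cube_eq bcube_eq Rn_def)
  then show ?thesis by blast
qed

text \<open>The part of the boundary of the cube that an elementary collapse retains.\<close>

definition cube_rest :: "nat \<Rightarrow> nat \<Rightarrow> real \<Rightarrow> (nat \<Rightarrow> real) set" where
  "cube_rest n j c = {u \<in> cube n. u j = 1 - c \<or> (\<exists>i<n. i \<noteq> j \<and> (u i = 0 \<or> u i = 1))}"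

text \<open>All complexes of the deformation will consist of cells of one space, so that a complex
  is a finite set of labels and a subcomplex a set of labels closed under \<open>bd\<close>.
  Collapsing then means removing labels.\<close>

locale cell_system =
  fixes L :: "'l set" and d :: "'l \<Rightarrow> nat" and cell :: "'l \<Rightarrow> 'a::metric_space set" and bd :: "'l \<Rightarrow> 'l set"
  assumes finite_L: "finite L" and bd_sub: "l \<in> L \<Longrightarrow> bd l \<subseteq> L"
    and bd_dim: "l \<in> L \<Longrightarrow> b \<in> bd l \<Longrightarrow> d b < d l"
    and disjoint: "l \<in> L \<Longrightarrow> m \<in> L \<Longrightarrow> l \<noteq> m \<Longrightarrow> cell l \<inter> cell m = {}"
    and param: "l \<in> L \<Longrightarrow> \<exists>\<psi>. cell_param (d l) \<psi> (cell l) (\<Union>(cell ` bd l))"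
begin

definition sub :: "'l set \<Rightarrow> 'a cw" where
  "sub S = \<lparr>cw_space = top_of_set (\<Union>(cell ` S)), cw_ncells = \<lambda>n. cell ` {l \<in> S. d l = n}\<rparr>"

definition down :: "'l set \<Rightarrow> bool" where
  "down S \<longleftrightarrow> S \<subseteq> L \<and> (\<forall>l\<in>S. bd l \<subseteq> S)"

lemma cw_space_sub: "cw_space (sub S) = top_of_set (\<Union>(cell ` S))"
  by (simp add: sub_def)

lemma cw_cells_sub: "cw_cells (sub S) = cell ` S"
  by (auto simp: cw_cells_def sub_def)

lemma cell_nonempty: "l \<in> L \<Longrightarrow> cell l \<noteq> {}"
  using param[of l] cube_interior_nonempty by (auto simp: cell_param_def)

lemma cell_inj: "inj_on cell L"
  using disjoint cell_nonempty by (metis inf.idem inj_onI)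

lemma cell_Union_disjoint: "l \<in> L \<Longrightarrow> S \<subseteq> L \<Longrightarrow> l \<notin> S \<Longrightarrow> cell l \<inter> \<Union>(cell ` S) = {}"
  using disjoint by blast

lemma skel_below_sub: "skel_below (sub S) n = \<Union>(cell ` {l \<in> S. d l < n})"
  by (auto simp: skel_below_def sub_def)

lemma closed_cell:
  assumes "l \<in> L"
  obtains C where "compact C" "cell l \<subseteq> C" "C \<subseteq> cell l \<union> \<Union>(cell ` bd l)"
proof -
  obtain \<psi> where \<psi>: "cell_param (d l) \<psi> (cell l) (\<Union>(cell ` bd l))" using param[OF assms] by blast
  have im: "\<psi> ` cube (d l) = \<psi> ` (cube (d l) - bcube (d l)) \<union> \<psi> ` bcube (d l)" using bcube_sub[of "d l"] by blast
  show ?thesis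
  proof (rule that)
    show "compact (\<psi> ` cube (d l))"
      using \<psi> compact_cube by (auto simp: cell_param_def intro: compact_continuous_image)
    show "cell l \<subseteq> \<psi> ` cube (d l)" using \<psi> unfolding im cell_param_def by blast
    show "\<psi> ` cube (d l) \<subseteq> cell l \<union> \<Union>(cell ` bd l)" using \<psi> unfolding im cell_param_def by blast
  qed
qed

lemma compact_sub: assumes "down S" shows "compact (\<Union>(cell ` S))"
proof -
  have S: "S \<subseteq> L" "finite S" using assms finite_L finite_subset by (auto simp: down_def)
  have "\<exists>C. \<forall>l\<in>S. compact (C l) \<and> cell l \<subseteq> C l \<and> C l \<subseteq> cell l \<union> \<Union>(cell ` bd l)"
    using closed_cell S(1) by (intro bchoice) (metis subsetD)
  then obtain C where C: "\<And>l. l \<in> S \<Longrightarrow> compact (C l) \<and> cell l \<subseteq> C l \<and> C l \<subseteq> cell l \<union> \<Union>(cell ` bd l)" by blast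
  have "C l \<subseteq> \<Union>(cell ` S)" if "l \<in> S" for l
  proof -
    have "bd l \<subseteq> S" using assms that by (simp add: down_def)
    then have "cell l \<union> \<Union>(cell ` bd l) \<subseteq> \<Union>(cell ` S)" using that by blast
    then show ?thesis using C[OF that] by (meson subset_trans)
  qed
  moreover have "\<Union>(cell ` S) \<subseteq> (\<Union>l\<in>S. C l)" using C by (meson UN_mono order_refl)
  ultimately have "\<Union>(cell ` S) = (\<Union>l\<in>S. C l)" by (meson UN_least subset_antisym)
  then show ?thesis using C S(2) by (auto intro: compact_UN)
qed

lemma closure_cell:
  assumes "down S" "l \<in> S"
  shows "cw_space (sub S) closure_of cell l \<subseteq> cell l \<union> \<Union>(cell ` bd l)"
proof -
  have l: "l \<in> L" "bd l \<subseteq> S" using assms by (auto simp: down_def)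
  obtain C where C: "compact C" "cell l \<subseteq> C" "C \<subseteq> cell l \<union> \<Union>(cell ` bd l)" using closed_cell[OF l(1)] by blast
  have "C \<subseteq> \<Union>(cell ` S)" using C(3) l assms(2) by blast
  then have "closedin (cw_space (sub S)) C"
    using compact_imp_closed[OF C(1)] by (auto simp: sub_def intro: closed_subset)
  then show ?thesis using closure_of_minimal[OF C(2)] C(3) by blast
qed

text \<open>Stated for arbitrary maps of the disk, since regularity of the core calls for a
  characteristic map that is injective on the whole disk and does not come from a parametrization by
  a cube.\<close>

lemma disk_characteristic_map:
  assumes S: "down S" and l: "l \<in> S"
    and \<phi>: "continuous_on (disk (d l)) \<phi>" "inj_on \<phi> (disk (d l) - bdisk (d l))"
      "\<phi> ` (disk (d l) - bdisk (d l)) = cell l" "\<phi> ` bdisk (d l) \<subseteq> \<Union>(cell ` bd l)"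
  shows "characteristic_map (sub S) (d l) (cell l) (disk (d l)) (bdisk (d l)) \<phi>"
proof -
  have SL: "S \<subseteq> L" "l \<in> L" using S l by (auto simp: down_def)
  have "bd l \<subseteq> {m \<in> S. d m < d l}" using S l bd_dim[OF SL(2)] by (auto simp: down_def)
  then have b: "\<Union>(cell ` bd l) \<subseteq> skel_below (sub S) (d l)" unfolding skel_below_sub by blast
  show ?thesis
  proof (rule characteristic_mapI[where T = "\<Union>(cell ` S)"])
    show "cell l \<inter> skel_below (sub S) (d l) = {}"
      unfolding skel_below_sub using SL by (intro cell_Union_disjoint) auto
    show "cell l \<subseteq> \<Union>(cell ` S)" "skel_below (sub S) (d l) \<subseteq> \<Union>(cell ` S)"
      using l by (auto simp: skel_below_sub)
    show "continuous_on (disk (d l)) \<phi>" "inj_on \<phi> (disk (d l) - bdisk (d l))"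
      "\<phi> ` (disk (d l) - bdisk (d l)) = cell l" by (rule \<phi>)+
    show "\<phi> ` bdisk (d l) \<subseteq> skel_below (sub S) (d l)" using \<phi>(4) b by blast
  qed (auto simp: sub_def compact_disk disk_sub_Rn bdisk_sub)
qed

lemma cube_characteristic_map:
  assumes S: "down S" and l: "l \<in> S" and \<psi>: "cell_param (d l) \<psi> (cell l) (\<Union>(cell ` bd l))"
  shows "characteristic_map (sub S) (d l) (cell l) (cube (d l)) (bcube (d l)) \<psi>"
proof -
  have SL: "S \<subseteq> L" "l \<in> L" using S l by (auto simp: down_def)
  have "bd l \<subseteq> {m \<in> S. d m < d l}" using S l bd_dim[OF SL(2)] by (auto simp: down_def)
  then have b: "\<Union>(cell ` bd l) \<subseteq> skel_below (sub S) (d l)" unfolding skel_below_sub by blast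
  show ?thesis
  proof (rule characteristic_mapI[where T = "\<Union>(cell ` S)"])
    show "cell l \<inter> skel_below (sub S) (d l) = {}"
      unfolding skel_below_sub using SL by (intro cell_Union_disjoint) auto
    show "cell l \<subseteq> \<Union>(cell ` S)" "skel_below (sub S) (d l) \<subseteq> \<Union>(cell ` S)"
      using l by (auto simp: skel_below_sub)
    show "continuous_on (cube (d l)) \<psi>" "inj_on \<psi> (cube (d l) - bcube (d l))"
      "\<psi> ` (cube (d l) - bcube (d l)) = cell l" using \<psi> by (auto simp: cell_param_def)
    show "\<psi> ` bcube (d l) \<subseteq> skel_below (sub S) (d l)"
      using \<psi> b unfolding cell_param_def by (meson subset_trans)
  qed (auto simp: sub_def compact_cube cube_sub_Rn bcube_sub)
qed

lemma finite_cw_sub: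
  assumes S: "down S"
  shows "finite_cw_complex (sub S)"
  unfolding finite_cw_complex_def cw_complex_def
proof (intro conjI allI ballI impI)
  have SL: "S \<subseteq> L" "finite S" using assms finite_L finite_subset by (auto simp: down_def)
  show fin: "finite (cw_cells (sub S))" using SL by (simp add: cw_cells_sub)
  show "Hausdorff_space (cw_space (sub S))"
    unfolding sub_def using Hausdorff_space_euclidean by (simp add: Hausdorff_space_subtopology)
  show "topspace (cw_space (sub S)) = \<Union>(cw_cells (sub S))"
    unfolding cw_cells_sub by (simp add: sub_def)
  show "dd \<inter> e = {}" if D: "dd \<in> cw_ncells (sub S) m" "e \<in> cw_ncells (sub S) n" "(m, dd) \<noteq> (n, e)" for m n dd e
  proof -
    obtain l where l: "l \<in> S" "d l = m" "dd = cell l" using D(1) by (auto simp: sub_def)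
    obtain k where k: "k \<in> S" "d k = n" "e = cell k" using D(2) by (auto simp: sub_def)
    have "l \<noteq> k" using D(3) l k by blast
    then show ?thesis using disjoint[of l k] l k SL(1) by blast
  qed
  show "\<exists>\<phi>. characteristic_map (sub S) n e (disk n) (bdisk n) \<phi>" if e: "e \<in> cw_ncells (sub S) n" for n e
  proof -
    obtain l where l: "l \<in> S" "d l = n" "e = cell l" using e by (auto simp: sub_def)
    then obtain \<psi> where \<psi>: "cell_param (d l) \<psi> (cell l) (\<Union>(cell ` bd l))" using param SL by blast
    obtain \<xi> where \<xi>: "continuous_on (disk n) \<xi>" "bij_betw \<xi> (disk n) (cube n)"
      "\<And>x. x \<in> disk n \<Longrightarrow> \<xi> x \<in> bcube n \<longleftrightarrow> x \<in> bdisk n" using disk_cube_homeo[of n] by blast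
    have im: "\<xi> ` disk n = cube n" "inj_on \<xi> (disk n)" using \<xi>(2) by (auto simp: bij_betw_def)
    have i2: "\<xi> ` bdisk n = bcube n"
    proof (intro equalityI subsetI)
      fix y assume "y \<in> bcube n"
      moreover from this obtain x where "x \<in> disk n" "y = \<xi> x" using im(1) bcube_sub[of n] by blast
      ultimately show "y \<in> \<xi> ` bdisk n" using \<xi>(3)[of x] by blast
    qed (use \<xi>(3) bdisk_sub[of n] in blast)
    then have i: "\<xi> ` (disk n - bdisk n) = cube n - bcube n"
      using inj_on_image_set_diff[OF im(2) Diff_subset bdisk_sub] im(1) by simp
    note i = i i2
    have inj: "inj_on \<xi> (disk n - bdisk n)" using im(2) by (rule inj_on_subset) blast
    have "characteristic_map (sub S) (d l) (cell l) (disk (d l)) (bdisk (d l)) (\<psi> \<circ> \<xi>)"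
    proof (rule disk_characteristic_map[OF S l(1)])
      show "continuous_on (disk (d l)) (\<psi> \<circ> \<xi>)"
        using \<psi> \<xi>(1,2) l(2) im by (intro continuous_on_compose) (simp_all add: cell_param_def)
      show "inj_on (\<psi> \<circ> \<xi>) (disk (d l) - bdisk (d l))"
        using \<psi> l(2) i inj by (intro comp_inj_on) (auto simp: cell_param_def)
      show "(\<psi> \<circ> \<xi>) ` (disk (d l) - bdisk (d l)) = cell l" "(\<psi> \<circ> \<xi>) ` bdisk (d l) \<subseteq> \<Union>(cell ` bd l)"
        using \<psi> l(2) i unfolding image_comp[symmetric] by (auto simp: cell_param_def)
    qed
    then show ?thesis using l by blast
  qed
  show "\<exists>F. finite F \<and> F \<subseteq> cw_cells (sub S) \<and> cw_space (sub S) closure_of e \<subseteq> \<Union>F" if "e \<in> cw_cells (sub S)" for e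
    using fin closure_of_subset_topspace[of "cw_space (sub S)" e]
    by (intro exI[of _ "cw_cells (sub S)"]) (simp add: cw_cells_sub cw_space_sub)
  show "closedin (cw_space (sub S)) A"
    if "A \<subseteq> topspace (cw_space (sub S)) \<and>
      (\<forall>e\<in>cw_cells (sub S). closedin (cw_space (sub S)) (A \<inter> (cw_space (sub S) closure_of e)))" for A
  proof -
    let ?cl = "\<lambda>l. cw_space (sub S) closure_of cell l"
    have cl: "cell l \<subseteq> ?cl l" if "l \<in> S" for l
      using that by (intro closure_of_subset) (auto simp: cw_space_sub)
    have A: "A \<subseteq> \<Union>(cell ` S)" using that by (simp add: cw_space_sub)
    have "A = (\<Union>l\<in>S. A \<inter> ?cl l)"
    proof (intro equalityI subsetI)
      fix x assume x: "x \<in> A"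
      then obtain l where "l \<in> S" "x \<in> cell l" using A by blast
      then show "x \<in> (\<Union>l\<in>S. A \<inter> ?cl l)" using cl[of l] x by blast
    qed simp
    moreover have "closedin (cw_space (sub S)) (\<Union>l\<in>S. A \<inter> ?cl l)"
      using that SL by (intro closedin_Union) (auto simp: cw_cells_sub)
    ultimately show ?thesis by metis
  qed
qed

lemma cw_subcomplex_sub:
  assumes "down S" "down S'" "S' \<subseteq> S"
  shows "cw_subcomplex (sub S') (sub S)"
  unfolding cw_subcomplex_def
proof (intro conjI allI ballI)
  show "cw_ncells (sub S') n \<subseteq> cw_ncells (sub S) n" for n using assms by (auto simp: sub_def)
  have "\<Union>(cell ` S) \<inter> \<Union>(cell ` S') = \<Union>(cell ` S')" using assms(3) by blast
  then show "cw_space (sub S') = subtopology (cw_space (sub S)) (\<Union>(cw_cells (sub S')))"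
    unfolding cw_cells_sub by (simp add: sub_def subtopology_subtopology)
  show "cw_space (sub S) closure_of e \<subseteq> \<Union>(cw_cells (sub S'))" if e: "e \<in> cw_cells (sub S')" for e
  proof -
    obtain l where l: "l \<in> S'" "e = cell l" using e by (auto simp: cw_cells_sub)
    then show ?thesis using closure_cell[OF assms(1), of l] assms unfolding cw_cells_sub down_def by blast
  qed
qed

lemma cw_dim_le_sub: "(\<And>l. l \<in> S \<Longrightarrow> int (d l) \<le> m) \<Longrightarrow> cw_dim_le (sub S) m"
  by (auto simp: cw_dim_le_def sub_def)

end

section \<open>Collapses\<close>

text \<open>The distance, in the maximum norm, from the line in direction \<open>j\<close> through
  the centre of the cube. In the cube it is at most 1/2, with equality on the sides.\<close>

primrec offset :: "nat \<Rightarrow> nat \<Rightarrow> (nat \<Rightarrow> real) \<Rightarrow> real" where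
  "offset j 0 u = 0"
| "offset j (Suc n) u = max (offset j n u) (if n = j then 0 else \<bar>u n - 1/2\<bar>)"

lemma continuous_offset: "continuous_on S (offset j n)"
proof (induction n)
  case (Suc n)
  have "continuous_on S (\<lambda>u. if n = j then 0 else \<bar>u n - 1/2\<bar>)"
    by (cases "n = j") (auto intro!: continuous_on_rabs continuous_on_diff continuous_on_coord continuous_on_const)
  then show ?case using Suc by (auto intro!: continuous_on_max)
qed simp

lemma offset_ge: "i < n \<Longrightarrow> i \<noteq> j \<Longrightarrow> \<bar>u i - 1/2\<bar> \<le> offset j n u"
  by (induction n) (auto simp: less_Suc_eq le_max_iff_disj)

lemma offset_attained: "offset j n u = 0 \<or> (\<exists>i<n. i \<noteq> j \<and> offset j n u = \<bar>u i - 1/2\<bar>)"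
  by (induction n) (auto simp: max_def less_Suc_eq)

lemma offset_le_half: "u \<in> cube n \<Longrightarrow> offset j n u \<le> 1/2"
proof -
  assume u: "u \<in> cube n"
  show ?thesis
  proof (cases "offset j n u = 0")
    case False
    then obtain i where i: "i < n" "offset j n u = \<bar>u i - 1/2\<bar>" using offset_attained[of j n u] by blast
    moreover have "0 \<le> u i" "u i \<le> 1" using u i(1) by (auto simp: cube_eq)
    ultimately show ?thesis by (simp add: abs_if)
  qed simp
qed

lemma cube_rest_sub: "cube_rest n j c \<subseteq> cube n"
  by (auto simp: cube_rest_def)

text \<open>The projection to the rest of the boundary fixes that rest, and the segments from the
  points to their projections stay in the cube by convexity.\<close>

lemma cube_flow:
  assumes j: "j < n" and c: "c = 0 \<or> c = (1::real)"
  obtains R :: "real \<Rightarrow> (nat \<Rightarrow> real) \<Rightarrow> nat \<Rightarrow> real"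
  where "continuous_on ({0..1} \<times> cube n) (\<lambda>(t, u). R t u)"
    "\<And>t u. t \<in> {0..1} \<Longrightarrow> u \<in> cube n \<Longrightarrow> R t u \<in> cube n"
    "\<And>u. u \<in> cube n \<Longrightarrow> R 0 u = u"
    "\<And>u. u \<in> cube n \<Longrightarrow> R 1 u \<in> cube_rest n j c"
    "\<And>t u. u \<in> cube_rest n j c \<Longrightarrow> R t u = u"
proof -
  \<comment> \<open>This sign points into the cube from the face where coordinate \<open>j\<close>
    is \<open>c\<close>, so \<open>h u\<close> is the distance of \<open>u\<close> from that
    face.\<close>
  define \<sigma> where "\<sigma> = 1 - 2 * c"
  define h where "h u = \<sigma> * (u j - c)" for u :: "nat \<Rightarrow> real"
  \<comment> \<open>Seen from the centre of projection, \<open>u\<close> has height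
    \<open>h u + 1\<close>, the far face has height 2 and the sides have offset 1/2. Scaling
    \<open>u\<close> by \<open>2 / (h u + 1)\<close> reaches the far face, scaling by
    \<open>2 / (4 * offset j n u)\<close> reaches a side, and the smaller factor is
    \<open>2 / M u\<close>.\<close>
  define M where "M u = max (h u + 1) (4 * offset j n u)" for u
  \<comment> \<open>Radial projection from the point above the centre of the face \<open>u j = c\<close> at distance 1 outside the cube.\<close>
  define r where "r u i = (if i < n then if i = j then c + \<sigma> * (2 / M u * (h u + 1) - 1)
      else 1/2 + 2 / M u * (u i - 1/2) else 0)" for u i
  define R where "R t u i = (1 - t) * u i + t * r u i" for t :: real and u i
  have \<sigma>: "\<sigma> * \<sigma> = 1" "\<sigma> = 1 \<or> \<sigma> = -1" using c by (auto simp: \<sigma>_def)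
  have uj: "u j = c + \<sigma> * h u" for u using \<sigma>(1) by (simp add: h_def mult.assoc[symmetric])
  have side: "0 \<le> c + \<sigma> * s \<and> c + \<sigma> * s \<le> 1 \<longleftrightarrow> 0 \<le> s \<and> s \<le> 1" for s
    using c by (auto simp: \<sigma>_def)
  have h: "0 \<le> h u" "h u \<le> 1" if "u \<in> cube n" for u
  proof -
    have "0 \<le> u j \<and> u j \<le> 1" using that j by (simp add: cube_eq)
    then show "0 \<le> h u" "h u \<le> 1" using side[of "h u"] uj[of u] by simp_all
  qed
  have M: "1 \<le> M u" "M u \<le> 2" if "u \<in> cube n" for u
    using h[OF that] offset_le_half[OF that, of j] by (auto simp: M_def le_max_iff_disj)
  have rest: "u \<in> cube_rest n j c \<longleftrightarrow> u \<in> cube n \<and> M u = 2" for u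
  proof (cases "u \<in> cube n")
    case True
    have "u j = 1 - c \<longleftrightarrow> h u = 1" using c by (auto simp: h_def \<sigma>_def)
    moreover have "(\<exists>i<n. i \<noteq> j \<and> (u i = 0 \<or> u i = 1)) \<longleftrightarrow> offset j n u = 1/2"
    proof
      assume "\<exists>i<n. i \<noteq> j \<and> (u i = 0 \<or> u i = 1)"
      then show "offset j n u = 1/2"
        using offset_ge[of _ n j u] offset_le_half[OF True, of j] by fastforce
    next
      assume "offset j n u = 1/2"
      then obtain i where "i < n" "i \<noteq> j" "\<bar>u i - 1/2\<bar> = 1/2" using offset_attained[of j n u] by auto
      then show "\<exists>i<n. i \<noteq> j \<and> (u i = 0 \<or> u i = 1)" by (intro exI[of _ i]) (auto simp: abs_if split: if_splits)
    qed
    moreover have "M u = 2 \<longleftrightarrow> h u = 1 \<or> offset j n u = 1/2"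
      using h[OF True] offset_le_half[OF True, of j] by (auto simp: M_def max_def)
    ultimately show ?thesis using True by (simp add: cube_rest_def)
  qed (auto simp: cube_rest_def)
  have rR: "r u \<in> cube_rest n j c" if u: "u \<in> cube n" for u
  proof -
    have Mp: "0 < M u" using M(1)[OF u] by simp
    have 1: "h u + 1 \<le> M u" "M u \<le> 2 * (h u + 1)" "4 * offset j n u \<le> M u"
      using h[OF u] offset_le_half[OF u, of j] by (auto simp: M_def)
    have a: "0 \<le> 2 / M u * (h u + 1) - 1" "2 / M u * (h u + 1) - 1 \<le> 1"
      using 1 Mp by (auto simp: field_simps)
    have b: "\<bar>2 / M u * (u i - 1/2)\<bar> \<le> 1/2" if "i < n" "i \<noteq> j" for i
    proof -
      have "4 * \<bar>u i - 1/2\<bar> \<le> 4 * offset j n u" using offset_ge[OF that, of u] by simp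
      then have "4 * \<bar>u i - 1/2\<bar> \<le> M u" using 1(3) by (rule order_trans)
      moreover have "2 / m * a \<le> 1/2" if "4 * a \<le> m" "0 < m" for a m :: real
        using that by (simp add: field_simps)
      ultimately have "2 / M u * \<bar>u i - 1/2\<bar> \<le> 1/2" using Mp by blast
      then show ?thesis using Mp by (simp only: abs_mult abs_divide abs_numeral abs_of_pos)
    qed
    have cub: "r u \<in> cube n"
      unfolding cube_eq Rn_def
    proof (intro CollectI conjI allI impI)
      fix i assume i: "i < n"
      show "0 \<le> r u i" "r u i \<le> 1"
      proof -
        have "0 \<le> r u i \<and> r u i \<le> 1"
        proof (cases "i = j")
          case True then show ?thesis using side[of "2 / M u * (h u + 1) - 1"] a i by (simp add: r_def)
        next
          case False
          then have "r u i = 1/2 + 2 / M u * (u i - 1/2)" using i by (simp add: r_def)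
          then show ?thesis using b[OF i False] unfolding abs_le_iff by linarith
        qed
        then show "0 \<le> r u i" "r u i \<le> 1" by auto
      qed
    qed (simp add: r_def)
    consider "M u = h u + 1" | "M u = 4 * offset j n u" unfolding M_def by linarith
    then show ?thesis
    proof cases
      case 1
      have "2 / M u * (h u + 1) = 2" using Mp unfolding 1[symmetric] by simp
      then have "r u j = c + \<sigma>" using j by (simp add: r_def)
      then have "r u j = 1 - c" using c by (auto simp: \<sigma>_def)
      then show ?thesis using cub by (simp add: cube_rest_def)
    next
      case 2
      then obtain i where i: "i < n" "i \<noteq> j" "M u = 4 * \<bar>u i - 1/2\<bar>" using offset_attained[of j n u] Mp by auto
      have "2 / m * a = 1/2" if "m = 4 * a" "0 < m" for a m :: real
        using that by (simp add: field_simps)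
      then have "2 / M u * \<bar>u i - 1/2\<bar> = 1/2" using i(3) Mp by blast
      then have "\<bar>2 / M u * (u i - 1/2)\<bar> = 1/2"
        using Mp by (simp only: abs_mult abs_divide abs_numeral abs_of_pos)
      moreover have "r u i = 1/2 + 2 / M u * (u i - 1/2)" using i(1,2) by (simp add: r_def)
      ultimately have "r u i = 0 \<or> r u i = 1" by linarith
      then show ?thesis using cub i by (auto simp: cube_rest_def)
    qed
  qed
  have fixed: "r u = u" if u: "u \<in> cube_rest n j c" for u
  proof
    fix i
    have "M u = 2" "u \<in> cube n" using u rest by auto
    then show "r u i = u i" using uj[of u] by (auto simp: r_def cube_eq Rn_def)
  qed
  show ?thesis
  proof (rule that[of R])
    have hc: "continuous_on S h" for S unfolding h_def
      by (intro continuous_on_mult continuous_on_diff continuous_on_const continuous_on_coord)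
    have Mc: "continuous_on S M" for S unfolding M_def
      by (intro continuous_on_max continuous_on_add continuous_on_mult continuous_on_const hc continuous_offset)
    have "continuous_on (cube n) (\<lambda>u. r u i)" for i
    proof -
      have M0: "\<forall>u\<in>cube n. M u \<noteq> 0" using M(1) by fastforce
      show ?thesis unfolding r_def
        by (cases "i < n"; cases "i = j")
          (auto intro!: continuous_on_mult continuous_on_add continuous_on_diff continuous_on_divide
            continuous_on_const continuous_on_coord hc Mc simp: M0)
    qed
    then have rc: "continuous_on (cube n) r" by (rule continuous_on_coordinatewise_then_product)
    have c1: "continuous_on ({0..1} \<times> cube n) (\<lambda>p. r (snd p))"
      by (rule continuous_on_compose2[OF rc]) (auto intro: continuous_on_snd continuous_on_id)
    have c2: "continuous_on ({0..1} \<times> cube n) (\<lambda>p. snd p :: nat \<Rightarrow> real)"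
      by (intro continuous_on_snd continuous_on_id)
    show "continuous_on ({0..1} \<times> cube n) (\<lambda>(t, u). R t u)"
      unfolding R_def split_beta
      by (intro continuous_on_coordinatewise_then_product continuous_on_add continuous_on_mult
          continuous_on_diff continuous_on_const continuous_on_fst continuous_on_id
          continuous_on_product_then_coordinatewise[OF c1] continuous_on_product_then_coordinatewise[OF c2])
    show "R t u \<in> cube n" if "t \<in> {0..1}" "u \<in> cube n" for t u
      unfolding cube_eq Rn_def
    proof (intro CollectI conjI allI impI)
      have ru: "r u \<in> cube n" using rR[OF that(2)] cube_rest_sub by blast
      fix i
      show "R t u i = 0" if "n \<le> i" using \<open>u \<in> cube n\<close> ru that by (simp add: R_def cube_eq Rn_def)
      assume i: "i < n"
      have b: "0 \<le> u i" "u i \<le> 1" "0 \<le> r u i" "r u i \<le> 1" using that ru i by (auto simp: cube_eq)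
      show "0 \<le> R t u i" unfolding R_def using b that(1) by (intro add_nonneg_nonneg mult_nonneg_nonneg) auto
      show "R t u i \<le> 1" unfolding R_def using b that(1) convex_bound_le[of "u i" 1 "r u i" "1 - t" t] by auto
    qed
    show "R 0 u = u" if "u \<in> cube n" for u by (simp add: R_def fun_eq_iff)
    show "R 1 u \<in> cube_rest n j c" if "u \<in> cube n" for u
    proof -
      have "R 1 u = r u" by (simp add: R_def fun_eq_iff)
      then show ?thesis using rR[OF that] by simp
    qed
    show "R t u = u" if "u \<in> cube_rest n j c" for t u
    proof
      fix i show "R t u i = u i" unfolding R_def fixed[OF that] by (simp add: algebra_simps)
    qed
  qed
qed

text \<open>The flow on the cube descends along \<open>\<psi>\<close>: off \<open>Y\<close> the map
  is injective, and points mapped into \<open>Y\<close> lie in \<open>cube_rest\<close>, where the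
  flow stands still. The resulting homotopy is glued to the constant one on
  \<open>Y\<close>.\<close>

lemma cube_push_homotopy_equivalent:
  fixes \<psi> :: "(nat \<Rightarrow> real) \<Rightarrow> 'a::metric_space"
  assumes jc: "j < n" "c = 0 \<or> c = 1" and \<psi>: "continuous_on (cube n) \<psi>" and Y: "closed Y"
    and rest: "\<psi> ` cube_rest n j c \<subseteq> Y" and out: "\<And>u. u \<in> cube n - cube_rest n j c \<Longrightarrow> \<psi> u \<notin> Y"
    and inj: "inj_on \<psi> (cube n - cube_rest n j c)"
  shows "top_of_set (Y \<union> \<psi> ` cube n) homotopy_equivalent_space top_of_set Y"
proof (rule cube_flow[OF jc])
  fix R :: "real \<Rightarrow> (nat \<Rightarrow> real) \<Rightarrow> nat \<Rightarrow> real"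
  assume R: "continuous_on ({0..1} \<times> cube n) (\<lambda>(t, u). R t u)"
    "\<And>t u. t \<in> {0..1} \<Longrightarrow> u \<in> cube n \<Longrightarrow> R t u \<in> cube n"
    "\<And>u. u \<in> cube n \<Longrightarrow> R 0 u = u"
    "\<And>u. u \<in> cube n \<Longrightarrow> R 1 u \<in> cube_rest n j c"
    "\<And>t u. u \<in> cube_rest n j c \<Longrightarrow> R t u = u"
  let ?I = "{0..1::real}"
  define P where "P = \<psi> ` cube n"
  have cP: "compact P" unfolding P_def by (intro compact_continuous_image \<psi> compact_cube)
  have c1: "continuous_on (?I \<times> cube n) (\<lambda>(t, u). (t, \<psi> u))"
    unfolding split_beta
    by (intro continuous_on_Pair continuous_on_fst continuous_on_id continuous_on_compose2[OF \<psi>] continuous_on_snd) auto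
  have c2: "continuous_on (?I \<times> cube n) (\<lambda>(t, u). \<psi> (R t u))"
    using continuous_on_compose2[OF \<psi> R(1)] R(2) by (auto simp: split_beta image_subset_iff)
  have eq: "(case p of (t, u) \<Rightarrow> \<psi> (R t u)) = (case q of (t, u) \<Rightarrow> \<psi> (R t u))"
    if p: "p \<in> ?I \<times> cube n" and q: "q \<in> ?I \<times> cube n"
      and e: "(case p of (t, u) \<Rightarrow> (t, \<psi> u)) = (case q of (t, u) \<Rightarrow> (t, \<psi> u))" for p q
  proof -
    obtain t u s v where pq: "p = (t, u)" "q = (s, v)" by fastforce
    have ts: "t = s" and uv: "\<psi> u = \<psi> v" using e pq by auto
    have uc: "u \<in> cube n" "v \<in> cube n" using p q pq by auto
    have "\<psi> (R t u) = \<psi> (R t v)"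
    proof (cases "\<psi> u \<in> Y")
      case True
      then have "u \<in> cube_rest n j c" "v \<in> cube_rest n j c" using out[of u] out[of v] uc uv by auto
      then show ?thesis using R(5) uv by simp
    next
      case False
      then have "u \<in> cube n - cube_rest n j c" "v \<in> cube n - cube_rest n j c" using rest uc uv by auto
      then have "u = v" using inj uv unfolding inj_on_def by blast
      then show ?thesis by simp
    qed
    then show ?thesis by (simp add: pq ts)
  qed
  obtain H0 where H0: "continuous_on ((\<lambda>(t, u). (t, \<psi> u)) ` (?I \<times> cube n)) H0"
    "\<And>p. p \<in> ?I \<times> cube n \<Longrightarrow> H0 (case p of (t, u) \<Rightarrow> (t, \<psi> u)) = (case p of (t, u) \<Rightarrow> \<psi> (R t u))"
    using compact_continuous_factor[OF compact_Times[OF compact_Icc compact_cube] c1 c2 eq] by blast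
  have im: "(\<lambda>(t, u). (t, \<psi> u)) ` (?I \<times> cube n) = ?I \<times> P" by (auto simp: P_def image_iff)
  have H0_c: "continuous_on (?I \<times> P) H0" using H0(1) unfolding im .
  have H0_e: "H0 (t, \<psi> u) = \<psi> (R t u)" if "t \<in> ?I" "u \<in> cube n" for t u
    using H0(2)[of "(t, u)"] that by simp
  define H where "H p = (if p \<in> ?I \<times> Y then snd p else H0 p)" for p
  have H_c: "continuous_on (?I \<times> Y \<union> ?I \<times> P) H"
    unfolding H_def
  proof (rule continuous_on_cases)
    show "closed (?I \<times> Y)" "closed (?I \<times> P)"
      using Y compact_imp_closed[OF cP] by (simp_all add: closed_Times)
    show "continuous_on (?I \<times> Y) snd" by (intro continuous_on_snd continuous_on_id)
    show "\<forall>p. p \<in> ?I \<times> Y \<and> p \<notin> ?I \<times> Y \<or> p \<in> ?I \<times> P \<and> p \<in> ?I \<times> Y \<longrightarrow> snd p = H0 p"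
    proof (intro allI impI)
      fix p assume "p \<in> ?I \<times> Y \<and> p \<notin> ?I \<times> Y \<or> p \<in> ?I \<times> P \<and> p \<in> ?I \<times> Y"
      then obtain t u where tu: "p = (t, \<psi> u)" "t \<in> ?I" "u \<in> cube n" "\<psi> u \<in> Y" by (auto simp: P_def)
      then have "u \<in> cube_rest n j c" using out by blast
      then show "snd p = H0 p" using tu R(5) H0_e by simp
    qed
  qed (rule H0_c)
  let ?X = "Y \<union> P"
  have IX: "?I \<times> Y \<union> ?I \<times> P = ?I \<times> ?X" by blast
  have HX: "H (t, x) \<in> ?X" if t: "t \<in> ?I" and x: "x \<in> ?X" for t x
  proof (cases "x \<in> Y")
    case False
    then obtain u where u: "u \<in> cube n" "x = \<psi> u" using x by (auto simp: P_def)
    then show ?thesis using False that H0_e R(2) by (auto simp: H_def P_def)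
  qed (use that in \<open>simp add: H_def\<close>)
  have H_0: "H (0, x) = x" if x: "x \<in> ?X" for x
  proof (cases "x \<in> Y")
    case False
    then obtain u where u: "u \<in> cube n" "x = \<psi> u" using x by (auto simp: P_def)
    then show ?thesis using False H0_e[of 0 u] R(3) by (simp add: H_def)
  qed (simp add: H_def)
  have H_1: "H (1, x) \<in> Y" if x: "x \<in> ?X" for x
  proof (cases "x \<in> Y")
    case False
    then obtain u where u: "u \<in> cube n" "x = \<psi> u" using x by (auto simp: P_def)
    then show ?thesis using False H0_e[of 1 u] R(4)[OF u(1)] rest by (auto simp: H_def)
  qed (simp add: H_def)
  have H_Y: "H (t, x) = x" if "x \<in> Y" "t \<in> ?I" for t x using that by (simp add: H_def)
  define r where "r x = H (1, x)" for x
  have r_c: "continuous_on ?X r" unfolding r_def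
    by (rule continuous_on_compose2[OF H_c[unfolded IX]]) (auto intro!: continuous_on_Pair continuous_on_const continuous_on_id)
  show ?thesis unfolding P_def[symmetric]
  proof (rule deformation_retraction_imp_homotopy_equivalent_space[of _ id r])
    show "retraction_maps (top_of_set ?X) (top_of_set Y) r id"
      unfolding retraction_maps_def using r_c H_1 H_Y
      by (auto simp: continuous_map_in_subtopology r_def)
    have H_c': "continuous_on ({0..1} \<times> ?X) H" using H_c unfolding IX .
    have "homotopic_with (\<lambda>x. True) (top_of_set ?X) (top_of_set ?X) id r"
    proof (subst homotopic_with, simp, intro exI[of _ H] conjI)
      show "continuous_map (prod_topology (top_of_set {0..1}) (top_of_set ?X)) (top_of_set ?X) H"
      proof -
        have "prod_topology (top_of_set {0..1::real}) (top_of_set ?X) = top_of_set ({0..1} \<times> ?X)"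
          by (metis prod_topology_euclidean subtopology_Times)
        moreover have "H \<in> {0..1::real} \<times> ?X \<rightarrow> ?X"
        proof
          fix p assume "p \<in> {0..1::real} \<times> ?X"
          then show "H p \<in> ?X" using HX[of "fst p" "snd p"] by (simp add: mem_Times_iff)
        qed
        ultimately show ?thesis using H_c' by (simp add: continuous_map_in_subtopology)
      qed
    qed (use H_0 in \<open>auto simp: r_def\<close>)
    then show "homotopic_with (\<lambda>x. True) (top_of_set ?X) (top_of_set ?X) (id \<circ> r) id"
      by (simp add: homotopic_with_symD)
  qed
qed

lemma cube_face_map_in: "j < Suc k \<Longrightarrow> c = 0 \<or> c = 1 \<Longrightarrow> v \<in> cube k \<Longrightarrow> cube_face_map j c v \<in> cube (Suc k)"
  by (auto simp: cube_face_map_def cube_eq Rn_def)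

lemma cube_face_map_obtain:
  assumes "u \<in> cube (Suc k)" "j < Suc k" "u j = c"
  obtains v where "v \<in> cube k" "u = cube_face_map j c v" "v \<in> bcube k \<Longrightarrow> u \<in> cube_rest (Suc k) j c"
proof (rule that)
  let ?v = "\<lambda>i. if i < j then u i else u (Suc i)"
  show vc: "?v \<in> cube k" using assms by (auto simp: cube_eq Rn_def)
  show "u = cube_face_map j c ?v"
    using assms(3) by (auto simp: cube_face_map_def fun_eq_iff)
  assume "?v \<in> bcube k"
  then obtain i where i: "i < k" "?v i = 0 \<or> ?v i = 1" by (auto simp: bcube_eq)
  show "u \<in> cube_rest (Suc k) j c"
  proof (cases "i < j")
    case True
    then show ?thesis using i assms(1) by (auto simp: cube_rest_def intro!: exI[of _ i])
  next
    case False
    then show ?thesis using i assms(1) by (auto simp: cube_rest_def intro!: exI[of _ "Suc i"])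
  qed
qed

lemma bcube_cases:
  assumes "u \<in> bcube (Suc k)" "u \<notin> cube_rest (Suc k) j c" "c = 0 \<or> c = 1"
  shows "u j = c"
proof -
  obtain i where i: "i < Suc k" "u i = 0 \<or> u i = 1" "u \<in> cube (Suc k)" using assms(1) by (auto simp: bcube_eq)
  then show ?thesis using assms(2,3) unfolding cube_rest_def by (cases "i = j") auto
qed

lemma closed_cube_rest: "closed (cube_rest n j c)"
proof -
  have eq: "closed {u :: nat \<Rightarrow> real. u i = b}" for i b
    by (intro closed_Collect_eq continuous_on_coord continuous_on_const)
  have "cube_rest n j c = cube n \<inter> ({u. u j = 1 - c} \<union> (\<Union>i\<in>{i. i < n \<and> i \<noteq> j}. {u. u i = 0} \<union> {u. u i = 1}))"
    by (auto simp: cube_rest_def)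
  moreover have "closed \<dots>"
    by (intro closed_Int closed_Un closed_UN compact_imp_closed[OF compact_cube] eq ballI) simp_all
  ultimately show ?thesis by simp
qed

lemma closure_bcube_minus_face:
  assumes "j < Suc k" "c = 0 \<or> c = 1"
  shows "Euclidean_space (Suc k) closure_of (bcube (Suc k) - cube_face_map j c ` cube k) \<subseteq> cube_rest (Suc k) j c"
proof (rule closure_of_minimal)
  show "closedin (Euclidean_space (Suc k)) (cube_rest (Suc k) j c)"
    unfolding Euclidean_space_eq using closed_cube_rest cube_rest_sub cube_sub_Rn
    by (meson closed_subset subset_trans)
  show "bcube (Suc k) - cube_face_map j c ` cube k \<subseteq> cube_rest (Suc k) j c"
  proof
    fix u assume u: "u \<in> bcube (Suc k) - cube_face_map j c ` cube k"
    show "u \<in> cube_rest (Suc k) j c"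
    proof (rule ccontr)
      assume n: "u \<notin> cube_rest (Suc k) j c"
      then have "u j = c" using u bcube_cases assms(2) by blast
      moreover have "u \<in> cube (Suc k)" using u bcube_sub by blast
      ultimately show False using u assms(1) by (metis DiffD2 cube_face_map_obtain imageI)
    qed
  qed
qed

section \<open>Free faces and acyclic matchings\<close>

context cell_system
begin

text \<open>One map \<open>\<psi>\<close> of the cube serves for the cell and, on the face where
  coordinate \<open>j\<close> is \<open>c\<close>, for its free face. The notion refers to the two
  cells and their boundaries alone; that no other cell of a complex has \<open>f\<close> in its
  boundary is expressed by the remaining labels being closed under \<open>bd\<close>.\<close>

definition free_pair :: "'l \<Rightarrow> 'l \<Rightarrow> bool" where
  "free_pair f e \<longleftrightarrow> (\<exists>\<psi> j c. d e = Suc (d f) \<and> j < Suc (d f) \<and> (c = 0 \<or> c = 1) \<and>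
     cell_param (d e) \<psi> (cell e) (\<Union>(cell ` bd e)) \<and>
     cell_param (d f) (\<psi> \<circ> cube_face_map j c) (cell f) (\<Union>(cell ` bd f)) \<and>
     \<psi> ` cube_rest (d e) j c \<subseteq> \<Union>(cell ` (bd e - {f})))"

text \<open>Off \<open>cube_rest\<close> the map \<open>\<psi>\<close> is injective: the interior of
  the cube gives \<open>e\<close>, the interior of the free face gives \<open>f\<close>, and these
  are disjoint from each other and from the remaining cells. So the same cube provides the
  elementary collapse and the deformation behind the homotopy equivalence.\<close>

lemma free_pair_collapse:
  assumes S: "down S" and S': "down (S - {f, e})" and fe: "f \<in> S" "e \<in> S" "free_pair f e"
  shows "elementary_collapse (sub S) (sub (S - {f, e}))"
    and "cw_space (sub S) homotopy_equivalent_space cw_space (sub (S - {f, e}))"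
proof -
  let ?S' = "S - {f, e}"
  obtain \<psi> j c where p: "d e = Suc (d f)" "j < Suc (d f)" "c = 0 \<or> c = 1"
    "cell_param (d e) \<psi> (cell e) (\<Union>(cell ` bd e))"
    "cell_param (d f) (\<psi> \<circ> cube_face_map j c) (cell f) (\<Union>(cell ` bd f))"
    "\<psi> ` cube_rest (d e) j c \<subseteq> \<Union>(cell ` (bd e - {f}))"
    using fe(3) unfolding free_pair_def by blast
  have L: "S \<subseteq> L" "f \<in> L" "e \<in> L" using S fe by (auto simp: down_def)
  have bde: "bd e \<subseteq> S" "e \<notin> bd e" using S fe bd_dim[OF L(3), of e] by (auto simp: down_def)
  have ne: "f \<noteq> e" using p(1) by auto
  have rest: "bd e - {f} \<subseteq> {l \<in> ?S'. d l < d e}" using bde bd_dim[OF L(3)] by auto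
  have notin: "cell f \<inter> \<Union>(cell ` ?S') = {}" "cell e \<inter> \<Union>(cell ` ?S') = {}"
    by (rule cell_Union_disjoint; use L in blast)+
  show "elementary_collapse (sub S) (sub ?S')"
    unfolding elementary_collapse_def
  proof (intro conjI exI)
    show "finite_cw_complex (sub S)" by (rule finite_cw_sub[OF S])
    show "cw_subcomplex (sub ?S') (sub S)" by (rule cw_subcomplex_sub[OF S S']) auto
    show "cell f \<in> cw_ncells (sub S) (d f)" "cell e \<in> cw_ncells (sub S) (Suc (d f))"
      using fe p(1) by (auto simp: sub_def)
    show "cell f \<notin> cw_cells (sub ?S')" "cell e \<notin> cw_cells (sub ?S')"
      unfolding cw_cells_sub using inj_on_image_mem_iff[OF cell_inj, of _ ?S'] L by auto
    show "cw_cells (sub S) = cw_cells (sub ?S') \<union> {cell f, cell e}"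
      using fe by (auto simp: cw_cells_sub)
    show "j < Suc (d f)" "c = 0 \<or> c = 1" by (rule p)+
    show "characteristic_map (sub S) (Suc (d f)) (cell e) (cube (Suc (d f))) (bcube (Suc (d f))) \<psi>"
      using cube_characteristic_map[OF S fe(2) p(4)] p(1) by simp
    show "characteristic_map (sub S) (d f) (cell f) (cube (d f)) (bcube (d f)) (\<psi> \<circ> cube_face_map j c)"
      by (rule cube_characteristic_map[OF S fe(1) p(5)])
    have "\<psi> ` cube_rest (Suc (d f)) j c \<subseteq> \<Union>(cell ` {l \<in> ?S'. d l < Suc (d f)})"
      using p(6) rest unfolding p(1) by blast
    then show "\<psi> ` (Euclidean_space (Suc (d f)) closure_of (bcube (Suc (d f)) - cube_face_map j c ` cube (d f)))
      \<subseteq> skel_below (sub ?S') (Suc (d f))"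
      unfolding skel_below_sub using closure_bcube_minus_face[OF p(2,3)] by (meson image_mono subset_trans)
  qed
  let ?Y = "\<Union>(cell ` ?S')"
  let ?R = "cube_rest (d e) j c"
  have \<psi>: "continuous_on (cube (d e)) \<psi>" "inj_on \<psi> (cube (d e) - bcube (d e))"
    "\<psi> ` (cube (d e) - bcube (d e)) = cell e" "\<psi> ` bcube (d e) \<subseteq> \<Union>(cell ` bd e)"
    using p(4) by (auto simp: cell_param_def)
  have \<phi>: "inj_on (\<psi> \<circ> cube_face_map j c) (cube (d f) - bcube (d f))"
    "(\<psi> \<circ> cube_face_map j c) ` (cube (d f) - bcube (d f)) = cell f"
    using p(5) by (auto simp: cell_param_def)
  have face: "\<exists>v\<in>cube (d f) - bcube (d f). u = cube_face_map j c v" if u: "u \<in> bcube (d e)" "u \<notin> ?R" for u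
  proof -
    have "u j = c" using bcube_cases[of u "d f" j c] u p(1,3) by simp
    moreover have "u \<in> cube (Suc (d f))" using u(1) bcube_sub p(1) by auto
    ultimately obtain v where "v \<in> cube (d f)" "u = cube_face_map j c v" "v \<in> bcube (d f) \<Longrightarrow> u \<in> cube_rest (Suc (d f)) j c"
      using p(2) by (metis cube_face_map_obtain)
    then show ?thesis using u(2) p(1) by auto
  qed
  have cell_e: "\<psi> u \<in> cell e" if "u \<in> cube (d e)" "u \<notin> bcube (d e)" for u using that \<psi>(3) by blast
  have cell_f: "\<psi> u \<in> cell f" if u: "u \<in> bcube (d e)" "u \<notin> ?R" for u
    using face[OF u] \<phi>(2) by auto
  have ef: "cell e \<inter> cell f = {}" using disjoint L ne by blast
  have "top_of_set (?Y \<union> \<psi> ` cube (d e)) homotopy_equivalent_space top_of_set ?Y"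
  proof (rule cube_push_homotopy_equivalent)
    show "j < d e" "c = 0 \<or> c = 1" using p by auto
    show "closed ?Y" by (rule compact_imp_closed[OF compact_sub[OF S']])
    show "\<psi> ` ?R \<subseteq> ?Y" using p(6) rest by blast
    show "\<psi> u \<notin> ?Y" if "u \<in> cube (d e) - ?R" for u
      using that cell_e[of u] cell_f[of u] notin by blast
    show "inj_on \<psi> (cube (d e) - ?R)"
    proof
      fix u v assume u: "u \<in> cube (d e) - ?R" and v: "v \<in> cube (d e) - ?R" and uv: "\<psi> u = \<psi> v"
      show "u = v"
      proof (cases "u \<in> bcube (d e)")
        case True
        then have "\<psi> v \<in> cell f" using cell_f[of u] u uv by simp
        then have "v \<in> bcube (d e)" using cell_e[of v] v ef by blast
        then obtain u' v' where uv': "u' \<in> cube (d f) - bcube (d f)" "u = cube_face_map j c u'"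
          "v' \<in> cube (d f) - bcube (d f)" "v = cube_face_map j c v'" using face u v True by (metis DiffD2)
        then have "u' = v'" using inj_onD[OF \<phi>(1), of u' v'] uv by simp
        then show ?thesis using uv' by simp
      next
        case False
        then have "\<psi> v \<in> cell e" using cell_e[of u] u uv by simp
        then have "v \<notin> bcube (d e)" using cell_f[of v] v ef by blast
        then show ?thesis using False u v inj_onD[OF \<psi>(2), of u v] uv by simp
      qed
    qed
  qed (rule \<psi>(1))
  moreover have "?Y \<union> \<psi> ` cube (d e) = \<Union>(cell ` S)"
  proof (intro equalityI subsetI)
    fix x assume "x \<in> ?Y \<union> \<psi> ` cube (d e)"
    then show "x \<in> \<Union>(cell ` S)"
    proof
      assume "x \<in> \<psi> ` cube (d e)"
      then obtain u where "u \<in> cube (d e)" "x = \<psi> u" by blast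
      then show ?thesis using cell_e[of u] \<psi>(4) bde(1) fe(2) by (cases "u \<in> bcube (d e)") blast+
    qed blast
  next
    fix x assume "x \<in> \<Union>(cell ` S)"
    then consider "x \<in> ?Y" | "x \<in> cell e" | "x \<in> cell f" by blast
    then show "x \<in> ?Y \<union> \<psi> ` cube (d e)"
    proof cases
      case 2 then show ?thesis using \<psi>(3) by blast
    next
      case 3
      then obtain v where "v \<in> cube (d f)" "x = \<psi> (cube_face_map j c v)" using \<phi>(2) by auto
      then show ?thesis using cube_face_map_in[OF p(2,3)] p(1) by auto
    qed blast
  qed
  ultimately show "cw_space (sub S) homotopy_equivalent_space cw_space (sub ?S')"
    by (simp add: cw_space_sub)
qed

text \<open>A matching as in discrete Morse theory, of \<open>f\<close> with \<open>\<pi> f\<close>.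
  Apart from \<open>A\<close> and the free face itself, the boundaries of the cells of a pair
  consist of cells from pairs of lower rank. A pair of highest rank is therefore in the boundary of
  no cell outside it and can be removed first.\<close>

lemma acyclic_matching_collapse:
  assumes A: "down A" and Q: "finite Q" "Q \<subseteq> L" "\<pi> ` Q \<subseteq> L"
    and disj: "Q \<inter> A = {}" "\<pi> ` Q \<inter> A = {}" "Q \<inter> \<pi> ` Q = {}" "inj_on \<pi> Q"
    and free: "\<And>f. f \<in> Q \<Longrightarrow> free_pair f (\<pi> f)"
    and rank: "\<And>g. g \<in> Q \<Longrightarrow> bd g \<union> bd (\<pi> g) \<subseteq>
      A \<union> {g} \<union> {f \<in> Q. \<rho> f < \<rho> g} \<union> \<pi> ` {f \<in> Q. \<rho> f < (\<rho> g :: nat)}"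
  shows "down (A \<union> Q \<union> \<pi> ` Q)" and "collapses_to (sub (A \<union> Q \<union> \<pi> ` Q)) (sub A)"
    and "cw_space (sub (A \<union> Q \<union> \<pi> ` Q)) homotopy_equivalent_space cw_space (sub A)"
proof -
  have "down (A \<union> Q \<union> \<pi> ` Q) \<and> collapses_to (sub (A \<union> Q \<union> \<pi> ` Q)) (sub A) \<and>
    cw_space (sub (A \<union> Q \<union> \<pi> ` Q)) homotopy_equivalent_space cw_space (sub A)"
    using Q disj free rank
  proof (induction "card Q" arbitrary: Q)
    case 0
    then have "Q = {}" by simp
    then show ?case using A by (simp add: collapses_to_def homotopy_equivalent_space_refl)
  next
    case (Suc k)
    have "Q \<noteq> {}" using Suc.hyps(2) by auto
    then have "Max (\<rho> ` Q) \<in> \<rho> ` Q" using Suc.prems(1) by (intro Max_in) auto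
    then obtain g where g0: "g \<in> Q" "\<rho> g = Max (\<rho> ` Q)" by auto
    have g: "g \<in> Q" "\<And>f. f \<in> Q \<Longrightarrow> \<rho> f \<le> \<rho> g" using g0 Suc.prems(1) by simp_all
    define Q' where "Q' = Q - {g}"
    have sub: "Q' \<subseteq> Q" "g \<notin> Q'" "Q = insert g Q'" using g(1) by (auto simp: Q'_def)
    \<comment> \<open>Removing \<open>g\<close> does not affect the rank condition for the other
      pairs, since no rank exceeds that of \<open>g\<close>.\<close>
    have less: "{f \<in> Q. \<rho> f < \<rho> h} = {f \<in> Q'. \<rho> f < \<rho> h}" if "h \<in> Q" for h
      using g(2)[OF that] by (auto simp: Q'_def)
    have IH: "down (A \<union> Q' \<union> \<pi> ` Q') \<and> collapses_to (sub (A \<union> Q' \<union> \<pi> ` Q')) (sub A) \<and>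
      cw_space (sub (A \<union> Q' \<union> \<pi> ` Q')) homotopy_equivalent_space cw_space (sub A)"
    proof (rule Suc.hyps(1))
      show "k = card Q'" using Suc.hyps(2) Suc.prems(1) g(1) by (simp add: Q'_def)
      show "finite Q'" using Suc.prems(1) by (simp add: Q'_def)
      show "Q' \<subseteq> L" "\<pi> ` Q' \<subseteq> L" "Q' \<inter> A = {}" "\<pi> ` Q' \<inter> A = {}" "Q' \<inter> \<pi> ` Q' = {}"
        using Suc.prems(2-6) sub(1) by blast+
      show "inj_on \<pi> Q'" using Suc.prems(7) sub(1) by (rule inj_on_subset)
      show "free_pair f (\<pi> f)" if "f \<in> Q'" for f using Suc.prems(8) that sub(1) by blast
      show "bd h \<union> bd (\<pi> h) \<subseteq> A \<union> {h} \<union> {f \<in> Q'. \<rho> f < \<rho> h} \<union> \<pi> ` {f \<in> Q'. \<rho> f < \<rho> h}"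
        if "h \<in> Q'" for h
      proof -
        have h: "h \<in> Q" using that sub(1) by blast
        show ?thesis using Suc.prems(9)[OF h] unfolding less[OF h] .
      qed
    qed
    let ?S = "A \<union> Q \<union> \<pi> ` Q"
    have S': "?S - {g, \<pi> g} = A \<union> Q' \<union> \<pi> ` Q'"
    proof -
      have "g \<notin> A" "\<pi> g \<notin> A" "g \<notin> \<pi> ` Q" "\<pi> g \<notin> Q" using Suc.prems(4-6) g(1) by blast+
      moreover have "\<pi> g \<notin> \<pi> ` Q'" using Suc.prems(7) g(1) sub by (auto simp: inj_on_def)
      ultimately show ?thesis using sub by auto
    qed
    have bdg: "bd g \<union> bd (\<pi> g) \<subseteq> A \<union> {g} \<union> Q' \<union> \<pi> ` Q'"
      using Suc.prems(9)[OF g(1)] unfolding less[OF g(1)] by blast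
    have downS: "down ?S"
      unfolding down_def
    proof (intro conjI ballI)
      show "?S \<subseteq> L" using A Suc.prems(2,3) by (auto simp: down_def)
      fix l assume "l \<in> ?S"
      then consider "l = g \<or> l = \<pi> g" | "l \<in> A \<union> Q' \<union> \<pi> ` Q'" unfolding S'[symmetric] by blast
      then show "bd l \<subseteq> ?S"
      proof cases
        case 1
        then have "bd l \<subseteq> A \<union> {g} \<union> Q' \<union> \<pi> ` Q'" using bdg by blast
        then show ?thesis using sub g(1) by blast
      next
        case 2
        then have "bd l \<subseteq> A \<union> Q' \<union> \<pi> ` Q'" using IH by (simp add: down_def)
        then show ?thesis using sub by blast
      qed
    qed
    have pair: "g \<in> ?S" "\<pi> g \<in> ?S" "free_pair g (\<pi> g)" using g(1) Suc.prems(8) by auto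
    have "down (?S - {g, \<pi> g})" unfolding S' using IH by blast
    note col = free_pair_collapse[OF downS this pair, unfolded S']
    have "collapses_to (sub ?S) (sub A)"
      unfolding collapses_to_def
      by (rule converse_rtranclp_into_rtranclp[OF _ IH[THEN conjunct2, THEN conjunct1, unfolded collapses_to_def]])
        (use col(1) in blast)
    moreover have "cw_space (sub ?S) homotopy_equivalent_space cw_space (sub A)"
      using col(2) IH homotopy_eqv_trans by blast
    ultimately show ?case using downS by blast
  qed
  then show "down (A \<union> Q \<union> \<pi> ` Q)" and "collapses_to (sub (A \<union> Q \<union> \<pi> ` Q)) (sub A)"
    and "cw_space (sub (A \<union> Q \<union> \<pi> ` Q)) homotopy_equivalent_space cw_space (sub A)" by blast+
qed

end

section \<open>The mapping cylinder\<close>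

text \<open>Stick breaking maps the cube of dimension \<open>length xs - 1\<close> onto the simplex \<open>set xs\<close>; the face of the cube where
  the last coordinate vanishes goes to the face opposite to the head of \<open>xs\<close>.\<close>

primrec stick :: "'v list \<Rightarrow> (nat \<Rightarrow> real) \<Rightarrow> 'v \<Rightarrow> real" where
  "stick [] u = (\<lambda>_. 0)"
| "stick (a # xs) u = (if xs = [] then (\<lambda>v. if v = a then 1 else 0)
     else (\<lambda>v. if v = a then u (length xs - 1) else (1 - u (length xs - 1)) * stick xs u v))"

lemma stick_Cons:
  "xs \<noteq> [] \<Longrightarrow> stick (a # xs) u v = (if v = a then u (length xs - 1) else (1 - u (length xs - 1)) * stick xs u v)"
  by simp

lemma length_pred_less: "xs \<noteq> [] \<Longrightarrow> length xs - 1 < length (a # xs) - 1"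
  by simp

lemma stick_cong: "(\<And>i. i < length xs - 1 \<Longrightarrow> u i = u' i) \<Longrightarrow> stick xs u = stick xs u'"
proof (induction xs)
  case (Cons a xs)
  show ?case
  proof (cases "xs = []")
    case False
    note l = length_pred_less[OF False, of a]
    have "stick xs u = stick xs u'" using Cons.prems l by (intro Cons.IH) (meson less_trans)
    then show ?thesis using Cons.prems[OF l] by (simp only: fun_eq_iff stick_Cons[OF False]) simp
  qed simp
qed simp

lemma continuous_stick: "continuous_on S (stick xs)"
proof (induction xs)
  case (Cons a xs)
  show ?case
  proof (cases "xs = []")
    case False
    have "continuous_on S (\<lambda>u. stick (a # xs) u v)" for v
      using False continuous_on_product_then_coordinatewise[OF Cons]
      by (cases "v = a") (auto intro!: continuous_on_coord continuous_on_mult continuous_on_diff continuous_on_const)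
    then show ?thesis by (rule continuous_on_coordinatewise_then_product)
  qed (simp add: continuous_on_const)
qed (simp add: continuous_on_const)

lemma stick_outside: "v \<notin> set xs \<Longrightarrow> stick xs u v = 0"
  by (induction xs) auto

lemma stick_sum: "distinct xs \<Longrightarrow> xs \<noteq> [] \<Longrightarrow> sum (stick xs u) (set xs) = 1"
proof (induction xs)
  case (Cons a xs)
  show ?case
  proof (cases "xs = []")
    case False
    have "sum (stick (a # xs) u) (set xs) = (1 - u (length xs - 1)) * sum (stick xs u) (set xs)"
      unfolding sum_distrib_left using Cons.prems False by (intro sum.cong) auto
    then show ?thesis using Cons False by simp
  qed simp
qed simp

lemma stick_nonneg: "(\<And>i. i < length xs - 1 \<Longrightarrow> 0 \<le> u i \<and> u i \<le> 1) \<Longrightarrow> 0 \<le> stick xs u v"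
proof (induction xs)
  case (Cons a xs)
  show ?case
  proof (cases "xs = []")
    case False
    note l = length_pred_less[OF False, of a]
    have "0 \<le> stick xs u v" using Cons.prems l by (intro Cons.IH) (meson less_trans)
    then show ?thesis using Cons.prems[OF l] unfolding stick_Cons[OF False] by auto
  qed simp
qed simp

lemma stick_pos:
  "(\<And>i. i < length xs - 1 \<Longrightarrow> 0 < u i \<and> u i < 1) \<Longrightarrow> v \<in> set xs \<Longrightarrow> 0 < stick xs u v"
proof (induction xs)
  case (Cons a xs)
  show ?case
  proof (cases "xs = []")
    case False
    note l = length_pred_less[OF False, of a]
    have "v \<in> set xs \<Longrightarrow> 0 < stick xs u v" using Cons.prems l by (intro Cons.IH) (meson less_trans)
    then show ?thesis using Cons.prems(1)[OF l] Cons.prems(2) unfolding stick_Cons[OF False] by auto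
  qed (use Cons.prems in simp)
qed simp

lemma stick_boundary_Cons:
  assumes "a \<notin> set xs" "xs \<noteq> []"
    and "u (length xs - 1) = 1 \<or> (\<exists>v\<in>set xs. stick xs u v = 0)"
  shows "\<exists>v\<in>set xs. stick (a # xs) u v = 0"
proof -
  obtain b where "b \<in> set xs" using assms(2) by (cases xs) auto
  then show ?thesis using assms unfolding stick_Cons[OF assms(2)] by force
qed

text \<open>A coordinate 0 leaves the corresponding vertex without mass, and a coordinate 1 leaves
  nothing for the vertices after it in the list.\<close>

lemma stick_boundary:
  "distinct xs \<Longrightarrow> i < length xs - 1 \<Longrightarrow> u i = 0 \<or> u i = 1 \<Longrightarrow> \<exists>v\<in>set xs. stick xs u v = 0"
proof (induction xs)
  case (Cons a xs)
  then have ne: "xs \<noteq> []" by auto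
  show ?case
  proof (cases "i = length xs - 1 \<and> u i = 0")
    case True
    then show ?thesis using ne by (intro bexI[of _ a]) auto
  next
    case False
    have "u (length xs - 1) = 1 \<or> (\<exists>v\<in>set xs. stick xs u v = 0)"
    proof (cases "i = length xs - 1")
      case True then show ?thesis using False Cons.prems by auto
    next
      case False then show ?thesis using Cons by auto
    qed
    then show ?thesis using stick_boundary_Cons[OF _ ne] Cons.prems(1) by (metis distinct.simps(2) list.set_intros(2))
  qed
qed simp

text \<open>The mass of the head is a coordinate. As long as something is left over, the factor in
  front of the tail can be cancelled and the next coordinate read off.\<close>

lemma stick_inj:
  "distinct xs \<Longrightarrow> (\<And>i. i < length xs - 1 \<Longrightarrow> u i < 1) \<Longrightarrow>
    stick xs u = stick xs u' \<Longrightarrow> i < length xs - 1 \<Longrightarrow> u i = u' i"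
proof (induction xs)
  case (Cons a xs)
  then have ne: "xs \<noteq> []" by auto
  note l = length_pred_less[OF ne, of a]
  have e: "stick (a # xs) u v = stick (a # xs) u' v" for v using Cons.prems(3) by simp
  have t: "u (length xs - 1) = u' (length xs - 1)" using e[of a] ne by simp
  have lt: "u (length xs - 1) < 1" by (rule Cons.prems(2)[OF l])
  have "stick xs u v = stick xs u' v" for v
  proof (cases "v = a")
    case True then show ?thesis using Cons.prems(1) by (simp add: stick_outside)
  next
    case False then show ?thesis using e[of v] t lt unfolding stick_Cons[OF ne] by simp
  qed
  then have s: "stick xs u = stick xs u'" by blast
  show ?case
  proof (cases "i = length xs - 1")
    case True then show ?thesis using t by simp
  next
    case False
    have "u k < 1" if "k < length xs - 1" for k using that l by (intro Cons.prems(2)) (rule less_trans)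
    then show ?thesis using Cons.prems(1,4) False s by (intro Cons.IH) auto
  qed
qed simp

lemma stick_surj:
  assumes "distinct xs" "xs \<noteq> []" "x \<in> open_simplex (set xs)"
  shows "\<exists>u. (\<forall>i<length xs - 1. 0 < u i \<and> u i < 1) \<and> stick xs u = x"
  using assms
proof (induction xs arbitrary: x)
  case (Cons a xs)
  have x: "\<And>v. v = a \<or> v \<in> set xs \<Longrightarrow> 0 < x v" "\<And>v. v \<noteq> a \<Longrightarrow> v \<notin> set xs \<Longrightarrow> x v = 0"
    "x a + sum x (set xs) = 1"
    using Cons.prems by (auto simp: open_simplex_def)
  show ?case
  proof (cases "xs = []")
    case True
    then show ?thesis using x by (auto simp: fun_eq_iff)
  next
    case False
    have "0 < sum x (set xs)" using x(1) False by (intro sum_pos) auto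
    then have lt: "x a < 1" using x(3) by linarith
    \<comment> \<open>The tail is rescaled to total mass 1, which undoes the factor in
      \<open>stick\<close>.\<close>
    define y where "y v = (if v = a then 0 else x v / (1 - x a))" for v
    have "sum y (set xs) = sum x (set xs) / (1 - x a)"
      unfolding sum_divide_distrib y_def using Cons.prems(1) by (intro sum.cong) auto
    then have "y \<in> open_simplex (set xs)"
      using x lt Cons.prems(1) by (auto simp: open_simplex_def y_def)
    then obtain u where u: "\<forall>i<length xs - 1. 0 < u i \<and> u i < 1" "stick xs u = y"
      using Cons.IH Cons.prems(1) False by auto
    define u' where "u' = u(length xs - 1 := x a)"
    have "stick xs u' = y" unfolding u(2)[symmetric] by (rule stick_cong) (simp add: u'_def)
    then have "stick (a # xs) u' = x"
      unfolding fun_eq_iff stick_Cons[OF False] using lt by (auto simp: u'_def y_def)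
    moreover have "0 < u' i \<and> u' i < 1" if "i < length (a # xs) - 1" for i
      using that u(1) x(1)[of a] lt by (auto simp: u'_def)
    ultimately show ?thesis by blast
  qed
qed simp

lemma open_simplex_disjoint:
  "x \<in> open_simplex \<sigma> \<Longrightarrow> x \<in> open_simplex \<tau> \<Longrightarrow> \<sigma> = \<tau>"
  unfolding open_simplex_def by (metis (mono_tags, lifting) less_irrefl mem_Collect_eq subsetI subset_antisym)

section \<open>Simplicial complexes with numbered vertices, and the effect of peeling on
  simplices\<close>

text \<open>The number \<open>N\<close> lies above all vertices and is an artificial critical one.
  The condition \<open>dominated\<close> speaks only of simplices with top vertex \<open>i\<close>,
  since these are the ones from which \<open>i\<close> is peeled.\<close>

locale ordered_complex = peeling +
  fixes K :: "nat set set" and N :: nat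
  assumes K: "simplicial_cpx K" "finite K" and bounded: "\<sigma> \<in> K \<Longrightarrow> \<sigma> \<subseteq> {..<N}" and apex: "N \<in> crit"
    and dominated: "\<sigma> \<in> K \<Longrightarrow> i \<in> \<sigma> \<Longrightarrow> \<sigma> \<subseteq> {..i} \<Longrightarrow> i \<notin> crit \<Longrightarrow> insert (\<alpha> i) \<sigma> \<in> K"
begin

lemma K_finite: "\<sigma> \<in> K \<Longrightarrow> finite \<sigma>" and K_nonempty: "\<sigma> \<in> K \<Longrightarrow> \<sigma> \<noteq> {}"
  and K_sub: "\<sigma> \<in> K \<Longrightarrow> \<tau> \<subseteq> \<sigma> \<Longrightarrow> \<tau> \<noteq> {} \<Longrightarrow> \<tau> \<in> K"
  using K(1) unfolding simplicial_cpx_def by blast+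

lemma card_pos: "\<sigma> \<in> K \<Longrightarrow> 0 < card \<sigma>"
  using K_finite K_nonempty by (simp add: card_gt_0_iff)

definition Kcrit :: "nat set set" where
  "Kcrit = {\<sigma> \<in> K. Max \<sigma> \<in> crit}"

text \<open>The cell map of \<open>F N\<close>: the open simplex \<open>\<sigma>\<close> goes to the cell of the core labelled \<open>peel N \<sigma>\<close>.\<close>

primrec peel :: "nat \<Rightarrow> nat set \<Rightarrow> nat set" where
  "peel 0 \<sigma> = \<sigma>"
| "peel (Suc i) \<sigma> = (if i \<in> \<sigma> then if i \<in> crit then \<sigma> else peel i (insert (\<alpha> i) (\<sigma> - {i})) else peel i \<sigma>)"

lemma push_open_simplex:
  assumes "x \<in> open_simplex \<sigma>" "finite \<sigma>" "i \<in> \<sigma>" "i \<notin> crit"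
  shows "push i x \<in> open_simplex (insert (\<alpha> i) (\<sigma> - {i}))"
proof -
  let ?a = "\<alpha> i"
  have ai: "?a \<noteq> i" using \<alpha>_less[OF assms(4)] by simp
  have x: "\<And>v. v \<in> \<sigma> \<Longrightarrow> 0 < x v" "\<And>v. v \<notin> \<sigma> \<Longrightarrow> x v = 0" "sum x \<sigma> = 1" using assms(1) by (auto simp: open_simplex_def)
  have x0: "0 \<le> x v" for v using x(1,2)[of v] by (cases "v \<in> \<sigma>") auto
  have p: "push i x v = (if v = ?a then x ?a + x i else if v = i then 0 else x v)" for v by (simp add: push_def)
  let ?r = "\<sigma> - {i} - {?a}"
  have "sum (push i x) (insert ?a (\<sigma> - {i})) = x ?a + x i + sum (push i x) ?r"
    using assms(2) by (simp add: sum.insert_remove p)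
  also have "sum (push i x) ?r = sum x ?r" by (intro sum.cong) (auto simp: p)
  also have "x ?a + x i + sum x ?r = sum x \<sigma>"
  proof -
    have "sum x \<sigma> = x i + sum x (\<sigma> - {i})" using assms(2,3) by (rule sum.remove)
    moreover have "sum x (\<sigma> - {i}) = x ?a + sum x ?r"
      using assms(2) x(2)[of ?a] ai by (cases "?a \<in> \<sigma>") (auto simp: sum.remove[of "\<sigma> - {i}" ?a])
    ultimately show ?thesis by simp
  qed
  finally have "sum (push i x) (insert ?a (\<sigma> - {i})) = 1" using x(3) by simp
  moreover have "0 < push i x v" if "v \<in> insert ?a (\<sigma> - {i})" for v
    using that x(1) x0[of ?a] assms(3) by (auto simp: p add_nonneg_pos)
  moreover have "push i x v = 0" if "v \<notin> insert ?a (\<sigma> - {i})" for v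
    using that x(2) by (auto simp: p)
  ultimately show ?thesis by (simp add: open_simplex_def)
qed

text \<open>One induction serves all claims, since they rest on the same step from
  \<open>\<sigma>\<close> to \<open>insert (\<alpha> i) (\<sigma> - {i})\<close>: this is a simplex
  by \<open>dominated\<close>, it has no more vertices than \<open>\<sigma>\<close>, and its top
  vertex is lower. The strict drop of the top vertex is what later makes the matching
  acyclic.\<close>

lemma peel_properties:
  assumes "\<sigma> \<in> K" "\<sigma> \<subseteq> {..<i}"
  shows "peel i \<sigma> \<in> Kcrit \<and> card (peel i \<sigma>) \<le> card \<sigma> \<and>
    (if Max \<sigma> \<in> crit then peel i \<sigma> = \<sigma> else Max (peel i \<sigma>) < Max \<sigma>) \<and>
    (\<forall>x\<in>open_simplex \<sigma>. \<exists>x'\<in>open_simplex (peel i \<sigma>). F i x = F i x')"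
  using assms
proof (induction i arbitrary: \<sigma>)
  case 0
  then show ?case using K_nonempty by auto
next
  case (Suc i)
  have fin: "finite \<sigma>" using K_finite Suc.prems(1) by blast
  show ?case
  proof (cases "i \<in> \<sigma>")
    case False
    then have sub: "\<sigma> \<subseteq> {..<i}" using Suc.prems(2) by (auto simp: less_Suc_eq)
    have F: "F (Suc i) x = F i x" if "x \<in> open_simplex \<tau>" "i \<notin> \<tau>" for x \<tau>
      using that by (intro F_Suc_zero) (auto simp: open_simplex_def)
    note IH = Suc.IH[OF Suc.prems(1) sub]
    have "peel i \<sigma> \<in> K" using IH by (simp add: Kcrit_def)
    have "i \<notin> peel i \<sigma>"
    proof
      assume "i \<in> peel i \<sigma>"
      then have "i \<le> Max (peel i \<sigma>)" using K_finite \<open>peel i \<sigma> \<in> K\<close> by simp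
      moreover have "Max (peel i \<sigma>) \<le> Max \<sigma>" using IH by (auto split: if_splits)
      moreover have "Max \<sigma> < i" using sub fin K_nonempty[OF Suc.prems(1)] by auto
      ultimately show False by simp
    qed
    then show ?thesis using IH False F[of _ \<sigma>] F[of _ "peel i \<sigma>"] by (simp del: F.simps)
  next
    case True
    have Max: "Max \<sigma> = i" using Suc.prems(2) True fin by (intro Max_eqI) auto
    show ?thesis
    proof (cases "i \<in> crit")
      case True
      then show ?thesis using \<open>i \<in> \<sigma>\<close> Suc.prems(1) Max by (auto simp: Kcrit_def simp del: F.simps)
    next
      case False
      define \<tau> where "\<tau> = insert (\<alpha> i) (\<sigma> - {i})"
      have "insert (\<alpha> i) \<sigma> \<in> K" using Suc.prems True False by (intro dominated[of _ i]) auto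
      then have \<tau>K: "\<tau> \<in> K" by (rule K_sub) (auto simp: \<tau>_def)
      have \<tau>i: "\<tau> \<subseteq> {..<i}" using Suc.prems(2) \<alpha>_less[OF False] by (auto simp: \<tau>_def less_Suc_eq)
      have card: "card \<tau> \<le> card \<sigma>"
        using fin True card_insert_le_m1[of "card \<sigma>" "\<sigma> - {i}" "\<alpha> i"] card_gt_0_iff[of \<sigma>] by (auto simp: \<tau>_def)
      note IH = Suc.IH[OF \<tau>K \<tau>i]
      have "Max \<tau> < i" using \<tau>i K_finite[OF \<tau>K] K_nonempty[OF \<tau>K] by auto
      then have m: "Max (peel i \<tau>) < i" using IH by (auto split: if_splits)
      have "\<exists>x'\<in>open_simplex (peel i \<tau>). F (Suc i) x = F (Suc i) x'" if x: "x \<in> open_simplex \<sigma>" for x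
      proof -
        have "push i x \<in> open_simplex \<tau>" unfolding \<tau>_def using push_open_simplex[OF x fin True False] .
        then obtain x' where x': "x' \<in> open_simplex (peel i \<tau>)" "F i (push i x) = F i x'" using IH by blast
        have "finite (peel i \<tau>)" using IH K_finite by (simp add: Kcrit_def)
        then have "i \<notin> peel i \<tau>" using m Max_ge leD by blast
        then have "F (Suc i) x' = F i x'" using x'(1) by (intro F_Suc_zero) (auto simp: open_simplex_def)
        then show ?thesis using x' False by (intro bexI[of _ x']) (simp_all)
      qed
      moreover have "peel (Suc i) \<sigma> = peel i \<tau>" using True False by (simp add: \<tau>_def)
      ultimately show ?thesis using IH card m Max False by (simp del: F.simps peel.simps)
    qed
  qed
qed

text \<open>The highest vertex of \<open>\<sigma> \<union> \<tau>\<close> is the top vertex of one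
  of the two, hence critical and of positive mass, and its record determines the whole
  point.\<close>

lemma F_inj_crit:
  assumes "\<sigma> \<in> Kcrit" "\<tau> \<in> Kcrit" "\<sigma> \<union> \<tau> \<subseteq> {..<i}" "x \<in> open_simplex \<sigma>" "y \<in> open_simplex \<tau>" "F i x = F i y"
  shows "x = y"
  using assms(3,6)
proof (induction i)
  case 0
  then show ?case using assms(1) K_nonempty by (auto simp: Kcrit_def)
next
  case (Suc i)
  have nn: "0 \<le> x v" "0 \<le> y v" "v \<in> \<sigma> \<longleftrightarrow> 0 < x v" "v \<in> \<tau> \<longleftrightarrow> 0 < y v" for v
    using assms(4,5) unfolding open_simplex_def by (smt (verit) mem_Collect_eq)+
  have fin: "finite \<sigma>" "finite \<tau>" "\<sigma> \<noteq> {}" "\<tau> \<noteq> {}" using assms(1,2) K_finite K_nonempty by (auto simp: Kcrit_def)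
  show ?case
  proof (cases "i \<in> \<sigma> \<or> i \<in> \<tau>")
    case True
    have "i \<in> crit"
    proof (cases "i \<in> \<sigma>")
      case True
      have "Max \<sigma> = i" using Suc.prems(1) True fin by (intro Max_eqI) auto
      then show ?thesis using assms(1) by (simp add: Kcrit_def)
    next
      case False
      then have "Max \<tau> = i" using Suc.prems(1) True fin by (intro Max_eqI) auto
      then show ?thesis using assms(2) by (simp add: Kcrit_def)
    qed
    then have R: "x i = y i \<and> (0 < x i \<longrightarrow> x = y) \<and> (x i = 0 \<longrightarrow> F i x = F i y)"
      by (rule F_Suc_crit[THEN iffD1, OF _ nn(1) nn(2) Suc.prems(2)])
    then have "x i = y i" by (rule conjunct1)
    then have "0 < x i" using True unfolding nn(3) nn(4) by simp
    with R show ?thesis by blast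
  next
    case False
    then have "x i = 0" "y i = 0" using nn(1,2)[of i] nn(3,4)[of i] by auto
    then have "F i x = F i y" using Suc.prems(2) F_Suc_zero by metis
    moreover have "\<sigma> \<union> \<tau> \<subseteq> {..<i}" using Suc.prems(1) False by (auto simp: less_Suc_eq)
    ultimately show ?thesis using Suc.IH by blast
  qed
qed

end

section \<open>Cells and boundaries of the mapping cylinder\<close>

context ordered_complex
begin

text \<open>The mapping cylinder of \<open>F N\<close> is the image of \<open>G\<close>: the cylinder parameter is the mass of the apex \<open>N\<close>.\<close>

definition G :: "real \<Rightarrow> (nat \<Rightarrow> real) \<Rightarrow> nat \<Rightarrow> real" where
  "G s x = F (Suc N) (x(N := s))"

lemma continuous_G: "continuous_on S f \<Longrightarrow> continuous_on S g \<Longrightarrow> continuous_on S (\<lambda>p. G (f p) (g p))"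
  unfolding G_def
  by (rule continuous_on_compose2[OF continuous_F]) (auto intro: continuous_on_fun_upd)

lemma G_eq_iff:
  assumes "0 \<le> s" "0 \<le> s'" "x N = 0" "x' N = 0"
  shows "G s x = G s' x' \<longleftrightarrow> s = s' \<and> (0 < s \<longrightarrow> x = x') \<and> (s = 0 \<longrightarrow> F N x = F N x')"
proof -
  have "x(N := s) = x'(N := s) \<longleftrightarrow> x = x'" using assms(3,4) by (metis fun_upd_triv fun_upd_upd)
  moreover have "F N (x(N := 0)) = F N x" "F N (x'(N := 0)) = F N x'" using assms(3,4) by (simp_all add: fun_upd_idem)
  ultimately show ?thesis
    unfolding G_def using F_Suc_crit[OF apex, of "x(N := s)" "x'(N := s')"] assms(1,2) by (auto simp del: F.simps)
qed

lemma G_coordinate: "x N = 0 \<Longrightarrow> j \<noteq> N \<Longrightarrow> G s x (prod_encode (N, j)) = s * x j"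
  using apex by (simp add: G_def)

definition cylinder_cell :: "nat \<times> nat set \<Rightarrow> (nat \<Rightarrow> real) set" where
  "cylinder_cell l = (\<lambda>(s, x). G s x) `
     ((if fst l = 0 then {0} else if fst l = 1 then {1} else {0<..<1}) \<times> open_simplex (snd l))"

lemma cylinder_cellE:
  assumes "z \<in> cylinder_cell l"
  obtains s x where "z = G s x" "x \<in> open_simplex (snd l)"
    "s \<in> (if fst l = 0 then {0} else if fst l = 1 then {1} else {0<..<1})"
  using assms by (auto simp: cylinder_cell_def)

text \<open>Labels \<open>(0, \<kappa>)\<close>, \<open>(1, \<sigma>)\<close> and \<open>(2, \<sigma>)\<close> stand for the cells of the core, of the complex, and for the
  open prisms of the mapping cylinder.\<close>

definition cylinder_labels :: "(nat \<times> nat set) set" where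
  "cylinder_labels = {0} \<times> Kcrit \<union> {1} \<times> K \<union> {2} \<times> K"

definition cylinder_dim :: "nat \<times> nat set \<Rightarrow> nat" where
  "cylinder_dim l = (if fst l = 2 then card (snd l) else card (snd l) - 1)"

definition faces :: "nat set \<Rightarrow> nat set set" where
  "faces \<sigma> = {\<tau>. \<tau> \<subset> \<sigma> \<and> \<tau> \<noteq> {}}"

text \<open>The bottom of a prism is seen only after the identifications, which is why faces enter
  there through \<open>peel N\<close>. Different faces may give the same label.\<close>

definition cylinder_bd :: "nat \<times> nat set \<Rightarrow> (nat \<times> nat set) set" where
  "cylinder_bd l = (if fst l = 0 then {0} \<times> peel N ` faces (snd l)
     else if fst l = 1 then {1} \<times> faces (snd l)
     else {0} \<times> peel N ` insert (snd l) (faces (snd l)) \<union> {1} \<times> insert (snd l) (faces (snd l)) \<union> {2} \<times> faces (snd l))"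

lemma faces_K: "\<sigma> \<in> K \<Longrightarrow> \<tau> \<in> faces \<sigma> \<Longrightarrow> \<tau> \<in> K \<and> card \<tau> < card \<sigma>"
  using K_sub K_finite by (auto simp: faces_def psubset_card_mono)

lemma peel_crit: "\<sigma> \<in> K \<Longrightarrow> peel N \<sigma> \<in> Kcrit"
  and peel_card: "\<sigma> \<in> K \<Longrightarrow> card (peel N \<sigma>) \<le> card \<sigma>"
  and peel_id: "\<sigma> \<in> Kcrit \<Longrightarrow> peel N \<sigma> = \<sigma>"
  and peel_Max: "\<sigma> \<in> K \<Longrightarrow> \<sigma> \<notin> Kcrit \<Longrightarrow> Max (peel N \<sigma>) < Max \<sigma>"
  and peel_F: "\<sigma> \<in> K \<Longrightarrow> x \<in> open_simplex \<sigma> \<Longrightarrow> \<exists>x'\<in>open_simplex (peel N \<sigma>). F N x = F N x'"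
  using peel_properties[OF _ bounded] by (auto simp: Kcrit_def split: if_splits)

lemma Kcrit_K: "\<sigma> \<in> Kcrit \<Longrightarrow> \<sigma> \<in> K"
  by (simp add: Kcrit_def)

lemma apex_zero: "\<sigma> \<in> K \<Longrightarrow> x \<in> open_simplex \<sigma> \<Longrightarrow> x N = 0"
  using bounded by (auto simp: open_simplex_def)

lemma G_cells:
  assumes "\<sigma> \<in> K" "x \<in> open_simplex \<sigma>"
  shows "G 0 x \<in> cylinder_cell (0, peel N \<sigma>)" "G 1 x \<in> cylinder_cell (1, \<sigma>)"
    "0 < s \<Longrightarrow> s < 1 \<Longrightarrow> G s x \<in> cylinder_cell (2, \<sigma>)"
proof -
  obtain x' where x': "x' \<in> open_simplex (peel N \<sigma>)" "F N x = F N x'" using peel_F[OF assms] by blast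
  have "x' N = 0" using x'(1) apex_zero Kcrit_K[OF peel_crit[OF assms(1)]] by blast
  then have "G 0 x = G 0 x'" using G_eq_iff[of 0 0 x x'] x'(2) apex_zero[OF assms] by simp
  then show "G 0 x \<in> cylinder_cell (0, peel N \<sigma>)" using x'(1) by (auto simp: cylinder_cell_def)
qed (use assms in \<open>auto simp: cylinder_cell_def\<close>)

lemma card_labels: "l \<in> cylinder_labels \<Longrightarrow> snd l \<in> K \<and> 0 < card (snd l)"
  using card_pos Kcrit_K by (auto simp: cylinder_labels_def)

lemma stick_support:
  assumes "\<sigma> \<in> K" "distinct xs" "set xs = \<sigma>" "\<And>i. i < length xs - 1 \<Longrightarrow> 0 \<le> u i \<and> u i \<le> 1"
  shows "\<exists>\<tau>\<in>insert \<sigma> (faces \<sigma>). stick xs u \<in> open_simplex \<tau>"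
proof -
  let ?x = "stick xs u"
  define \<tau> where "\<tau> = {v \<in> \<sigma>. ?x v \<noteq> 0}"
  have ne: "xs \<noteq> []" using K_nonempty assms(1,3) by auto
  have "sum ?x \<tau> = sum ?x \<sigma>"
    unfolding \<tau>_def using K_finite[OF assms(1)] by (intro sum.mono_neutral_left) auto
  then have s: "sum ?x \<tau> = 1" using stick_sum[OF assms(2) ne] assms(3) by metis
  have "?x \<in> open_simplex \<tau>"
    unfolding open_simplex_def
  proof (intro CollectI conjI ballI allI impI s)
    show "0 < ?x v" if "v \<in> \<tau>" for v
      using that stick_nonneg[of xs u v, OF assms(4)] by (simp add: \<tau>_def less_le)
    show "?x v = 0" if "v \<notin> \<tau>" for v using that stick_outside[of v xs u] assms(3) by (auto simp: \<tau>_def)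
  qed
  moreover have "\<tau> \<noteq> {}" using s by auto
  moreover have "\<tau> \<subseteq> \<sigma>" by (auto simp: \<tau>_def)
  ultimately show ?thesis by (intro bexI[of _ \<tau>]) (auto simp: faces_def)
qed

text \<open>\<open>stick xs\<close> reads only the coordinates below \<open>length xs - 1\<close>,
  so the next one is free for the cylinder parameter. The domain is thus the cube of dimension
  \<open>length xs\<close>.\<close>

definition prism :: "nat list \<Rightarrow> (nat \<Rightarrow> real) \<Rightarrow> nat \<Rightarrow> real" where
  "prism xs u = G (u (length xs - 1)) (stick xs u)"

lemma cube_interior:
  assumes "u \<in> cube n - bcube n" "i < n"
  shows "0 < u i \<and> u i < 1"
proof -
  have "0 \<le> u i" "u i \<le> 1" using assms by (simp_all add: cube_eq)
  moreover have "u i \<noteq> 0" "u i \<noteq> 1" using assms by (auto simp: bcube_eq)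
  ultimately show ?thesis by simp
qed

lemma stick_interior:
  assumes "distinct xs" "xs \<noteq> []" "length xs - 1 \<le> n" "u \<in> cube n - bcube n"
  shows "stick xs u \<in> open_simplex (set xs)"
proof -
  have "0 < u i \<and> u i < 1" if "i < length xs - 1" for i
    using cube_interior[OF assms(4), of i] assms(3) that by simp
  then show ?thesis
    using stick_pos[of xs u] stick_outside[of _ xs u] stick_sum[OF assms(1,2)] by (simp add: open_simplex_def)
qed

lemma cube_interior_eqI:
  assumes "u \<in> cube n - bcube n" "u' \<in> cube n - bcube n" "\<And>i. i < n \<Longrightarrow> u i = u' i"
  shows "u = u'"
proof
  fix i show "u i = u' i" using assms by (cases "i < n") (auto simp: cube_eq Rn_def)
qed

lemma stick_bij:
  assumes "distinct xs" "xs \<noteq> []"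
  shows "bij_betw (stick xs) (cube (length xs - 1) - bcube (length xs - 1)) (open_simplex (set xs))"
proof -
  let ?n = "length xs - 1"
  have "inj_on (stick xs) (cube ?n - bcube ?n)"
  proof
    fix u u' assume u: "u \<in> cube ?n - bcube ?n" "u' \<in> cube ?n - bcube ?n" "stick xs u = stick xs u'"
    have "u i < 1" if "i < ?n" for i using cube_interior[OF u(1) that] by simp
    then show "u = u'" using stick_inj[OF assms(1)] u by (intro cube_interior_eqI) auto
  qed
  moreover have "x \<in> stick xs ` (cube ?n - bcube ?n)" if "x \<in> open_simplex (set xs)" for x
  proof -
    obtain u where u: "\<forall>i<?n. 0 < u i \<and> u i < 1" "stick xs u = x" using stick_surj[OF assms \<open>x \<in> _\<close>] by blast
    define u' where "u' i = (if i < ?n then u i else 0)" for i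
    have "stick xs u' = x" unfolding u(2)[symmetric] by (rule stick_cong) (simp add: u'_def)
    moreover have "u' \<in> cube ?n - bcube ?n" using u(1) by (auto simp: u'_def cube_eq bcube_eq Rn_def less_imp_le)
    ultimately show ?thesis by blast
  qed
  ultimately show ?thesis using stick_interior[OF assms order_refl] by (auto simp: bij_betw_def)
qed

lemma open_simplex_nonzero: "x \<in> open_simplex \<tau> \<Longrightarrow> v \<in> \<tau> \<Longrightarrow> x v \<noteq> 0"
  by (auto simp: open_simplex_def)

lemma base_param:
  assumes "\<sigma> \<in> K" "distinct xs" "set xs = \<sigma>" and l: "l = (1, \<sigma>) \<or> l = (0, \<sigma>) \<and> \<sigma> \<in> Kcrit"
  shows "cell_param (cylinder_dim l) (\<lambda>u. G (real (fst l)) (stick xs u)) (cylinder_cell l) (\<Union>(cylinder_cell ` cylinder_bd l))"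
proof -
  let ?n = "length xs - 1" let ?s = "real (fst l)"
  have ne: "xs \<noteq> []" using K_nonempty assms(1,3) by auto
  have n: "cylinder_dim l = ?n" using l assms(2,3) by (auto simp: cylinder_dim_def distinct_card)
  note b = stick_bij[OF assms(2) ne, unfolded assms(3)]
  \<comment> \<open>At height 1 the map \<open>G\<close> loses nothing. At height 0 it is injective
    on the open simplex because this simplex is critical.\<close>
  have inj: "inj_on (G ?s) (open_simplex \<sigma>)"
  proof
    fix x y assume x: "x \<in> open_simplex \<sigma>" and y: "y \<in> open_simplex \<sigma>" and e: "G ?s x = G ?s y"
    have R: "(0 < ?s \<longrightarrow> x = y) \<and> (?s = 0 \<longrightarrow> F N x = F N y)"
      using G_eq_iff[of ?s ?s x y] apex_zero assms(1) x y e by auto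
    show "x = y"
    proof (cases "l = (1, \<sigma>)")
      case False
      then have "\<sigma> \<in> Kcrit" "?s = 0" using l by auto
      then show ?thesis using F_inj_crit[of \<sigma> \<sigma> N x y] bounded[OF assms(1)] x y R by blast
    qed (use R in auto)
  qed
  have cell: "cylinder_cell l = G ?s ` open_simplex \<sigma>" using l by (auto simp: cylinder_cell_def)
  show ?thesis
    unfolding cell_param_def n
  proof (intro conjI)
    show "continuous_on (cube ?n) (\<lambda>u. G ?s (stick xs u))"
      by (intro continuous_G continuous_on_const continuous_stick)
    show "inj_on (\<lambda>u. G ?s (stick xs u)) (cube ?n - bcube ?n)"
      using comp_inj_on[of "stick xs" "cube ?n - bcube ?n" "G ?s"] b inj by (simp add: bij_betw_def comp_def)
    show "(\<lambda>u. G ?s (stick xs u)) ` (cube ?n - bcube ?n) = cylinder_cell l"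
      unfolding cell using b by (metis bij_betw_imp_surj_on image_image)
    show "(\<lambda>u. G ?s (stick xs u)) ` bcube ?n \<subseteq> \<Union>(cylinder_cell ` cylinder_bd l)"
    proof (rule image_subsetI)
      fix u assume u: "u \<in> bcube ?n"
      then obtain i where "i < ?n" "u i = 0 \<or> u i = 1" "u \<in> cube ?n" by (auto simp: bcube_eq)
      then obtain v where v: "v \<in> \<sigma>" "stick xs u v = 0" using stick_boundary[OF assms(2)] assms(3) by blast
      obtain \<tau> where \<tau>: "\<tau> \<in> insert \<sigma> (faces \<sigma>)" "stick xs u \<in> open_simplex \<tau>"
        using stick_support[OF assms(1-3), of u] \<open>u \<in> cube ?n\<close> by (auto simp: cube_eq)
      have "\<tau> \<noteq> \<sigma>" using open_simplex_nonzero[OF \<tau>(2), of v] v by blast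
      then have \<tau>: "\<tau> \<in> faces \<sigma>" "stick xs u \<in> open_simplex \<tau>" using \<tau> by simp_all
      then have "\<tau> \<in> K" using faces_K assms(1) by blast
      show "G ?s (stick xs u) \<in> \<Union>(cylinder_cell ` cylinder_bd l)"
        using l
      proof
        assume l1: "l = (1, \<sigma>)"
        then have "G ?s (stick xs u) \<in> cylinder_cell (1, \<tau>)" using G_cells(2)[OF \<open>\<tau> \<in> K\<close> \<tau>(2)] by simp
        moreover have "(1, \<tau>) \<in> cylinder_bd l" using \<tau>(1) l1 by (simp add: cylinder_bd_def)
        ultimately show ?thesis by blast
      next
        assume l0: "l = (0, \<sigma>) \<and> \<sigma> \<in> Kcrit"
        then have "G ?s (stick xs u) \<in> cylinder_cell (0, peel N \<tau>)" using G_cells(1)[OF \<open>\<tau> \<in> K\<close> \<tau>(2)] by simp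
        moreover have "(0, peel N \<tau>) \<in> cylinder_bd l" using \<tau>(1) l0 by (simp add: cylinder_bd_def)
        ultimately show ?thesis by blast
      qed
    qed
  qed
qed

lemma prism_boundary:
  assumes "\<sigma> \<in> K" "distinct xs" "set xs = \<sigma>" "u \<in> cube (card \<sigma>)"
  obtains \<tau> where "\<tau> \<in> insert \<sigma> (faces \<sigma>)" "\<forall>v\<in>\<tau>. stick xs u v \<noteq> 0"
    "u (length xs - 1) = 0 \<Longrightarrow> prism xs u \<in> cylinder_cell (0, peel N \<tau>)"
    "u (length xs - 1) = 1 \<Longrightarrow> prism xs u \<in> cylinder_cell (1, \<tau>)"
    "u (length xs - 1) \<noteq> 0 \<Longrightarrow> u (length xs - 1) \<noteq> 1 \<Longrightarrow> prism xs u \<in> cylinder_cell (2, \<tau>)"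
proof -
  have len: "length xs = card \<sigma>" "0 < card \<sigma>" using assms(1-3) card_pos by (auto simp: distinct_card)
  have u: "0 \<le> u i \<and> u i \<le> 1" if "i < card \<sigma>" for i using that assms(4) by (simp add: cube_eq)
  have "\<exists>\<tau>\<in>insert \<sigma> (faces \<sigma>). stick xs u \<in> open_simplex \<tau>"
    by (rule stick_support[OF assms(1-3)]) (use u len in simp)
  then obtain \<tau> where \<tau>: "\<tau> \<in> insert \<sigma> (faces \<sigma>)" "stick xs u \<in> open_simplex \<tau>" by blast
  have "\<tau> \<in> K" using \<tau>(1) faces_K assms(1) by blast
  note g = G_cells[OF this \<tau>(2)]
  show ?thesis
  proof (rule that[OF \<tau>(1)])
    show "\<forall>v\<in>\<tau>. stick xs u v \<noteq> 0" using open_simplex_nonzero[OF \<tau>(2)] by blast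
    show "prism xs u \<in> cylinder_cell (2, \<tau>)" if "u (length xs - 1) \<noteq> 0" "u (length xs - 1) \<noteq> 1"
      unfolding prism_def using that u[of "length xs - 1"] len by (intro g(3)) auto
  qed (use g(1,2) in \<open>simp_all add: prism_def\<close>)
qed

lemma prism_param:
  assumes "\<sigma> \<in> K" "distinct xs" "set xs = \<sigma>"
  shows "cell_param (card \<sigma>) (prism xs) (cylinder_cell (2, \<sigma>)) (\<Union>(cylinder_cell ` cylinder_bd (2, \<sigma>)))"
proof -
  let ?n = "card \<sigma>" let ?m = "length xs - 1"
  have len: "length xs = ?n" "0 < ?n" using assms card_pos by (auto simp: distinct_card)
  have ne: "xs \<noteq> []" using len by auto
  have mn: "?m < ?n" "?m \<le> ?n" using len by auto
  have int: "0 < u i \<and> u i < 1" if "u \<in> cube ?n - bcube ?n" "i < ?n" for u i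
    using cube_interior that by blast
  have stick_int: "stick xs u \<in> open_simplex \<sigma>" if "u \<in> cube ?n - bcube ?n" for u
    using stick_interior[OF assms(2) ne mn(2) that] assms(3) by simp
  show ?thesis
    unfolding cell_param_def
  proof (intro conjI)
    show "continuous_on (cube ?n) (prism xs)"
      unfolding prism_def by (intro continuous_G continuous_on_coord continuous_stick)
    show "inj_on (prism xs) (cube ?n - bcube ?n)"
    proof
      fix u u' assume u: "u \<in> cube ?n - bcube ?n" and u': "u' \<in> cube ?n - bcube ?n" and e: "prism xs u = prism xs u'"
      have "0 < u ?m" "0 < u' ?m" using int[OF u mn(1)] int[OF u' mn(1)] by auto
      then have "u ?m = u' ?m" "stick xs u = stick xs u'"
        using e G_eq_iff[of "u ?m" "u' ?m" "stick xs u" "stick xs u'"]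
          apex_zero[OF assms(1) stick_int[OF u]] apex_zero[OF assms(1) stick_int[OF u']] unfolding prism_def by auto
      moreover have "u i = u' i" if "i < ?m" for i
        using stick_inj[OF assms(2) _ \<open>stick xs u = stick xs u'\<close> that] int[OF u] mn by simp
      ultimately have "u i = u' i" if "i < ?n" for i using that len by (cases "i = ?m") auto
      then show "u = u'" using u u' by (intro cube_interior_eqI)
    qed
    show "prism xs ` (cube ?n - bcube ?n) = cylinder_cell (2, \<sigma>)"
    proof (intro equalityI subsetI)
      fix z assume "z \<in> prism xs ` (cube ?n - bcube ?n)"
      then obtain u where u: "u \<in> cube ?n - bcube ?n" "z = prism xs u" by blast
      then show "z \<in> cylinder_cell (2, \<sigma>)"
        using G_cells(3)[OF assms(1) stick_int[OF u(1)]] int[OF u(1) mn(1)] by (simp add: prism_def)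
    next
      fix z assume "z \<in> cylinder_cell (2, \<sigma>)"
      then obtain s x where z: "z = G s x" "0 < s" "s < 1" "x \<in> open_simplex \<sigma>" by (auto simp: cylinder_cell_def)
      obtain u where u: "\<forall>i<?m. 0 < u i \<and> u i < 1" "stick xs u = x"
        using stick_surj[OF assms(2) ne] z(4) assms(3) by blast
      define u' where "u' i = (if i < ?m then u i else if i = ?m then s else 0)" for i
      have "stick xs u' = x" unfolding u(2)[symmetric] by (rule stick_cong) (simp add: u'_def)
      then have pz: "prism xs u' = z" by (simp add: prism_def z(1) u'_def)
      have "0 < u' i \<and> u' i < 1" if "i < ?n" for i using that u(1) z len by (cases "i = ?m") (auto simp: u'_def)
      then have "\<forall>i<?n. 0 < u' i \<and> u' i < 1" by blast
      moreover have "u' \<in> Rn ?n" using len by (auto simp: Rn_def u'_def)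
      ultimately have "u' \<in> cube ?n - bcube ?n" by (auto simp: cube_eq bcube_eq less_imp_le)
      then show "z \<in> prism xs ` (cube ?n - bcube ?n)" using pz by blast
    qed
    show "prism xs ` bcube ?n \<subseteq> \<Union>(cylinder_cell ` cylinder_bd (2, \<sigma>))"
    proof (rule image_subsetI)
      fix u assume u: "u \<in> bcube ?n"
      then have uc: "u \<in> cube ?n" using bcube_sub by blast
      obtain \<tau> where \<tau>: "\<tau> \<in> insert \<sigma> (faces \<sigma>)" "\<forall>v\<in>\<tau>. stick xs u v \<noteq> 0"
        "u ?m = 0 \<Longrightarrow> prism xs u \<in> cylinder_cell (0, peel N \<tau>)"
        "u ?m = 1 \<Longrightarrow> prism xs u \<in> cylinder_cell (1, \<tau>)"
        "u ?m \<noteq> 0 \<Longrightarrow> u ?m \<noteq> 1 \<Longrightarrow> prism xs u \<in> cylinder_cell (2, \<tau>)"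
        by (rule prism_boundary[OF assms uc]) blast
      consider "u ?m = 0" | "u ?m = 1" | "u ?m \<noteq> 0" "u ?m \<noteq> 1" by blast
      then show "prism xs u \<in> \<Union>(cylinder_cell ` cylinder_bd (2, \<sigma>))"
      proof cases
        case 1
        then have "(0, peel N \<tau>) \<in> cylinder_bd (2, \<sigma>)" using \<tau>(1) by (auto simp: cylinder_bd_def)
        then show ?thesis using \<tau>(3)[OF 1] by blast
      next
        case 2
        then have "(1, \<tau>) \<in> cylinder_bd (2, \<sigma>)" using \<tau>(1) by (auto simp: cylinder_bd_def)
        then show ?thesis using \<tau>(4)[OF 2] by blast
      next
        case 3
        \<comment> \<open>The height is neither 0 nor 1, so the coordinate that puts
          \<open>u\<close> on the boundary of the cube is one of those used by
          \<open>stick\<close>.\<close>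
        obtain i where i: "i < ?n" "u i = 0 \<or> u i = 1" using u by (auto simp: bcube_eq)
        then have "i < ?m" using 3 len by (cases "i = ?m") auto
        then obtain v where "v \<in> \<sigma>" "stick xs u v = 0" using stick_boundary[OF assms(2)] i(2) assms(3) by blast
        then have "\<tau> \<in> faces \<sigma>" using \<tau>(1,2) by blast
        then have "(2, \<tau>) \<in> cylinder_bd (2, \<sigma>)" by (auto simp: cylinder_bd_def)
        then show ?thesis using \<tau>(5)[OF 3] by blast
      qed
    qed
  qed
qed

text \<open>Dimensions drop along \<open>cylinder_bd\<close> because peeling never increases the
  number of vertices. Cells are disjoint because a point of the cylinder determines its height, at
  positive height the point of the complex, and at height 0 the point of a critical simplex.\<close>

sublocale cyl: cell_system cylinder_labels cylinder_dim cylinder_cell cylinder_bd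
proof
  show "finite cylinder_labels" using K(2) by (auto simp: cylinder_labels_def Kcrit_def)
  fix l assume l: "l \<in> cylinder_labels"
  then have lK: "snd l \<in> K" "0 < card (snd l)" using card_labels by auto
  have fK: "\<tau> \<in> K \<and> card \<tau> < card (snd l)" if "\<tau> \<in> faces (snd l)" for \<tau> using faces_K[OF lK(1) that] .
  show "cylinder_bd l \<subseteq> cylinder_labels"
    using l lK(1) fK peel_crit by (auto simp: cylinder_bd_def cylinder_labels_def)
  show "cylinder_dim b < cylinder_dim l" if "b \<in> cylinder_bd l" for b
  proof -
    have "card (peel N \<tau>) - 1 < card (snd l) - 1" if "\<tau> \<in> faces (snd l)" for \<tau>
      using peel_card[of \<tau>] fK[OF that] card_pos[of \<tau>] by linarith
    moreover have "card \<tau> - 1 < card (snd l) - 1" if "\<tau> \<in> faces (snd l)" for \<tau>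
      using fK[OF that] card_pos[of \<tau>] by linarith
    moreover have "card (peel N \<tau>) - 1 < card (snd l)" if "\<tau> \<in> insert (snd l) (faces (snd l))" for \<tau>
      using that peel_card[of \<tau>] fK[of \<tau>] lK by auto
    moreover have "card \<tau> - 1 < card (snd l)" if "\<tau> \<in> insert (snd l) (faces (snd l))" for \<tau>
      using that fK[of \<tau>] lK by auto
    ultimately show ?thesis
      using that l fK by (auto simp: cylinder_bd_def cylinder_dim_def cylinder_labels_def split: if_splits)
  qed
  show "\<exists>\<psi>. cell_param (cylinder_dim l) \<psi> (cylinder_cell l) (\<Union>(cylinder_cell ` cylinder_bd l))"
  proof -
    obtain xs where xs: "distinct xs" "set xs = snd l"
      using finite_distinct_list[OF K_finite[OF lK(1)]] by blast
    show ?thesis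
    proof (cases "fst l = 2")
      case True
      then have "l = (2, snd l)" by (simp add: prod_eq_iff)
      then show ?thesis using prism_param[OF lK(1) xs] True by (metis cylinder_dim_def)
    next
      case False
      then have "l = (1, snd l) \<or> l = (0, snd l) \<and> snd l \<in> Kcrit" using l by (auto simp: cylinder_labels_def)
      then show ?thesis using base_param[OF lK(1) xs] by blast
    qed
  qed
  fix m assume m: "m \<in> cylinder_labels" and lm: "l \<noteq> m"
  have mK: "snd m \<in> K" using m card_labels by auto
  show "cylinder_cell l \<inter> cylinder_cell m = {}"
  proof (rule ccontr)
    assume "cylinder_cell l \<inter> cylinder_cell m \<noteq> {}"
    then obtain z where "z \<in> cylinder_cell l" "z \<in> cylinder_cell m" by blast
    obtain s x where sx: "z = G s x" "x \<in> open_simplex (snd l)"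
      "s \<in> (if fst l = 0 then {0} else if fst l = 1 then {1} else {0<..<1})"
      using \<open>z \<in> cylinder_cell l\<close> by (rule cylinder_cellE)
    obtain t y where ty: "z = G t y" "y \<in> open_simplex (snd m)"
      "t \<in> (if fst m = 0 then {0} else if fst m = 1 then {1} else {0<..<1})"
      using \<open>z \<in> cylinder_cell m\<close> by (rule cylinder_cellE)
    have s: "0 \<le> s" "0 \<le> t" using sx(3) ty(3) by (auto split: if_splits)
    then have R: "s = t" "0 < s \<longrightarrow> x = y" "s = 0 \<longrightarrow> F N x = F N y"
      using G_eq_iff[of s t x y] sx(1) ty(1) apex_zero[OF lK(1) sx(2)] apex_zero[OF mK ty(2)] by auto
    have f: "fst l = fst m" using l m sx(3) ty(3) R(1) by (auto simp: cylinder_labels_def)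
    have "x = y"
    proof (cases "s = 0")
      case True
      then have "fst l = 0" using sx(3) by (auto split: if_splits)
      then have "snd l \<in> Kcrit" "snd m \<in> Kcrit" using l m f by (auto simp: cylinder_labels_def)
      then show ?thesis using F_inj_crit[of "snd l" "snd m" N x y] bounded lK(1) mK sx(2) ty(2) R(3) True by blast
    qed (use R s in auto)
    then have "snd l = snd m" using open_simplex_disjoint sx(2) ty(2) by blast
    then show False using f lm by (simp add: prod_eq_iff)
  qed
qed

end

lemma cw_isomorphic_trans:
  assumes "cw_isomorphic X Y" "cw_isomorphic Y Z"
  shows "cw_isomorphic X Z"
proof -
  obtain h where h: "homeomorphic_map (cw_space X) (cw_space Y) h \<and> (\<forall>n. cw_ncells Y n = (\<lambda>e. h ` e) ` cw_ncells X n)"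
    using assms(1)[unfolded cw_isomorphic_def] by (rule exE)
  obtain k where k: "homeomorphic_map (cw_space Y) (cw_space Z) k \<and> (\<forall>n. cw_ncells Z n = (\<lambda>e. k ` e) ` cw_ncells Y n)"
    using assms(2)[unfolded cw_isomorphic_def] by (rule exE)
  show ?thesis
    unfolding cw_isomorphic_def
  proof (rule exI, rule conjI)
    show "homeomorphic_map (cw_space X) (cw_space Z) (k \<circ> h)"
      by (rule homeomorphic_map_compose[OF h[THEN conjunct1] k[THEN conjunct1]])
    show "\<forall>n. cw_ncells Z n = (\<lambda>e. (k \<circ> h) ` e) ` cw_ncells X n"
      by (simp only: h[THEN conjunct2, rule_format] k[THEN conjunct2, rule_format] image_image comp_def) simp
  qed
qed

lemma cw_isomorphic_homotopy_equivalent: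
  assumes "cw_isomorphic X Y"
  shows "cw_space X homotopy_equivalent_space cw_space Y"
  using assms[unfolded cw_isomorphic_def]
  by (elim exE conjE) (rule homeomorphic_imp_homotopy_equivalent_space[OF homeomorphic_map_imp_homeomorphic_space])

section \<open>Free faces of the cylinder and its collapse to the core\<close>

context ordered_complex
begin

lemma enumerate_simplex:
  assumes "\<sigma> \<in> K" obtains xs where "distinct xs" "set xs = \<sigma>" "length xs = card \<sigma>" "xs \<noteq> []"
proof -
  obtain xs where "distinct xs" "set xs = \<sigma>" using finite_distinct_list[OF K_finite[OF assms]] by blast
  then show ?thesis using that distinct_card[of xs] K_nonempty[OF assms] by force
qed

lemma dim_simps [simp]: "cylinder_dim (0, \<sigma>) = card \<sigma> - 1" "cylinder_dim (1, \<sigma>) = card \<sigma> - 1"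
  "cylinder_dim (Suc 0, \<sigma>) = card \<sigma> - 1" "cylinder_dim (2, \<sigma>) = card \<sigma>"
  by (auto simp: cylinder_dim_def)

lemma mem_bd_prism:
  "(0, \<tau>) \<in> cylinder_bd (2, \<sigma>) \<longleftrightarrow> \<tau> \<in> peel N ` insert \<sigma> (faces \<sigma>)"
  "(1, \<tau>) \<in> cylinder_bd (2, \<sigma>) \<longleftrightarrow> \<tau> \<in> insert \<sigma> (faces \<sigma>)"
  "(2, \<tau>) \<in> cylinder_bd (2, \<sigma>) \<longleftrightarrow> \<tau> \<in> faces \<sigma>"
  by (auto simp: cylinder_bd_def)

text \<open>A prism can always be pushed in from its top. From the bottom this works if no other
  part of the boundary of the prism is mapped to the bottom cell: a critical \<open>\<sigma>\<close>
  labels its own cell, while proper faces peel to labels with fewer vertices.\<close>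

lemma free_pair_end:
  assumes "\<sigma> \<in> K" and c: "c = 1 \<or> c = 0 \<and> \<sigma> \<in> Kcrit"
  shows "cyl.free_pair (c, \<sigma>) (2, \<sigma>)"
proof -
  obtain xs where xs: "distinct xs" "set xs = \<sigma>" "length xs = card \<sigma>" "xs \<noteq> []" using enumerate_simplex[OF assms(1)] .
  \<comment> \<open>The cylinder coordinate, which is the last one of the cube.\<close>
  let ?j = "card \<sigma> - 1"
  have pos: "0 < card \<sigma>" by (rule card_pos[OF assms(1)])
  show ?thesis
    unfolding cyl.free_pair_def
  proof (intro exI conjI)
    show d: "cylinder_dim (2, \<sigma>) = Suc (cylinder_dim (c, \<sigma>))" "?j < Suc (cylinder_dim (c, \<sigma>))"
      using c pos by auto
    show "real c = 0 \<or> real c = 1" using c by auto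
    show "cell_param (cylinder_dim (2, \<sigma>)) (prism xs) (cylinder_cell (2, \<sigma>)) (\<Union>(cylinder_cell ` cylinder_bd (2, \<sigma>)))"
      using prism_param[OF assms(1) xs(1,2)] by simp
    have "prism xs (cube_face_map ?j (real c) u) = G (real c) (stick xs u)" for u
    proof -
      have "stick xs (cube_face_map ?j (real c) u) = stick xs u"
        by (rule stick_cong) (simp add: cube_face_map_def xs(3))
      moreover have "cube_face_map ?j (real c) u ?j = real c" by (simp add: cube_face_map_def)
      ultimately show ?thesis by (simp add: prism_def xs(3))
    qed
    then have "prism xs \<circ> cube_face_map ?j (real c) = (\<lambda>u. G (real (fst (c, \<sigma>))) (stick xs u))" by auto
    then show "cell_param (cylinder_dim (c, \<sigma>)) (prism xs \<circ> cube_face_map ?j (real c)) (cylinder_cell (c, \<sigma>))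
        (\<Union>(cylinder_cell ` cylinder_bd (c, \<sigma>)))"
      using base_param[OF assms(1) xs(1,2), of "(c, \<sigma>)"] c by auto
    show "prism xs ` cube_rest (cylinder_dim (2, \<sigma>)) ?j (real c) \<subseteq> \<Union>(cylinder_cell ` (cylinder_bd (2, \<sigma>) - {(c, \<sigma>)}))"
    proof (rule image_subsetI)
      fix u assume "u \<in> cube_rest (cylinder_dim (2, \<sigma>)) ?j (real c)"
      then have u: "u \<in> cube (card \<sigma>)" "u ?j = 1 - real c \<or> (\<exists>i<card \<sigma>. i \<noteq> ?j \<and> (u i = 0 \<or> u i = 1))"
        by (auto simp: cube_rest_def)
      obtain \<tau> where \<tau>: "\<tau> \<in> insert \<sigma> (faces \<sigma>)" "\<forall>v\<in>\<tau>. stick xs u v \<noteq> 0"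
        "u (length xs - 1) = 0 \<Longrightarrow> prism xs u \<in> cylinder_cell (0, peel N \<tau>)"
        "u (length xs - 1) = 1 \<Longrightarrow> prism xs u \<in> cylinder_cell (1, \<tau>)"
        "u (length xs - 1) \<noteq> 0 \<Longrightarrow> u (length xs - 1) \<noteq> 1 \<Longrightarrow> prism xs u \<in> cylinder_cell (2, \<tau>)"
        by (rule prism_boundary[OF assms(1) xs(1,2) u(1)]) blast
      have face: "\<tau> \<in> faces \<sigma>" if "u ?j \<noteq> 1 - real c"
      proof -
        obtain i where i: "i < card \<sigma>" "i \<noteq> ?j" "u i = 0 \<or> u i = 1" using u(2) \<open>u ?j \<noteq> _\<close> by blast
        then have "i < length xs - 1" using xs(3) by simp
        then obtain v where "v \<in> \<sigma>" "stick xs u v = 0" using stick_boundary[OF xs(1)] i(3) xs(2) by blast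
        then show ?thesis using \<tau>(1,2) by blast
      qed
      have "\<exists>b\<in>cylinder_bd (2, \<sigma>) - {(c, \<sigma>)}. prism xs u \<in> cylinder_cell b"
      proof -
        consider "u ?j = 0" | "u ?j = 1" | "u ?j \<noteq> 0" "u ?j \<noteq> 1" by blast
        then show ?thesis
        proof cases
          case 1
          have "peel N \<tau> \<noteq> \<sigma>" if "c = 0"
          proof -
            have "\<tau> \<in> faces \<sigma>" using face 1 that by simp
            then show ?thesis using faces_K[OF assms(1)] peel_card[of \<tau>] by fastforce
          qed
          then show ?thesis using \<tau>(1,3) 1 xs(3) by (intro bexI[of _ "(0, peel N \<tau>)"]) (auto simp: mem_bd_prism)
        next
          case 2
          have "\<tau> \<noteq> \<sigma>" if "c = 1" using face 2 that by (auto simp: faces_def)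
          then show ?thesis using \<tau>(1,4) 2 xs(3) by (intro bexI[of _ "(1, \<tau>)"]) (auto simp only: mem_bd_prism)
        next
          case 3
          then have "u ?j \<noteq> 1 - real c" using c by auto
          then show ?thesis using \<tau>(5) face 3 xs(3) c by (intro bexI[of _ "(2, \<tau>)"]) (auto simp: mem_bd_prism)
        qed
      qed
      then show "prism xs u \<in> \<Union>(cylinder_cell ` (cylinder_bd (2, \<sigma>) - {(c, \<sigma>)}))" by blast
    qed
  qed
qed

text \<open>The prism over \<open>\<sigma>\<close> is the side of the larger prism opposite to
  \<open>a\<close>. With \<open>a\<close> at the head of the list it becomes the face of the cube
  where the coordinate of \<open>a\<close> is 0, and there the larger prism restricts to
  \<open>prism xs\<close>.\<close>

lemma free_pair_side:
  assumes "insert a \<sigma> \<in> K" "a \<notin> \<sigma>" "\<sigma> \<noteq> {}"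
  shows "cyl.free_pair (2, \<sigma>) (2, insert a \<sigma>)"
proof -
  let ?\<sigma>' = "insert a \<sigma>"
  have \<sigma>: "\<sigma> \<in> K" using K_sub[OF assms(1)] assms(3) by blast
  obtain xs where xs: "distinct xs" "set xs = \<sigma>" "length xs = card \<sigma>" "xs \<noteq> []" using enumerate_simplex[OF \<sigma>] .
  \<comment> \<open>Coordinate \<open>?j\<close> holds the mass of \<open>a\<close>; the cylinder
    coordinate of the larger prism is the next one.\<close>
  let ?ys = "a # xs" let ?j = "card \<sigma> - 1"
  have ys: "distinct ?ys" "set ?ys = ?\<sigma>'" using xs assms(2) by auto
  have card: "card ?\<sigma>' = Suc (card \<sigma>)" using assms(2) K_finite[OF \<sigma>] by simp
  have pos: "0 < card \<sigma>" by (rule card_pos[OF \<sigma>])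
  show ?thesis
    unfolding cyl.free_pair_def
  proof (intro exI conjI)
    show "cylinder_dim (2, ?\<sigma>') = Suc (cylinder_dim (2, \<sigma>))" "?j < Suc (cylinder_dim (2, \<sigma>))" using card by auto
    show "(0::real) = 0 \<or> (0::real) = 1" by simp
    show "cell_param (cylinder_dim (2, ?\<sigma>')) (prism ?ys) (cylinder_cell (2, ?\<sigma>')) (\<Union>(cylinder_cell ` cylinder_bd (2, ?\<sigma>')))"
      using prism_param[OF assms(1) ys] by simp
    have "prism ?ys (cube_face_map ?j 0 u) = prism xs u" for u
    proof -
      let ?f = "cube_face_map ?j 0 u"
      have "stick xs ?f = stick xs u"
        by (rule stick_cong) (simp add: cube_face_map_def xs(3))
      moreover have "?f ?j = 0" "?f (card \<sigma>) = u ?j" using pos by (auto simp: cube_face_map_def)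
      moreover have "stick xs u a = 0" using assms(2) xs(2) by (simp add: stick_outside)
      ultimately have "stick ?ys ?f = stick xs u"
        unfolding fun_eq_iff stick_Cons[OF xs(4)] xs(3) by simp
      then show ?thesis using \<open>?f (card \<sigma>) = u ?j\<close> by (simp add: prism_def xs(3))
    qed
    then have "prism ?ys \<circ> cube_face_map ?j 0 = prism xs" by auto
    then show "cell_param (cylinder_dim (2, \<sigma>)) (prism ?ys \<circ> cube_face_map ?j 0) (cylinder_cell (2, \<sigma>))
        (\<Union>(cylinder_cell ` cylinder_bd (2, \<sigma>)))"
      using prism_param[OF \<sigma> xs(1,2)] by simp
    show "prism ?ys ` cube_rest (cylinder_dim (2, ?\<sigma>')) ?j 0 \<subseteq> \<Union>(cylinder_cell ` (cylinder_bd (2, ?\<sigma>') - {(2, \<sigma>)}))"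
    proof (rule image_subsetI)
      fix u assume "u \<in> cube_rest (cylinder_dim (2, ?\<sigma>')) ?j 0"
      then have u: "u \<in> cube (card ?\<sigma>')" "u ?j = 1 \<or> (\<exists>i<Suc (card \<sigma>). i \<noteq> ?j \<and> (u i = 0 \<or> u i = 1))"
        using card by (auto simp: cube_rest_def)
      obtain \<tau> where \<tau>: "\<tau> \<in> insert ?\<sigma>' (faces ?\<sigma>')" "\<forall>v\<in>\<tau>. stick ?ys u v \<noteq> 0"
        "u (length ?ys - 1) = 0 \<Longrightarrow> prism ?ys u \<in> cylinder_cell (0, peel N \<tau>)"
        "u (length ?ys - 1) = 1 \<Longrightarrow> prism ?ys u \<in> cylinder_cell (1, \<tau>)"
        "u (length ?ys - 1) \<noteq> 0 \<Longrightarrow> u (length ?ys - 1) \<noteq> 1 \<Longrightarrow> prism ?ys u \<in> cylinder_cell (2, \<tau>)"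
        by (rule prism_boundary[OF assms(1) ys u(1)]) blast
      have m: "length ?ys - 1 = card \<sigma>" using xs(3) by simp
      consider "u (card \<sigma>) = 0" | "u (card \<sigma>) = 1" | "u (card \<sigma>) \<noteq> 0" "u (card \<sigma>) \<noteq> 1" by blast
      then have "\<exists>b\<in>cylinder_bd (2, ?\<sigma>') - {(2, \<sigma>)}. prism ?ys u \<in> cylinder_cell b"
      proof cases
        case 1
        then show ?thesis using \<tau>(1,3) m by (intro bexI[of _ "(0, peel N \<tau>)"]) (auto simp: mem_bd_prism)
      next
        case 2
        then show ?thesis using \<tau>(1,4) m by (intro bexI[of _ "(1, \<tau>)"]) (auto simp: mem_bd_prism(2)[unfolded One_nat_def])
      next
        case 3
        have "u (length xs - 1) = 1 \<or> (\<exists>v\<in>set xs. stick xs u v = 0)"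
        proof (cases "u ?j = 1")
          case False
          then obtain i where i: "i < Suc (card \<sigma>)" "i \<noteq> ?j" "u i = 0 \<or> u i = 1" using u(2) by blast
          then have "i \<noteq> card \<sigma>" using 3 by auto
          then have "i < length xs - 1" using i xs(3) by simp
          then show ?thesis using stick_boundary[OF xs(1)] i(3) by blast
        qed (simp add: xs(3))
        then obtain v where v: "v \<in> \<sigma>" "stick ?ys u v = 0"
          using stick_boundary_Cons[of a xs u] assms(2) xs(2,4) by blast
        then have "v \<notin> \<tau>" using \<tau>(2) by blast
        then have "\<tau> \<in> faces ?\<sigma>'" "\<tau> \<noteq> \<sigma>" using \<tau>(1) v(1) by auto
        then show ?thesis using \<tau>(5) 3 m by (intro bexI[of _ "(2, \<tau>)"]) (auto simp: mem_bd_prism)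
      qed
      then show "prism ?ys u \<in> \<Union>(cylinder_cell ` (cylinder_bd (2, ?\<sigma>') - {(2, \<sigma>)}))" by blast
    qed
  qed
qed

lemma down_core: "cyl.down ({0} \<times> Kcrit)"
  unfolding cyl.down_def
  using faces_K peel_crit Kcrit_K by (auto simp: cylinder_labels_def cylinder_bd_def)

lemma down_base: "cyl.down ({1} \<times> K)"
  unfolding cyl.down_def
  using faces_K by (auto simp: cylinder_labels_def cylinder_bd_def)

lemma down_all: "cyl.down cylinder_labels"
  unfolding cyl.down_def using cyl.bd_sub by blast

text \<open>Apart from its own top, the boundary of a prism consists of its bottom, which belongs to
  the core and stays, and of cells over proper faces. Hence the number of vertices serves as a
  rank.\<close>

lemma collapse_to_core:
  "collapses_to (cyl.sub cylinder_labels) (cyl.sub ({0} \<times> Kcrit))"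
  "cw_space (cyl.sub cylinder_labels) homotopy_equivalent_space cw_space (cyl.sub ({0} \<times> Kcrit))"
proof -
  let ?Q = "{1::nat} \<times> K" and ?\<pi> = "\<lambda>l :: nat \<times> nat set. (2 :: nat, snd l)" and ?\<rho> = "\<lambda>l :: nat \<times> nat set. card (snd l)"
  have im: "?\<pi> ` ?Q = {2} \<times> K" by force
  have all: "{0} \<times> Kcrit \<union> ?Q \<union> ?\<pi> ` ?Q = cylinder_labels" unfolding im by (auto simp: cylinder_labels_def)
  have rank: "cylinder_bd g \<union> cylinder_bd (?\<pi> g) \<subseteq>
      {0} \<times> Kcrit \<union> {g} \<union> {f \<in> ?Q. ?\<rho> f < ?\<rho> g} \<union> ?\<pi> ` {f \<in> ?Q. ?\<rho> f < ?\<rho> g}" if g: "g \<in> ?Q" for g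
  proof -
    obtain \<sigma> where \<sigma>: "g = (1, \<sigma>)" "\<sigma> \<in> K" using g by auto
    have a: "(1, \<tau>) \<in> {f \<in> ?Q. ?\<rho> f < ?\<rho> g}" "(2, \<tau>) \<in> ?\<pi> ` {f \<in> ?Q. ?\<rho> f < ?\<rho> g}" if "\<tau> \<in> faces \<sigma>" for \<tau>
    proof -
      show 1: "(1, \<tau>) \<in> {f \<in> ?Q. ?\<rho> f < ?\<rho> g}" using faces_K[OF \<sigma>(2) that] \<sigma> by simp
      show "(2, \<tau>) \<in> ?\<pi> ` {f \<in> ?Q. ?\<rho> f < ?\<rho> g}" using imageI[OF 1, of ?\<pi>] by simp
    qed
    have b: "peel N \<tau> \<in> Kcrit" if "\<tau> \<in> insert \<sigma> (faces \<sigma>)" for \<tau> using that faces_K[OF \<sigma>(2)] peel_crit \<sigma>(2) by blast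
    have bd: "cylinder_bd g = {1} \<times> faces \<sigma>"
      "cylinder_bd (?\<pi> g) = {0} \<times> peel N ` insert \<sigma> (faces \<sigma>) \<union> {1} \<times> insert \<sigma> (faces \<sigma>) \<union> {2} \<times> faces \<sigma>"
      using \<sigma> by (auto simp: cylinder_bd_def)
    define R where "R = {f \<in> ?Q. ?\<rho> f < ?\<rho> g}"
    have "{1} \<times> faces \<sigma> \<subseteq> R" "{2} \<times> faces \<sigma> \<subseteq> ?\<pi> ` R" unfolding R_def using a by blast+
    moreover have "{0} \<times> peel N ` insert \<sigma> (faces \<sigma>) \<subseteq> {0} \<times> Kcrit" using b by blast
    moreover have "{1} \<times> insert \<sigma> (faces \<sigma>) = insert g ({1} \<times> faces \<sigma>)" using \<sigma>(1) by blast
    ultimately have "cylinder_bd g \<union> cylinder_bd (?\<pi> g) \<subseteq> {0} \<times> Kcrit \<union> {g} \<union> R \<union> ?\<pi> ` R"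
      using bd b by auto
    then show ?thesis unfolding R_def .
  qed
  have free: "cyl.free_pair f (?\<pi> f)" if "f \<in> ?Q" for f using that free_pair_end[of _ 1] by auto
  note * = cyl.acyclic_matching_collapse[of "{0} \<times> Kcrit" ?Q ?\<pi> ?\<rho>, unfolded all]
  have s: "finite ?Q" "?Q \<subseteq> cylinder_labels" "?\<pi> ` ?Q \<subseteq> cylinder_labels" "?Q \<inter> {0} \<times> Kcrit = {}"
    "?\<pi> ` ?Q \<inter> {0} \<times> Kcrit = {}" "?Q \<inter> ?\<pi> ` ?Q = {}" "inj_on ?\<pi> ?Q"
    unfolding im using K(2) by (auto simp: cylinder_labels_def inj_on_def)
  show "collapses_to (cyl.sub cylinder_labels) (cyl.sub ({0} \<times> Kcrit))"
    by (rule *(2)[OF down_core s free rank])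
  show "cw_space (cyl.sub cylinder_labels) homotopy_equivalent_space cw_space (cyl.sub ({0} \<times> Kcrit))"
    by (rule *(3)[OF down_core s free rank])
qed

section \<open>The collapse of the cylinder to the complex\<close>

text \<open>In the matching of the mapping cylinder relative to the complex, the prism over \<open>\<tau>\<close> belongs to the pair
  of \<open>partner_face \<tau>\<close>.\<close>

definition side :: "nat set set" where
  "side = {\<sigma> \<in> K - Kcrit. \<alpha> (Max \<sigma>) \<notin> \<sigma>}"

definition partner_face :: "nat set \<Rightarrow> nat \<times> nat set" where
  "partner_face \<tau> = (if \<tau> \<in> Kcrit then (0, \<tau>) else (2, \<tau> - {\<alpha> (Max \<tau>)}))"

definition partner :: "nat \<times> nat set \<Rightarrow> nat \<times> nat set" where
  "partner l = (2, if fst l = 0 then snd l else insert (\<alpha> (Max (snd l))) (snd l))"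

text \<open>The lexicographic order by top vertex and number of vertices, coded in one number
  because simplices have at most \<open>N\<close> vertices. The top vertex counts first, since
  peeling a noncritical simplex lowers it strictly but need not lower the number of
  vertices.\<close>

definition cell_rank :: "nat \<times> nat set \<Rightarrow> nat" where
  "cell_rank l = Max (snd l) * Suc N + card (snd l)"

lemma rank_less:
  assumes "\<tau> \<in> K" "Max \<tau> < Max \<sigma> \<or> Max \<tau> \<le> Max \<sigma> \<and> card \<tau> < card \<sigma>"
  shows "cell_rank (k, \<tau>) < cell_rank (m, \<sigma>)"
proof -
  have "card \<tau> \<le> N" using card_mono[OF _ bounded[OF assms(1)]] by simp
  show ?thesis
  proof (cases "Max \<tau> < Max \<sigma>")
    case True
    then have "Suc (Max \<tau>) * Suc N \<le> Max \<sigma> * Suc N" by (intro mult_le_mono1) simp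
    then show ?thesis using \<open>card \<tau> \<le> N\<close> by (simp add: cell_rank_def)
  next
    case False
    then have "Max \<tau> * Suc N \<le> Max \<sigma> * Suc N" "card \<tau> < card \<sigma>" using assms(2) by (auto intro!: mult_le_mono1)
    then show ?thesis by (simp add: cell_rank_def)
  qed
qed

lemma Max_face: "\<sigma> \<in> K \<Longrightarrow> \<tau> \<in> faces \<sigma> \<Longrightarrow> Max \<tau> \<le> Max \<sigma>"
  using K_finite by (auto simp: faces_def intro: Max_mono)

text \<open>Adding or removing \<open>\<alpha> (Max \<tau>)\<close> leaves the top vertex alone,
  hence also the vertex to be added or removed. It is thus an involution of the noncritical
  simplices, and its orbits are the members of \<open>side\<close> with their partners.\<close>

lemma noncrit_Max:
  assumes "\<tau> \<in> K" "\<tau> \<notin> Kcrit"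
  shows "Max \<tau> \<in> \<tau>" "\<alpha> (Max \<tau>) < Max \<tau>" "insert (\<alpha> (Max \<tau>)) \<tau> \<in> K"
    "Max (insert (\<alpha> (Max \<tau>)) \<tau>) = Max \<tau>" "Max (\<tau> - {\<alpha> (Max \<tau>)}) = Max \<tau>"
    "\<tau> - {\<alpha> (Max \<tau>)} \<in> K" "\<tau> - {\<alpha> (Max \<tau>)} \<notin> Kcrit" "insert (\<alpha> (Max \<tau>)) \<tau> \<notin> Kcrit"
proof -
  note fin = K_finite[OF assms(1)] K_nonempty[OF assms(1)]
  show m: "Max \<tau> \<in> \<tau>" using fin by simp
  have nc: "Max \<tau> \<notin> crit" using assms by (simp add: Kcrit_def)
  show lt: "\<alpha> (Max \<tau>) < Max \<tau>" by (rule \<alpha>_less[OF nc])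
  show "insert (\<alpha> (Max \<tau>)) \<tau> \<in> K" using fin m nc by (intro dominated[OF assms(1), of "Max \<tau>"]) auto
  show i: "Max (insert (\<alpha> (Max \<tau>)) \<tau>) = Max \<tau>" using fin lt by (simp add: max_def)
  show d: "Max (\<tau> - {\<alpha> (Max \<tau>)}) = Max \<tau>" using fin lt m by (intro Max_eqI) auto
  show "\<tau> - {\<alpha> (Max \<tau>)} \<in> K" using lt m by (intro K_sub[OF assms(1)]) auto
  show "\<tau> - {\<alpha> (Max \<tau>)} \<notin> Kcrit" "insert (\<alpha> (Max \<tau>)) \<tau> \<notin> Kcrit" using i d nc by (auto simp: Kcrit_def)
qed

lemma partner_face:
  assumes "\<tau> \<in> K"
  shows "partner_face \<tau> \<in> {0} \<times> Kcrit \<union> {2} \<times> side"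
    "(2, \<tau>) = partner_face \<tau> \<or> (2, \<tau>) = partner (partner_face \<tau>)"
    "Max (snd (partner_face \<tau>)) = Max \<tau>" "card (snd (partner_face \<tau>)) \<le> card \<tau>" "snd (partner_face \<tau>) \<in> K"
proof -
  have "(2, \<tau>) = partner_face \<tau> \<or> (2, \<tau>) = partner (partner_face \<tau>)" if "\<tau> \<notin> Kcrit"
  proof (cases "\<alpha> (Max \<tau>) \<in> \<tau>")
    case True
    then show ?thesis using that noncrit_Max(5)[OF assms that] by (simp add: partner_face_def partner_def insert_absorb)
  qed (simp add: partner_face_def that)
  then show "(2, \<tau>) = partner_face \<tau> \<or> (2, \<tau>) = partner (partner_face \<tau>)"
    by (cases "\<tau> \<in> Kcrit") (simp_all add: partner_face_def partner_def)
  show "partner_face \<tau> \<in> {0} \<times> Kcrit \<union> {2} \<times> side" "Max (snd (partner_face \<tau>)) = Max \<tau>" "snd (partner_face \<tau>) \<in> K"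
    using noncrit_Max[OF assms] assms by (auto simp: partner_face_def side_def)
  show "card (snd (partner_face \<tau>)) \<le> card \<tau>"
    using K_finite[OF assms] by (auto simp: partner_face_def intro: card_mono)
qed

text \<open>A critical simplex is its own label, so the third premise has to supply the smaller
  rank. Any other simplex is peeled to a label with a lower top vertex, and this decides the
  rank.\<close>

lemma rank_peel_less:
  assumes "\<tau> \<in> K" "Max \<tau> \<le> Max \<sigma>" "\<tau> \<in> Kcrit \<Longrightarrow> Max \<tau> < Max \<sigma> \<or> card \<tau> < card \<sigma>"
  shows "(0, peel N \<tau>) \<in> {0} \<times> Kcrit \<and> cell_rank (0, peel N \<tau>) < cell_rank (k, \<sigma>)"
proof (cases "\<tau> \<in> Kcrit")
  case True
  then show ?thesis using peel_id[OF True] assms rank_less[OF assms(1)] by auto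
next
  case False
  then have "Max (peel N \<tau>) < Max \<sigma>" using peel_Max[OF assms(1) False] assms(2) by simp
  then show ?thesis using peel_crit[OF assms(1)] rank_less[of "peel N \<tau>"] Kcrit_K by blast
qed

text \<open>The prism over \<open>\<tau>\<close> may be the larger cell of its pair, so the rank to
  be compared is that of \<open>partner_face \<tau>\<close>. Let \<open>a\<close> be
  \<open>\<alpha> (Max \<sigma>)\<close>, for a noncritical \<open>\<sigma>\<close>. The delicate
  faces \<open>\<tau>\<close> of \<open>insert a \<sigma>\<close> are those with the top vertex of
  \<open>\<sigma>\<close>: their pair is that of \<open>\<tau> - {a}\<close>, a proper face of
  \<open>\<sigma>\<close> unless \<open>\<tau>\<close> is \<open>\<sigma>\<close> itself.\<close>

lemma matching_rank:
  assumes g: "g \<in> {0} \<times> Kcrit \<union> {2} \<times> side"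
  defines "R \<equiv> {f \<in> {0} \<times> Kcrit \<union> {2} \<times> side. cell_rank f < cell_rank g}"
  shows "cylinder_bd g \<union> cylinder_bd (partner g) \<subseteq> {1} \<times> K \<union> {g} \<union> R \<union> partner ` R"
proof -
  let ?U = "{1} \<times> K \<union> {g} \<union> R \<union> partner ` R"
  obtain k \<sigma> where k: "g = (k, \<sigma>)" by fastforce
  have \<sigma>: "\<sigma> \<in> K" "k = 0 \<longleftrightarrow> \<sigma> \<in> Kcrit" using g Kcrit_K unfolding k by (auto simp: side_def)
  have peel: "(0, peel N \<tau>) \<in> R"
    if "\<tau> \<in> K" "Max \<tau> \<le> Max \<sigma>" "\<tau> \<in> Kcrit \<Longrightarrow> Max \<tau> < Max \<sigma> \<or> card \<tau> < card \<sigma>" for \<tau>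
    using rank_peel_less[OF that, of k] unfolding R_def k by blast
  have pris: "(2, \<tau>) \<in> R \<union> partner ` R" if "cell_rank (partner_face \<tau>) < cell_rank g" "\<tau> \<in> K" for \<tau>
  proof -
    have "partner_face \<tau> \<in> R" using that partner_face(1) by (simp add: R_def)
    then show ?thesis using partner_face(2)[OF that(2)] by (metis UnI1 UnI2 imageI)
  qed
  have prism1: "(2, \<tau>) \<in> R \<union> partner ` R" if "\<tau> \<in> K" "Max \<tau> \<le> Max \<sigma>" "Max \<tau> < Max \<sigma> \<or> card \<tau> < card \<sigma>" for \<tau>
  proof (rule pris[OF _ that(1)])
    show "cell_rank (partner_face \<tau>) < cell_rank g"
      using rank_less[OF partner_face(5)[OF that(1)], of \<sigma> "fst (partner_face \<tau>)" k] partner_face(3,4)[OF that(1)] that(2,3) k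
      by auto
  qed
  have face: "\<tau> \<in> K" "Max \<tau> \<le> Max \<sigma>" "card \<tau> < card \<sigma>" if "\<tau> \<in> faces \<sigma>" for \<tau>
    using faces_K[OF \<sigma>(1) that] Max_face[OF \<sigma>(1) that] by auto
  have "b \<in> ?U" if b: "b \<in> cylinder_bd g \<union> cylinder_bd (partner g)" for b
  proof (cases "k = 0")
    case True
    then have c: "\<sigma> \<in> Kcrit" and p: "partner g = (2, \<sigma>)" using \<sigma> by (auto simp: partner_def k)
    have "b \<in> {0} \<times> peel N ` insert \<sigma> (faces \<sigma>) \<union> {1} \<times> insert \<sigma> (faces \<sigma>) \<union> {2} \<times> faces \<sigma>"
      using b[unfolded p, unfolded k True] by (auto simp: cylinder_bd_def)
    then consider \<tau> where "b = (0, peel N \<tau>)" "\<tau> \<in> faces \<sigma>" | "b = g" | \<tau> where "b = (1, \<tau>)" "\<tau> \<in> K"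
      | \<tau> where "b = (2, \<tau>)" "\<tau> \<in> faces \<sigma>"
      using peel_id[OF c] face(1) \<sigma>(1) k True by blast
    then show ?thesis
    proof cases
      case (1 \<tau>) then show ?thesis using peel[of \<tau>] face[of \<tau>] by blast
    next
      case (4 \<tau>) then show ?thesis using prism1[of \<tau>] face[of \<tau>] by blast
    qed blast+
  next
    case False
    let ?a = "\<alpha> (Max \<sigma>)"
    let ?\<sigma>' = "insert ?a \<sigma>"
    have k2: "k = 2" and s: "\<sigma> \<in> side" and nc: "\<sigma> \<notin> Kcrit" using g False \<sigma>(2) unfolding k by auto
    have p: "partner g = (2, ?\<sigma>')" by (simp add: partner_def k k2)
    note m = noncrit_Max[OF \<sigma>(1) nc]
    have an: "?a \<notin> \<sigma>" using s by (simp add: side_def)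
    have "b \<in> {0} \<times> peel N ` insert ?\<sigma>' (faces ?\<sigma>') \<union> {1} \<times> insert ?\<sigma>' (faces ?\<sigma>') \<union> {2} \<times> faces ?\<sigma>'"
    proof -
      have "insert \<sigma> (faces \<sigma>) \<subseteq> faces ?\<sigma>'" using an K_nonempty[OF \<sigma>(1)] by (auto simp: faces_def)
      moreover have "b \<in> cylinder_bd (2, \<sigma>) \<or> b \<in> cylinder_bd (2, ?\<sigma>')" using b[unfolded p, unfolded k k2] by blast
      ultimately show ?thesis by (auto simp: cylinder_bd_def)
    qed
    moreover have fK: "\<tau> \<in> K" if "\<tau> \<in> insert ?\<sigma>' (faces ?\<sigma>')" for \<tau> using that m(3) faces_K[OF m(3)] by blast
    ultimately consider \<tau> where "b = (0, peel N \<tau>)" "\<tau> \<in> insert ?\<sigma>' (faces ?\<sigma>')" | \<tau> where "b = (1, \<tau>)" "\<tau> \<in> K"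
      | \<tau> where "b = (2, \<tau>)" "\<tau> \<in> faces ?\<sigma>'" by blast
    then show ?thesis
    proof cases
      case (1 \<tau>)
      have le: "Max \<tau> \<le> Max \<sigma>" using 1(2) Max_face[OF m(3)] m(4) by auto
      \<comment> \<open>A critical face cannot have the top vertex of \<open>\<sigma>\<close>, which
        is noncritical.\<close>
      have "Max \<tau> < Max \<sigma>" if "\<tau> \<in> Kcrit"
      proof -
        have "Max \<tau> \<noteq> Max \<sigma>" using that nc \<sigma>(1) by (auto simp: Kcrit_def)
        then show ?thesis using le by simp
      qed
      then show ?thesis using peel[OF fK[OF 1(2)] le] 1(1) by blast
    next
      case (2 \<tau>) then show ?thesis by blast
    next
      case (3 \<tau>)
      have \<tau>K: "\<tau> \<in> K" using fK 3(2) by blast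
      have le: "Max \<tau> \<le> Max \<sigma>" using Max_face[OF m(3) 3(2)] m(4) by simp
      show ?thesis
      proof (cases "Max \<tau> < Max \<sigma> \<or> \<tau> = \<sigma>")
        case True
        then show ?thesis using prism1[OF \<tau>K le] 3(1) k k2 by blast
      next
        case False
        then have eq: "Max \<tau> = Max \<sigma>" and ne: "\<tau> \<noteq> \<sigma>" using le by auto
        have "\<tau> \<notin> Kcrit" using eq nc \<sigma>(1) \<tau>K by (simp add: Kcrit_def)
        then have pf: "partner_face \<tau> = (2, \<tau> - {?a})" by (simp add: partner_face_def eq)
        have "\<tau> - {?a} \<subset> \<sigma>" using 3(2) ne an by (auto simp: faces_def)
        then have "card (\<tau> - {?a}) < card \<sigma>" using K_finite[OF \<sigma>(1)] by (rule psubset_card_mono[rotated])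
        moreover have "Max (\<tau> - {?a}) = Max \<sigma>" "\<tau> - {?a} \<in> K" using noncrit_Max(5,6)[OF \<tau>K \<open>\<tau> \<notin> Kcrit\<close>] eq by simp_all
        ultimately have "cell_rank (partner_face \<tau>) < cell_rank g" unfolding pf k using rank_less[of "\<tau> - {?a}" \<sigma>] by simp
        then show ?thesis using pris[OF _ \<tau>K] 3(1) by blast
      qed
    qed
  qed
  then show ?thesis by blast
qed

text \<open>Every prism determines its pair through \<open>partner_face\<close>. This yields both
  that \<open>partner\<close> is injective and that the pairs exhaust the cells outside the
  complex.\<close>

lemma collapse_to_base:
  "collapses_to (cyl.sub cylinder_labels) (cyl.sub ({1} \<times> K))"
  "cw_space (cyl.sub cylinder_labels) homotopy_equivalent_space cw_space (cyl.sub ({1} \<times> K))"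
proof -
  let ?Q = "{0::nat} \<times> Kcrit \<union> {2} \<times> side"
  have sideK: "\<sigma> \<in> K" "\<sigma> \<notin> Kcrit" "\<alpha> (Max \<sigma>) \<notin> \<sigma>" if "\<sigma> \<in> side" for \<sigma> using that by (auto simp: side_def)
  have ins: "insert (\<alpha> (Max \<sigma>)) \<sigma> \<in> K" "insert (\<alpha> (Max \<sigma>)) \<sigma> \<notin> Kcrit" "insert (\<alpha> (Max \<sigma>)) \<sigma> \<notin> side"
    "partner_face (insert (\<alpha> (Max \<sigma>)) \<sigma>) = (2, \<sigma>)" if "\<sigma> \<in> side" for \<sigma>
    using noncrit_Max[OF sideK(1,2)[OF that]] sideK[OF that] by (simp_all add: side_def partner_face_def)
  have pair: "\<exists>\<tau>. partner l = (2, \<tau>) \<and> \<tau> \<in> K \<and> \<tau> \<notin> side \<and> partner_face \<tau> = l" if "l \<in> ?Q" for l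
  proof -
    consider \<sigma> where "l = (0, \<sigma>)" "\<sigma> \<in> Kcrit" | \<sigma> where "l = (2, \<sigma>)" "\<sigma> \<in> side" using \<open>l \<in> ?Q\<close> by blast
    then show ?thesis
    proof cases
      case (1 \<sigma>)
      then show ?thesis using Kcrit_K sideK(2) by (auto simp: partner_def partner_face_def)
    next
      case (2 \<sigma>)
      then show ?thesis using ins[OF 2(2)] by (simp add: partner_def)
    qed
  qed
  have inj: "inj_on partner ?Q"
  proof
    fix l m assume l: "l \<in> ?Q" and m: "m \<in> ?Q" and e: "partner l = partner m"
    obtain \<tau> where \<tau>: "partner l = (2, \<tau>)" "partner_face \<tau> = l" using pair[OF l] by blast
    obtain \<rho> where \<rho>: "partner m = (2, \<rho>)" "partner_face \<rho> = m" using pair[OF m] by blast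
    show "l = m" using \<tau> \<rho> e by simp
  qed
  have img: "partner ` ?Q \<subseteq> {2} \<times> (K - side)" using pair by (intro image_subsetI) fastforce
  have all: "{1} \<times> K \<union> ?Q \<union> partner ` ?Q = cylinder_labels"
  proof (intro equalityI subsetI)
    fix l assume "l \<in> {1} \<times> K \<union> ?Q \<union> partner ` ?Q"
    then show "l \<in> cylinder_labels" using img sideK(1) by (auto simp: cylinder_labels_def)
  next
    fix l assume "l \<in> cylinder_labels"
    then consider "l \<in> {1} \<times> K" | "l \<in> {0} \<times> Kcrit" | \<tau> where "l = (2, \<tau>)" "\<tau> \<in> K" by (auto simp: cylinder_labels_def)
    then show "l \<in> {1} \<times> K \<union> ?Q \<union> partner ` ?Q"
    proof cases
      case (3 \<tau>)
      then show ?thesis using partner_face(1,2)[OF 3(2)] by (metis UnI1 UnI2 imageI)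
    qed auto
  qed
  have free: "cyl.free_pair l (partner l)" if "l \<in> ?Q" for l
  proof -
    consider \<sigma> where "l = (0, \<sigma>)" "\<sigma> \<in> Kcrit" | \<sigma> where "l = (2, \<sigma>)" "\<sigma> \<in> side" using \<open>l \<in> ?Q\<close> by blast
    then show ?thesis
    proof cases
      case (1 \<sigma>)
      then show ?thesis using free_pair_end[of \<sigma> 0] Kcrit_K by (simp add: partner_def)
    next
      case (2 \<sigma>)
      then show ?thesis using free_pair_side[OF ins(1)[OF 2(2)] sideK(3)[OF 2(2)]] K_nonempty[OF sideK(1)[OF 2(2)]]
        by (simp add: partner_def)
    qed
  qed
  have s: "finite ?Q" "?Q \<subseteq> cylinder_labels" "partner ` ?Q \<subseteq> cylinder_labels" "?Q \<inter> {1} \<times> K = {}"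
    "partner ` ?Q \<inter> {1} \<times> K = {}" "?Q \<inter> partner ` ?Q = {}"
  proof -
    have "?Q \<subseteq> cylinder_labels" "partner ` ?Q \<subseteq> cylinder_labels" using all by blast+
    then show "finite ?Q" "?Q \<subseteq> cylinder_labels" "partner ` ?Q \<subseteq> cylinder_labels"
      using finite_subset[OF _ cyl.finite_L] by blast+
    show "partner ` ?Q \<inter> {1} \<times> K = {}" "?Q \<inter> partner ` ?Q = {}" using img by force+
  qed auto
  note * = cyl.acyclic_matching_collapse[of "{1} \<times> K" ?Q partner cell_rank, unfolded all]
  show "collapses_to (cyl.sub cylinder_labels) (cyl.sub ({1} \<times> K))"
    by (rule *(2)[OF down_base s inj free matching_rank])
  show "cw_space (cyl.sub cylinder_labels) homotopy_equivalent_space cw_space (cyl.sub ({1} \<times> K))"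
    by (rule *(3)[OF down_base s inj free matching_rank])
qed

end

section \<open>The two ends of the cylinder: the complex and the core\<close>

context ordered_complex
begin

text \<open>At height 1 the record of the apex contains the point itself, so \<open>G 1\<close> has
  a continuous inverse that reads off coordinates.\<close>

lemma realization_isomorphic: "cw_isomorphic (realization K) (cyl.sub ({1} \<times> K))"
proof -
  \<comment> \<open>The entry at \<open>j = N\<close> of that record is the square of the mass of
    the apex, which is 1, whereas a point of the realization has 0 there.\<close>
  define k where "k z = (\<lambda>j. if j = N then 0 else z (prod_encode (N, j)))" for z :: "nat \<Rightarrow> real"
  let ?X = "\<Union>\<sigma>\<in>K. open_simplex \<sigma>"
  have cell: "cylinder_cell (1, \<sigma>) = G 1 ` open_simplex \<sigma>" for \<sigma> by (auto simp: cylinder_cell_def)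
  have sp: "cw_space (realization K) = top_of_set ?X"
    by (simp add: realization_def euclidean_product_topology)
  have img: "\<Union>(cylinder_cell ` ({1} \<times> K)) = G 1 ` ?X"
    unfolding image_UN cell[symmetric] by blast
  have inv: "k (G 1 x) = x" if x: "x \<in> ?X" for x
  proof
    fix j
    have "x N = 0" using x apex_zero by blast
    then show "k (G 1 x) j = x j" using G_coordinate[of x j 1] by (simp add: k_def)
  qed
  have kc: "continuous_on S k" for S
    unfolding k_def
  proof (rule continuous_on_coordinatewise_then_product)
    fix j show "continuous_on S (\<lambda>z. if j = N then 0 else z (prod_encode (N, j)))"
      by (cases "j = N") (auto intro: continuous_on_coord)
  qed
  have "homeomorphic_maps (top_of_set ?X) (top_of_set (G 1 ` ?X)) (G 1) k"
    unfolding homeomorphic_maps_def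
  proof (intro conjI ballI)
    have "continuous_on ?X (G 1)" by (rule continuous_G[OF continuous_on_const continuous_on_id])
    then show "continuous_map (top_of_set ?X) (top_of_set (G 1 ` ?X)) (G 1)"
      by (simp add: continuous_map_in_subtopology)
    have "k \<in> G 1 ` ?X \<rightarrow> ?X" using inv by fastforce
    then show "continuous_map (top_of_set (G 1 ` ?X)) (top_of_set ?X) k"
      using kc by (simp add: continuous_map_in_subtopology)
    show "k (G 1 x) = x" if "x \<in> topspace (top_of_set ?X)" for x using inv that by simp
    show "G 1 (k y) = y" if "y \<in> topspace (top_of_set (G 1 ` ?X))" for y
    proof -
      obtain x where "x \<in> ?X" "y = G 1 x" using \<open>y \<in> _\<close> by auto
      then show ?thesis using inv by simp
    qed
  qed
  then have "homeomorphic_map (cw_space (realization K)) (cw_space (cyl.sub ({1} \<times> K))) (G 1)"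
    unfolding sp cyl.cw_space_sub img using homeomorphic_map_maps by blast
  moreover have "cw_ncells (cyl.sub ({1} \<times> K)) n = (\<lambda>e. G 1 ` e) ` cw_ncells (realization K) n" for n
  proof -
    have "{l \<in> {1} \<times> K. cylinder_dim l = n} = {1} \<times> {\<sigma> \<in> K. card \<sigma> = n + 1}"
      by (auto dest: card_pos)
    moreover have "cylinder_cell ` ({1} \<times> A) = (\<lambda>e. G 1 ` e) ` open_simplex ` A" for A
      using cell by force
    moreover have "cw_ncells (realization K) n = open_simplex ` {\<sigma> \<in> K. card \<sigma> = n + 1}"
      by (auto simp: realization_def)
    ultimately show ?thesis by (simp add: cyl.sub_def)
  qed
  ultimately show ?thesis unfolding cw_isomorphic_def by (intro exI[of _ "G 1"]) simp
qed

text \<open>The closed cell of \<open>\<kappa>\<close> is the image of the closed simplex with the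
  top vertex of \<open>\<kappa>\<close> as apex. The ball map \<open>\<Theta>\<close> given by the
  opposite face has exactly the fibres of \<open>G 0\<close> on this simplex, so \<open>G 0\<close>
  factors through the disk as an injective map. Injectivity on the closed disk, boundary included,
  is what makes the core regular.\<close>

lemma core_characteristic_map:
  assumes "\<kappa> \<in> Kcrit"
  obtains \<phi> where "characteristic_map (cyl.sub ({0} \<times> Kcrit)) (card \<kappa> - 1) (cylinder_cell (0, \<kappa>))
      (disk (card \<kappa> - 1)) (bdisk (card \<kappa> - 1)) \<phi>"
    "continuous_on (disk (card \<kappa> - 1)) \<phi>" "inj_on \<phi> (disk (card \<kappa> - 1))"
proof -
  note \<kappa>K = Kcrit_K[OF assms]
  note fin = K_finite[OF \<kappa>K] K_nonempty[OF \<kappa>K]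
  define w where "w = Max \<kappa>"
  define \<sigma> where "\<sigma> = \<kappa> - {w}"
  have w: "w \<in> \<kappa>" "w \<in> crit" using Max_in[OF fin] assms by (simp_all add: w_def Kcrit_def)
  have wN: "w < N" using bounded[OF \<kappa>K] w(1) by blast
  have \<sigma>: "finite \<sigma>" "\<sigma> \<subseteq> {..<w}" "w \<notin> \<sigma>" "\<kappa> = insert w \<sigma>" "card \<sigma> = card \<kappa> - 1"
  proof -
    have "v < w" if "v \<in> \<kappa>" "v \<noteq> w" for v using Max_ge[OF fin(1) that(1)] that(2) by (simp add: w_def)
    then show "\<sigma> \<subseteq> {..<w}" by (auto simp: \<sigma>_def)
  qed (use fin w(1) in \<open>auto simp: \<sigma>_def\<close>)
  let ?n = "card \<kappa> - 1"
  define C where "C = cone_simplex \<sigma>"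
  have C_compact: "compact C" unfolding C_def by (rule compact_cone_simplex[OF \<sigma>(1)])
  have Cp: "0 \<le> fst p" "0 \<le> snd p v" "v \<notin> \<sigma> \<Longrightarrow> snd p v = 0" "fst p + sum (snd p) \<sigma> = 1" if "p \<in> C" for p v
    using that by (auto simp: C_def cone_simplex_def)
  obtain \<Theta> where "cell_ball w \<sigma> \<Theta>" using cell_ball_exists[OF \<sigma>(1,2)] by blast
  note \<Theta> = cell_ballD[OF this, folded C_def, unfolded \<sigma>(5)]
  \<comment> \<open>Puts the apex, which \<open>cell_ball\<close> keeps apart, back to its place
    \<open>w\<close> among the vertices.\<close>
  define E where "E p = (snd p)(w := fst p)" for p :: "real \<times> (nat \<Rightarrow> real)"
  have E_zero: "E p v = 0" if "p \<in> C" "v \<notin> \<kappa>" for p v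
    using Cp(3)[OF that(1), of v] that(2) \<sigma>(4) by (auto simp: E_def)
  \<comment> \<open>The stages above \<open>w\<close> find no mass and do nothing, so
    \<open>F_Suc_crit\<close> at the critical vertex \<open>w\<close> will describe the
    fibres.\<close>
  have GE: "G 0 (E p) = F (Suc w) (E p)" if "p \<in> C" for p
  proof -
    have z: "E p v = 0" if "Suc w \<le> v" for v
    proof (rule E_zero[OF \<open>p \<in> C\<close>])
      show "v \<notin> \<kappa>" using \<sigma>(2) that unfolding \<sigma>(4) by (auto dest: subsetD)
    qed
    have "(E p)(N := 0) = E p" using z[of N] wN by auto
    then show ?thesis unfolding G_def using F_supported[of "Suc w" "E p" "Suc N"] z wN by simp
  qed
  have fib: "G 0 (E p) = G 0 (E q) \<longleftrightarrow> \<Theta> p = \<Theta> q" if p: "p \<in> C" and q: "q \<in> C" for p q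
  proof -
    have 0: "snd p w = 0" "snd q w = 0" using Cp(3)[OF p \<sigma>(3)] Cp(3)[OF q \<sigma>(3)] by auto
    have e: "E p = E q \<longleftrightarrow> snd p = snd q \<and> fst p = fst q"
      using 0 unfolding E_def by (metis fun_upd_same fun_upd_triv fun_upd_upd)
    have z: "E p = snd p" if "fst p = 0" using that 0(1) by (auto simp: E_def)
    have z': "E q = snd q" if "fst q = 0" using that 0(2) by (auto simp: E_def)
    have E_w: "E p w = fst p" "E q w = fst q" by (simp_all add: E_def)
    have "G 0 (E p) = G 0 (E q) \<longleftrightarrow>
      fst p = fst q \<and> (0 < fst p \<longrightarrow> E p = E q) \<and> (fst p = 0 \<longrightarrow> F w (E p) = F w (E q))"
      unfolding GE[OF p] GE[OF q]
      using F_Suc_crit[OF w(2), of "E p" "E q"] Cp(1)[OF p] Cp(1)[OF q] unfolding E_w by blast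
    also have "\<dots> \<longleftrightarrow> \<Theta> p = \<Theta> q"
      unfolding \<Theta>(4)[OF p q] using e z z' by auto
    finally show ?thesis .
  qed
  have E_c: "continuous_on C (\<lambda>p. G 0 (E p))"
    unfolding E_def
    by (intro continuous_G continuous_on_const continuous_on_fun_upd continuous_on_snd continuous_on_fst continuous_on_id)
  obtain \<phi> where \<phi>: "continuous_on (\<Theta> ` C) \<phi>" "\<And>p. p \<in> C \<Longrightarrow> \<phi> (\<Theta> p) = G 0 (E p)"
    by (rule compact_continuous_factor[OF C_compact \<Theta>(1) E_c]) (use fib in blast)+
  have im: "\<Theta> ` C = disk ?n" by (rule \<Theta>(2))
  have inj: "inj_on \<phi> (disk ?n)"
    unfolding im[symmetric] using \<phi>(2) fib by (auto simp: inj_on_def)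
  have open_E: "E p \<in> open_simplex \<tau>"
    if p: "p \<in> C" and \<tau>: "\<tau> = {v \<in> \<kappa>. E p v \<noteq> 0}" for p \<tau>
  proof -
    have "sum (E p) \<tau> = sum (E p) \<kappa>" unfolding \<tau> using fin by (intro sum.mono_neutral_left) auto
    also have "\<dots> = fst p + sum (E p) \<sigma>" unfolding \<sigma>(4) using \<sigma>(1,3) by (simp add: E_def)
    also have "sum (E p) \<sigma> = sum (snd p) \<sigma>" using \<sigma>(3) by (intro sum.cong) (auto simp: E_def)
    finally have s: "sum (E p) \<tau> = 1" using Cp(4)[OF p] by simp
    have nn: "0 \<le> E p v" for v using Cp(1,2)[OF p] by (simp add: E_def)
    show ?thesis
      unfolding open_simplex_def
    proof (intro CollectI conjI ballI allI impI s)
      show "0 < E p v" if "v \<in> \<tau>" for v using that nn[of v] by (simp add: \<tau> less_le)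
      show "E p v = 0" if "v \<notin> \<tau>" for v using that E_zero[OF p, of v] by (auto simp: \<tau>)
    qed
  qed
  have bdry: "\<Theta> p \<in> bdisk ?n \<longleftrightarrow> (\<exists>v\<in>\<kappa>. E p v = 0)" if "p \<in> C" for p
  proof -
    have "(\<exists>v\<in>insert w \<sigma>. E p v = 0) \<longleftrightarrow> fst p = 0 \<or> (\<exists>v\<in>\<sigma>. snd p v = 0)"
      using \<sigma>(3) by (auto simp: E_def)
    then show ?thesis using \<Theta>(3)[OF that] unfolding \<sigma>(4)[symmetric] by simp
  qed
  have dn: "cylinder_dim (0, \<kappa>) = ?n" by simp
  have "characteristic_map (cyl.sub ({0} \<times> Kcrit)) (cylinder_dim (0, \<kappa>)) (cylinder_cell (0, \<kappa>))
      (disk (cylinder_dim (0, \<kappa>))) (bdisk (cylinder_dim (0, \<kappa>))) \<phi>"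
  proof (rule cyl.disk_characteristic_map[OF down_core])
    show "(0, \<kappa>) \<in> {0} \<times> Kcrit" using assms by simp
    show "continuous_on (disk (cylinder_dim (0, \<kappa>))) \<phi>" using \<phi>(1) unfolding im dn .
    show "inj_on \<phi> (disk (cylinder_dim (0, \<kappa>)) - bdisk (cylinder_dim (0, \<kappa>)))"
      unfolding dn by (rule inj_on_subset[OF inj]) blast
    show "\<phi> ` (disk (cylinder_dim (0, \<kappa>)) - bdisk (cylinder_dim (0, \<kappa>))) = cylinder_cell (0, \<kappa>)"
    proof (intro equalityI subsetI)
      fix z assume "z \<in> \<phi> ` (disk (cylinder_dim (0, \<kappa>)) - bdisk (cylinder_dim (0, \<kappa>)))"
      then obtain d where d: "d \<in> disk ?n" "d \<notin> bdisk ?n" "z = \<phi> d" unfolding dn by blast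
      obtain p where p: "p \<in> C" "d = \<Theta> p" using d(1) unfolding im[symmetric] by blast
      have "\<forall>v\<in>\<kappa>. E p v \<noteq> 0" using bdry[OF p(1)] d(2) p(2) by blast
      then have "E p \<in> open_simplex \<kappa>" using open_E[OF p(1), of \<kappa>] by blast
      then show "z \<in> cylinder_cell (0, \<kappa>)" using \<phi>(2)[OF p(1)] d(3) p(2) by (auto simp: cylinder_cell_def)
    next
      fix z assume "z \<in> cylinder_cell (0, \<kappa>)"
      then obtain x where x: "x \<in> open_simplex \<kappa>" "z = G 0 x" by (auto simp: cylinder_cell_def)
      define p where "p = (x w, x(w := 0))"
      have x': "\<And>v. v \<in> \<kappa> \<Longrightarrow> 0 < x v" "\<And>v. v \<notin> \<kappa> \<Longrightarrow> x v = 0" "sum x \<kappa> = 1"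
        using x(1) by (auto simp: open_simplex_def)
      have x0: "0 \<le> x v" for v using x'(1,2)[of v] by (cases "v \<in> \<kappa>") auto
      have "sum (x(w := 0)) \<sigma> = sum x \<sigma>" using \<sigma>(3) by (intro sum.cong) auto
      then have "x w + sum (x(w := 0)) \<sigma> = 1" using x'(3) \<sigma>(1,3) unfolding \<sigma>(4) by simp
      then have pC: "p \<in> C" using x0 x'(2) \<sigma>(4) by (auto simp: C_def cone_simplex_def p_def)
      have Ep: "E p = x" by (simp add: E_def p_def)
      have "\<Theta> p \<notin> bdisk ?n" unfolding bdry[OF pC] Ep using x'(1) by fastforce
      moreover have "\<Theta> p \<in> disk ?n" using pC im by blast
      ultimately show "z \<in> \<phi> ` (disk (cylinder_dim (0, \<kappa>)) - bdisk (cylinder_dim (0, \<kappa>)))"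
        unfolding dn using \<phi>(2)[OF pC] Ep x(2) by (intro image_eqI[of _ _ "\<Theta> p"]) auto
    qed
    show "\<phi> ` bdisk (cylinder_dim (0, \<kappa>)) \<subseteq> \<Union>(cylinder_cell ` cylinder_bd (0, \<kappa>))"
      unfolding dn
    proof (rule image_subsetI)
      fix d assume d: "d \<in> bdisk ?n"
      then have "d \<in> disk ?n" using bdisk_sub by blast
      then obtain p where p: "p \<in> C" "d = \<Theta> p" unfolding im[symmetric] by blast
      define \<tau> where "\<tau> = {v \<in> \<kappa>. E p v \<noteq> 0}"
      have o: "E p \<in> open_simplex \<tau>" by (rule open_E[OF p(1) \<tau>_def])
      have "\<tau> \<noteq> {}" using o by (auto simp: open_simplex_def)
      moreover have "\<tau> \<noteq> \<kappa>" using bdry[OF p(1)] d p(2) by (auto simp: \<tau>_def)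
      ultimately have \<tau>: "\<tau> \<in> faces \<kappa>" by (auto simp: faces_def \<tau>_def)
      have "\<phi> d \<in> cylinder_cell (0, peel N \<tau>)"
        using G_cells(1)[OF _ o] faces_K[OF \<kappa>K \<tau>] \<phi>(2)[OF p(1)] p(2) by simp
      moreover have "(0, peel N \<tau>) \<in> cylinder_bd (0, \<kappa>)" using \<tau> by (simp add: cylinder_bd_def)
      ultimately show "\<phi> d \<in> \<Union>(cylinder_cell ` cylinder_bd (0, \<kappa>))" by blast
    qed
  qed
  then show ?thesis using \<phi>(1) inj unfolding dn im by (rule that)
qed

lemma compact_bdisk: "compact (bdisk n)"
proof -
  have "bdisk n = disk n \<inter> {x. enorm n x = 1}" by (auto simp: bdisk_eq disk_eq)
  moreover have "closed {x. enorm n x = 1}"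
    by (intro closed_Collect_eq continuous_on_enorm continuous_on_id continuous_on_const)
  ultimately show ?thesis using compact_Int_closed[OF compact_disk] by simp
qed

lemma regular_core: "regular_cw_complex (cyl.sub ({0} \<times> Kcrit))"
  unfolding regular_cw_complex_def
proof (intro conjI allI ballI)
  let ?X = "cyl.sub ({0} \<times> Kcrit)"
  show "cw_complex ?X" using cyl.finite_cw_sub[OF down_core] by (simp add: finite_cw_complex_def)
  fix n e assume "e \<in> cw_ncells ?X n"
  then obtain \<kappa> where \<kappa>: "\<kappa> \<in> Kcrit" "card \<kappa> - 1 = n" "e = cylinder_cell (0, \<kappa>)" by (auto simp: cyl.sub_def)
  obtain \<phi> where \<phi>: "characteristic_map ?X n e (disk n) (bdisk n) \<phi>" "continuous_on (disk n) \<phi>" "inj_on \<phi> (disk n)"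
    using core_characteristic_map[OF \<kappa>(1), unfolded \<kappa>(2), folded \<kappa>(3)] by blast
  let ?S = "skel_below ?X n" let ?T = "\<Union>(cylinder_cell ` ({0} \<times> Kcrit))"
  have im: "\<phi> ` bdisk n \<subseteq> ?S" using \<phi>(1) by (simp add: characteristic_map_def)
  have "?S \<subseteq> ?T" by (auto simp: cyl.skel_below_sub)
  have B: "subtopology (Euclidean_space n) (bdisk n) = top_of_set (bdisk n)"
    by (rule subtopology_Euclidean_space) (use bdisk_sub disk_sub_Rn in blast)
  have "?T \<inter> (?S \<inter> \<phi> ` bdisk n) = \<phi> ` bdisk n" using im \<open>?S \<subseteq> ?T\<close> by blast
  then have R: "subtopology (subtopology (cw_space ?X) ?S) (\<phi> ` bdisk n) = top_of_set (\<phi> ` bdisk n)"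
    by (simp add: cyl.cw_space_sub subtopology_subtopology Int_assoc)
  have "homeomorphic_map (top_of_set (bdisk n - {})) (top_of_set (\<phi> ` (bdisk n - {}))) \<phi>"
    using continuous_on_subset[OF \<phi>(2) bdisk_sub] inj_on_subset[OF \<phi>(3) bdisk_sub] compact_bdisk
    by (intro compact_homeomorphic_map_interior) auto
  then have "embedding_map (subtopology (Euclidean_space n) (bdisk n)) (subtopology (cw_space ?X) ?S) \<phi>"
    unfolding embedding_map_def B using R by simp
  then show "\<exists>\<phi>. characteristic_map ?X n e (disk n) (bdisk n) \<phi> \<and>
      embedding_map (subtopology (Euclidean_space n) (bdisk n)) (subtopology (cw_space ?X) ?S) \<phi>"
    using \<phi>(1) by blast
qed

lemma core_cells_bij: "bij_betw (\<lambda>\<kappa>. cylinder_cell (0, \<kappa>)) Kcrit (cw_cells (cyl.sub ({0} \<times> Kcrit)))"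
proof -
  have "inj_on (\<lambda>\<kappa>. cylinder_cell (0, \<kappa>)) Kcrit"
    using cyl.cell_inj by (auto simp: inj_on_def cylinder_labels_def)
  moreover have "cw_cells (cyl.sub ({0} \<times> Kcrit)) = (\<lambda>\<kappa>. cylinder_cell (0, \<kappa>)) ` Kcrit"
    unfolding cyl.cw_cells_sub by force
  ultimately show ?thesis by (simp add: bij_betw_def)
qed

text \<open>The bound is on numbers of vertices and not on dimensions of simplices, because the
  prism over \<open>\<sigma>\<close> has dimension \<open>card \<sigma>\<close>.\<close>

lemma core_deformation:
  assumes "\<And>\<sigma>. \<sigma> \<in> K \<Longrightarrow> int (card \<sigma>) \<le> m" and X: "cw_isomorphic X (realization K)"
  shows "deformation m X (cyl.sub ({0} \<times> Kcrit))"
  unfolding deformation_def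
proof (intro exI conjI)
  \<comment> \<open>An expansion from the complex to the cylinder, followed by a collapse to the
    core.\<close>
  let ?Zs = "[cyl.sub ({1} \<times> K), cyl.sub cylinder_labels, cyl.sub ({0} \<times> Kcrit)]"
  show "?Zs \<noteq> []" by simp
  show "cw_isomorphic X (hd ?Zs)" using cw_isomorphic_trans[OF X realization_isomorphic] by simp
  have "cw_isomorphic Y Y" for Y :: "(nat \<Rightarrow> real) cw"
    unfolding cw_isomorphic_def by (intro exI[of _ id]) simp
  then show "cw_isomorphic (last ?Zs) (cyl.sub ({0} \<times> Kcrit))" by simp
  have "int (cylinder_dim l) \<le> m" if "l \<in> cylinder_labels" for l
    using card_labels[OF that] assms(1)[of "snd l"] by (auto simp: cylinder_dim_def)
  then have "cw_dim_le (cyl.sub S) m" if "S \<subseteq> cylinder_labels" for S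
    using that by (intro cyl.cw_dim_le_sub) blast
  then show "\<forall>Z\<in>set ?Zs. finite_cw_complex Z \<and> cw_dim_le Z m"
    using cyl.finite_cw_sub down_core down_base down_all by (simp add: cyl.down_def)
  show "successively (\<lambda>Z Z'. collapses_to Z Z' \<or> collapses_to Z' Z) ?Zs"
    using collapse_to_base(1) collapse_to_core(1) by simp
qed

lemma core_homotopy_equivalent:
  assumes "cw_isomorphic X (realization K)"
  shows "cw_space X homotopy_equivalent_space cw_space (cyl.sub ({0} \<times> Kcrit))"
  using cw_isomorphic_homotopy_equivalent[OF cw_isomorphic_trans[OF assms realization_isomorphic]]
    collapse_to_base(2) collapse_to_core(2)
  by (meson homotopy_eqv_trans homotopy_equivalent_space_sym)

end

section \<open>Numbering the vertices of a given complex\<close>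

text \<open>The number of predecessors of an element is its position in the order.\<close>

lemma finite_strict_order_embedding:
  assumes "finite V" and irrefl: "\<And>u. \<not> R u u" and trans: "\<And>u v w. R u v \<Longrightarrow> R v w \<Longrightarrow> R u w"
    and total: "\<And>u v. u \<in> V \<Longrightarrow> v \<in> V \<Longrightarrow> u \<noteq> v \<Longrightarrow> R u v \<or> R v u"
  shows "\<exists>ord :: 'v \<Rightarrow> nat. inj_on ord V \<and> (\<forall>u\<in>V. \<forall>v\<in>V. ord u < ord v \<longleftrightarrow> R u v)"
proof -
  define ord where "ord v = card {u \<in> V. R u v}" for v
  have less: "ord u < ord v" if "u \<in> V" "R u v" for u v
    unfolding ord_def
  proof (rule psubset_card_mono)
    show "{w \<in> V. R w u} \<subset> {w \<in> V. R w v}" using that irrefl[of u] trans by blast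
  qed (simp add: assms(1))
  have "inj_on ord V"
    using less total by (metis inj_onI less_irrefl)
  moreover have "ord u < ord v \<longleftrightarrow> R u v" if "u \<in> V" "v \<in> V" for u v
    using less total that by (metis less_asym less_irrefl)
  ultimately show ?thesis by blast
qed

lemma realization_relabel:
  fixes ord :: "'v \<Rightarrow> nat"
  assumes "inj_on ord (\<Union>K)"
  shows "cw_isomorphic (realization K) (realization ((`) ord ` K))"
proof -
  let ?V = "\<Union>K"
  define h where "h x n = (if n \<in> ord ` ?V then x (the_inv_into ?V ord n) else 0)" for x :: "'v \<Rightarrow> real" and n
  define k where "k z v = (if v \<in> ?V then z (ord v) else 0)" for z :: "nat \<Rightarrow> real" and v
  have h_ord: "h x (ord v) = x v" if "v \<in> ?V" for x v
    using that the_inv_into_f_f[OF assms that] by (auto simp: h_def)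
  have kh: "k (h x) = x" if "x \<in> open_simplex \<sigma>" "\<sigma> \<in> K" for x \<sigma>
  proof
    fix v
    have "x v = 0" if "v \<notin> ?V" using that \<open>x \<in> open_simplex \<sigma>\<close> \<open>\<sigma> \<in> K\<close> by (auto simp: open_simplex_def)
    then show "k (h x) v = x v" by (simp add: k_def h_ord)
  qed
  have hk: "h (k z) = z" if "z \<in> open_simplex (ord ` \<sigma>)" "\<sigma> \<in> K" for z \<sigma>
  proof
    fix n show "h (k z) n = z n"
    proof (cases "n \<in> ord ` ?V")
      case True
      then obtain v where "v \<in> ?V" "n = ord v" by blast
      then show ?thesis by (simp add: h_ord k_def)
    next
      case False
      then have "n \<notin> ord ` \<sigma>" using \<open>\<sigma> \<in> K\<close> by blast
      then show ?thesis using False that(1) by (simp add: h_def open_simplex_def)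
    qed
  qed
  have inj\<sigma>: "inj_on ord \<sigma>" if "\<sigma> \<in> K" for \<sigma> using inj_on_subset[OF assms, of \<sigma>] that by blast
  have h_in: "h x \<in> open_simplex (ord ` \<sigma>)" if x: "x \<in> open_simplex \<sigma>" and \<sigma>: "\<sigma> \<in> K" for x \<sigma>
  proof -
    have hv: "h x (ord v) = x v" if "v \<in> \<sigma>" for v using h_ord[of v x] that \<sigma> by blast
    have "sum (h x) (ord ` \<sigma>) = sum x \<sigma>"
      using hv by (simp add: sum.reindex[OF inj\<sigma>[OF \<sigma>]])
    moreover have "h x n = 0" if n: "n \<notin> ord ` \<sigma>" for n
    proof (cases "n \<in> ord ` ?V")
      case True
      then obtain v where "v \<in> ?V" "n = ord v" by blast
      then show ?thesis using n x by (auto simp: h_ord open_simplex_def)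
    qed (simp add: h_def)
    ultimately show ?thesis using hv x by (auto simp: open_simplex_def)
  qed
  have k_in: "k z \<in> open_simplex \<sigma>" if z: "z \<in> open_simplex (ord ` \<sigma>)" and \<sigma>: "\<sigma> \<in> K" for z \<sigma>
  proof -
    have kv: "k z v = z (ord v)" if "v \<in> \<sigma>" for v using that \<sigma> by (auto simp: k_def)
    have "sum (k z) \<sigma> = sum z (ord ` \<sigma>)" using kv by (simp add: sum.reindex[OF inj\<sigma>[OF \<sigma>]])
    moreover have "k z v = 0" if v: "v \<notin> \<sigma>" for v
    proof (cases "v \<in> ?V")
      case True
      have "ord v \<notin> ord ` \<sigma>" using inj_on_image_mem_iff[OF assms True, of \<sigma>] v \<sigma> by blast
      then show ?thesis using z by (simp add: k_def open_simplex_def)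
    qed (simp add: k_def)
    ultimately show ?thesis using kv z by (auto simp: open_simplex_def)
  qed
  let ?X = "\<Union>\<sigma>\<in>K. open_simplex \<sigma>" let ?Y = "\<Union>\<sigma>\<in>(`) ord ` K. open_simplex \<sigma>"
  have coord: "continuous_on S (\<lambda>x. x i)" for S :: "('i \<Rightarrow> real) set" and i
    by (rule continuous_on_product_then_coordinatewise) (rule continuous_on_id)
  have "continuous_on ?X h"
  proof (rule continuous_on_coordinatewise_then_product)
    show "continuous_on ?X (\<lambda>x. h x n)" for n
      unfolding h_def by (cases "n \<in> ord ` ?V") (simp_all add: coord)
  qed
  moreover have "continuous_on ?Y k"
  proof (rule continuous_on_coordinatewise_then_product)
    show "continuous_on ?Y (\<lambda>z. k z v)" for v
      unfolding k_def by (cases "v \<in> ?V") (simp_all add: coord)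
  qed
  ultimately have "homeomorphic_maps (top_of_set ?X) (top_of_set ?Y) h k"
    unfolding homeomorphic_maps_def using h_in k_in hk kh
    by (auto simp: continuous_map_in_subtopology)
  then have "homeomorphic_map (cw_space (realization K)) (cw_space (realization ((`) ord ` K))) h"
    unfolding realization_def using homeomorphic_map_maps by (auto simp: euclidean_product_topology)
  moreover have "cw_ncells (realization ((`) ord ` K)) n = (\<lambda>e. h ` e) ` cw_ncells (realization K) n" for n
  proof -
    have cell: "open_simplex (ord ` \<sigma>) = h ` open_simplex \<sigma>" if "\<sigma> \<in> K" for \<sigma>
    proof (intro equalityI subsetI)
      fix z assume "z \<in> open_simplex (ord ` \<sigma>)"
      then show "z \<in> h ` open_simplex \<sigma>" using hk k_in that by (metis imageI)
    qed (use h_in that in blast)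
    have card: "card (ord ` \<sigma>) = card \<sigma>" if "\<sigma> \<in> K" for \<sigma> using card_image[OF inj\<sigma>[OF that]] .
    have "cw_ncells (realization ((`) ord ` K)) n = (\<lambda>\<sigma>. open_simplex (ord ` \<sigma>)) ` {\<sigma> \<in> K. card \<sigma> = n + 1}"
      using card by (auto simp: realization_def)
    also have "\<dots> = (\<lambda>\<sigma>. h ` open_simplex \<sigma>) ` {\<sigma> \<in> K. card \<sigma> = n + 1}"
      using cell by (intro image_cong) auto
    also have "\<dots> = (\<lambda>e. h ` e) ` open_simplex ` {\<sigma> \<in> K. card \<sigma> = n + 1}" by (simp add: image_image)
    also have "open_simplex ` {\<sigma> \<in> K. card \<sigma> = n + 1} = cw_ncells (realization K) n"
      by (auto simp: realization_def)
    finally show ?thesis .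
  qed
  ultimately show ?thesis unfolding cw_isomorphic_def by (intro exI[of _ h]) simp
qed

lemma simplicial_cpx_subset:
  assumes "simplicial_cpx K" "\<sigma> \<in> K" "\<tau> \<subseteq> \<sigma>" "\<tau> \<noteq> {}"
  shows "\<tau> \<in> K"
proof -
  have "\<forall>\<sigma>\<in>K. \<forall>\<tau>. \<tau> \<noteq> {} \<and> \<tau> \<subseteq> \<sigma> \<longrightarrow> \<tau> \<in> K"
    using assms(1) unfolding simplicial_cpx_def by (rule conjunct2)
  from bspec[OF this assms(2), THEN spec, THEN mp, OF conjI, OF assms(4,3)] show ?thesis .
qed

text \<open>A simplex of a cone stays in the cone when the apex is added. Applied to the link of
  \<open>v\<close>, this concerns the simplices of \<open>K\<close> that contain
  \<open>v\<close>.\<close>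

lemma dominated_by_insert:
  assumes "simplicial_cpx K" "dominated_by K v a" "\<sigma> \<in> K" "v \<in> \<sigma>"
  shows "insert a \<sigma> \<in> K"
proof -
  obtain K0 where K0: "link v K = simplicial_cone a K0" using assms(2) by (auto simp: dominated_by_def)
  have link: "insert v \<tau> \<in> K" if "\<tau> \<in> simplicial_cone a K0" for \<tau>
    using that unfolding K0[symmetric] by (simp add: link_def)
  \<comment> \<open>\<open>{v}\<close> is a case of its own: removing \<open>v\<close> leaves the
    empty set, which does not count as a simplex of the link.\<close>
  have "\<sigma> = {v} \<or> \<sigma> - {v} \<in> simplicial_cone a K0"
  proof (cases "\<sigma> = {v}")
    case False
    then have "\<sigma> - {v} \<noteq> {}" using assms(4) by blast
    then have "\<sigma> - {v} \<in> K" by (intro simplicial_cpx_subset[OF assms(1,3)]) auto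
    then show ?thesis unfolding K0[symmetric] using assms(3,4) by (simp add: link_def delete_vertex_def insert_absorb)
  qed simp
  moreover have "insert a {v} \<in> K" using link[of "{a}"] by (simp add: simplicial_cone_def insert_commute)
  moreover have "insert a \<sigma> \<in> K" if s: "\<sigma> - {v} \<in> simplicial_cone a K0"
  proof -
    have "insert a \<tau> \<in> simplicial_cone a K0" if "\<tau> \<in> simplicial_cone a K0" for \<tau>
    proof -
      consider "\<tau> \<in> K0" | "a \<in> \<tau>" using \<open>\<tau> \<in> _\<close> by (auto simp only: simplicial_cone_def)
      then show ?thesis
      proof cases
        case 1
        then have "\<tau> \<union> {a} \<in> {\<sigma> \<union> {a} |\<sigma>. \<sigma> \<in> K0}" by (intro CollectI exI[of _ \<tau>] conjI refl)
        then show ?thesis by (simp add: simplicial_cone_def)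
      qed (use that in \<open>simp add: insert_absorb\<close>)
    qed
    from link[OF this[OF s]] show ?thesis using assms(4) by (simp add: insert_absorb insert_commute[of v a])
  qed
  ultimately show ?thesis by blast
qed

lemma simplicial_cpx_sublevel: "simplicial_cpx K \<Longrightarrow> simplicial_cpx (sublevel g K c)"
  unfolding simplicial_cpx_def sublevel_def by blast

theorem mainTheorem1:
  fixes K :: "'v set set" and g :: "'v \<Rightarrow> real"
  assumes "simplicial_cpx K" and "finite K"
  shows "\<exists>core :: (nat \<Rightarrow> real) cw.
    regular_cw_complex core \<and>
    cw_space (realization K) homotopy_equivalent_space cw_space core \<and>
    (\<exists>b. bij_betw b (cw_cells core)
           (\<Union>{descending_star g w K |w. strong_critical g K w})) \<and>
    (\<forall>N. simplicial_dim K = N \<longrightarrow> deformation (N + 1) (realization K) core)"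
proof -
  have fin: "finite \<sigma>" and ne: "\<sigma> \<noteq> {}" if "\<sigma> \<in> K" for \<sigma> using assms(1) that by (auto simp: simplicial_cpx_def)
  have sub: "\<tau> \<in> K" if "\<sigma> \<in> K" "\<tau> \<subseteq> \<sigma>" "\<tau> \<noteq> {}" for \<sigma> \<tau>
    using simplicial_cpx_subset[OF assms(1) that] .
  define V where "V = \<Union>K"
  have V: "v \<in> vertices K" if "v \<in> V" for v using that sub[of _ "{v}"] by (auto simp: V_def vertices_def)
  have finV: "finite V" unfolding V_def using assms(2) fin by blast
  have \<sigma>V: "\<sigma> \<subseteq> V" if "\<sigma> \<in> K" for \<sigma> using that by (auto simp: V_def)
  define D where "D = {v \<in> V. descending_dominated g K v}"
  \<comment> \<open>On each level the dominated vertices come first. So they stay dominated when they are on top, and a simplex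
    has a strong critical top vertex as soon as it has any strong critical vertex on its highest level.\<close>
  obtain e :: "'v \<Rightarrow> nat" where e: "inj_on e V" using finite_imp_inj_to_nat_seg[OF finV] by blast
  define key where "key v = (if v \<in> D then 0 else 1 :: nat)" for v
  define before where "before u v \<longleftrightarrow> g u < g v \<or> g u = g v \<and> (key u < key v \<or> key u = key v \<and> e u < e v)" for u v
  have "\<exists>ord :: 'v \<Rightarrow> nat. inj_on ord V \<and> (\<forall>u\<in>V. \<forall>v\<in>V. ord u < ord v \<longleftrightarrow> before u v)"
  proof (rule finite_strict_order_embedding[OF finV, of before])
    show "\<not> before u u" for u by (simp add: before_def)
    show "before u w" if "before u v" "before v w" for u v w using that by (auto simp: before_def)
    show "before u v \<or> before v u" if "u \<in> V" "v \<in> V" "u \<noteq> v" for u v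
    proof -
      have "e u < e v \<or> e v < e u" using inj_onD[OF e _ that(1,2)] that(3) by (meson nat_neq_iff)
      then show ?thesis by (auto simp: before_def)
    qed
  qed
  then obtain ord :: "'v \<Rightarrow> nat" where ord: "inj_on ord V" "\<And>u v. u \<in> V \<Longrightarrow> v \<in> V \<Longrightarrow> ord u < ord v \<longleftrightarrow> before u v"
    by blast
  have ord_le: "g u \<le> g v" if "u \<in> V" "v \<in> V" "ord u \<le> ord v" for u v
  proof (cases "u = v")
    case False
    then have "ord u < ord v" using that inj_onD[OF ord(1), of u v] by (auto simp: le_less)
    then show ?thesis using ord(2)[OF that(1,2)] by (auto simp: before_def)
  qed simp
  \<comment> \<open>Domination is given in the whole sublevel complex, which contains all vertices
    on the level of \<open>v\<close>, also those ordered after \<open>v\<close>. In particular it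
    covers the simplices with top vertex \<open>v\<close>.\<close>
  have "\<exists>a\<in>V. g a < g v \<and> (\<forall>\<sigma>\<in>K. v \<in> \<sigma> \<and> (\<forall>x\<in>\<sigma>. g x \<le> g v) \<longrightarrow> insert a \<sigma> \<in> K)" if v: "v \<in> D" for v
  proof -
    obtain a where a: "dominated_by (sublevel g K (g v)) v a" "g a < g v"
      using v by (auto simp: D_def descending_dominated_def)
    note ins = dominated_by_insert[OF simplicial_cpx_sublevel[OF assms(1)] a(1)]
    have i: "insert a \<sigma> \<in> K" if "\<sigma> \<in> K" "v \<in> \<sigma>" "\<forall>x\<in>\<sigma>. g x \<le> g v" for \<sigma>
      using ins[of \<sigma>] that by (simp add: sublevel_def)
    have "{v} \<in> K" using v V by (auto simp: D_def vertices_def)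
    then have "insert a {v} \<in> K" using i[of "{v}"] by simp
    then have "a \<in> V" by (auto simp: V_def)
    then show ?thesis using a(2) i by blast
  qed
  then obtain dom where dom: "\<And>v. v \<in> D \<Longrightarrow> dom v \<in> V" "\<And>v. v \<in> D \<Longrightarrow> g (dom v) < g v"
    "\<And>v \<sigma>. v \<in> D \<Longrightarrow> \<sigma> \<in> K \<Longrightarrow> v \<in> \<sigma> \<Longrightarrow> \<forall>x\<in>\<sigma>. g x \<le> g v \<Longrightarrow> insert (dom v) \<sigma> \<in> K"
    by metis
  have DV: "D \<subseteq> V" by (auto simp: D_def)
  have top: "\<exists>v\<in>\<sigma>. Max (ord ` \<sigma>) = ord v \<and> (\<forall>x\<in>\<sigma>. ord x \<le> ord v)" if "\<sigma> \<in> K" for \<sigma>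
    using Max_in[of "ord ` \<sigma>"] Max_ge[of "ord ` \<sigma>"] fin[OF that] ne[OF that] by fastforce
  have ordD: "ord v \<in> ord ` D \<longleftrightarrow> v \<in> D" if "v \<in> V" for v by (rule inj_on_image_mem_iff[OF ord(1) that DV])
  define K' where "K' = (`) ord ` K"
  define crit where "crit = - ord ` D"
  define \<alpha> where "\<alpha> n = ord (dom (the_inv_into V ord n))" for n
  have \<alpha>: "\<alpha> (ord v) = ord (dom v)" if "v \<in> V" for v using the_inv_into_f_f[OF ord(1) that] by (simp add: \<alpha>_def)
  \<comment> \<open>Above all numbers in use; the extra 0 gives \<open>Max\<close> a value when
    there are no vertices.\<close>
  define N where "N = Suc (Max (insert 0 (ord ` V)))"
  have ordN: "ord v < N" if "v \<in> V" for v
    unfolding N_def less_Suc_eq_le using finV that by (intro Max_ge) auto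
  interpret C: ordered_complex crit \<alpha> K' N
  proof
    show "\<alpha> i < i" if "i \<notin> crit" for i
    proof -
      obtain v where v: "v \<in> D" "i = ord v" using \<open>i \<notin> crit\<close> by (auto simp: crit_def)
      have "before (dom v) v" using dom(2)[OF v(1)] by (simp add: before_def)
      then show ?thesis using v \<alpha>[of v] ord(2)[OF dom(1)[OF v(1)], of v] DV by auto
    qed
    show "simplicial_cpx K'"
      unfolding simplicial_cpx_def
    proof (intro conjI ballI allI impI)
      fix \<sigma> assume "\<sigma> \<in> K'"
      then obtain \<rho> where \<rho>: "\<rho> \<in> K" "\<sigma> = ord ` \<rho>" by (auto simp: K'_def)
      show "finite \<sigma>" "\<sigma> \<noteq> {}" using \<rho> fin ne by auto
      fix \<tau> assume "\<tau> \<noteq> {} \<and> \<tau> \<subseteq> \<sigma>"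
      then obtain \<rho>' where "\<rho>' \<subseteq> \<rho>" "\<tau> = ord ` \<rho>'" "\<rho>' \<noteq> {}" using \<rho>(2) by (auto simp: subset_image_iff)
      then show "\<tau> \<in> K'" using sub \<rho>(1) by (auto simp: K'_def)
    qed
    show "finite K'" using assms(2) by (simp add: K'_def)
    show "\<sigma> \<subseteq> {..<N}" if "\<sigma> \<in> K'" for \<sigma> using that ordN \<sigma>V by (auto simp: K'_def)
    show "N \<in> crit" using ordN DV by (fastforce simp: crit_def)
    fix \<sigma> i assume "\<sigma> \<in> K'" and i: "i \<in> \<sigma>" "\<sigma> \<subseteq> {..i}" "i \<notin> crit"
    then obtain \<rho> where \<rho>: "\<rho> \<in> K" "\<sigma> = ord ` \<rho>" by (auto simp: K'_def)
    obtain v where v: "v \<in> \<rho>" "i = ord v" using i(1) \<rho>(2) by blast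
    have vV: "v \<in> V" using \<sigma>V[OF \<rho>(1)] v(1) by blast
    have vD: "v \<in> D" using i(3) ordD[OF vV] v(2) by (simp add: crit_def)
    have "\<forall>x\<in>\<rho>. g x \<le> g v"
    proof
      fix x assume "x \<in> \<rho>"
      then have "x \<in> V" "ord x \<le> ord v" using \<sigma>V[OF \<rho>(1)] i(2) \<rho>(2) v(2) by auto
      then show "g x \<le> g v" using ord_le vV by blast
    qed
    then have "insert (dom v) \<rho> \<in> K" using dom(3)[OF vD \<rho>(1) v(1)] by blast
    then have "ord ` insert (dom v) \<rho> \<in> K'" unfolding K'_def by (rule imageI)
    then show "insert (\<alpha> i) \<sigma> \<in> K'" using \<alpha>[OF vV] v(2) \<rho>(2) by simp
  qed
  let ?core = "C.cyl.sub ({0} \<times> C.Kcrit)"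
  have iso: "cw_isomorphic (realization K) (realization K')"
    unfolding K'_def by (rule realization_relabel) (use ord(1) in \<open>simp add: V_def\<close>)
  let ?U = "\<Union>{descending_star g w K |w. strong_critical g K w}"
  have U: "\<sigma> \<in> ?U \<longleftrightarrow> \<sigma> \<in> K \<and> Max (ord ` \<sigma>) \<in> crit" for \<sigma>
  proof
    assume "\<sigma> \<in> ?U"
    then obtain w where w: "strong_critical g K w" "\<sigma> \<in> K" "w \<in> \<sigma>" "\<forall>x\<in>\<sigma>. g x \<le> g w"
      by (auto simp: descending_star_def open_star_def sublevel_def)
    obtain v where v: "v \<in> \<sigma>" "Max (ord ` \<sigma>) = ord v" "\<forall>x\<in>\<sigma>. ord x \<le> ord v" using top[OF w(2)] by blast
    have vw: "v \<in> V" "w \<in> V" using \<sigma>V[OF w(2)] v(1) w(3) by auto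
    have wD: "w \<notin> D" using w(1) by (simp add: D_def strong_critical_def)
    \<comment> \<open>Otherwise \<open>v\<close> would precede \<open>w\<close>: its level is not
      above that of \<open>w\<close>, and on the same level the dominated vertices come
      first.\<close>
    have "v \<notin> D"
    proof
      assume "v \<in> D"
      moreover have "g v \<le> g w" using w(4) v(1) by blast
      ultimately have "before v w" using wD by (auto simp: before_def key_def)
      then have "ord v < ord w" using ord(2)[OF vw] by simp
      then show False using v(3) w(3) by fastforce
    qed
    then show "\<sigma> \<in> K \<and> Max (ord ` \<sigma>) \<in> crit" using v(2) w(2) ordD[OF vw(1)] by (simp add: crit_def)
  next
    assume s: "\<sigma> \<in> K \<and> Max (ord ` \<sigma>) \<in> crit"
    then obtain v where v: "v \<in> \<sigma>" "Max (ord ` \<sigma>) = ord v" "\<forall>x\<in>\<sigma>. ord x \<le> ord v" using top by blast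
    have vV: "v \<in> V" using \<sigma>V s v(1) by blast
    have "v \<notin> D" using s v(2) ordD[OF vV] by (simp add: crit_def)
    then have "strong_critical g K v" using vV V[OF vV] by (simp add: strong_critical_def D_def)
    moreover have "\<forall>x\<in>\<sigma>. g x \<le> g v" using ord_le[OF _ vV] \<sigma>V s v(3) by blast
    then have "\<sigma> \<in> descending_star g v K"
      using s v(1) by (simp add: descending_star_def open_star_def sublevel_def)
    ultimately show "\<sigma> \<in> ?U" by blast
  qed
  have "bij_betw ((`) ord) ?U C.Kcrit"
    unfolding bij_betw_def
  proof
    have "?U \<subseteq> Pow V" using U \<sigma>V by blast
    then show "inj_on ((`) ord) ?U" using inj_on_image_Pow[OF ord(1)] by (rule inj_on_subset[rotated])
    show "(`) ord ` ?U = C.Kcrit"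
    proof -
      have "?U = {\<sigma> \<in> K. Max (ord ` \<sigma>) \<in> crit}" using U by blast
      then show ?thesis unfolding C.Kcrit_def by (simp only:) (auto simp: K'_def)
    qed
  qed
  then have "bij_betw ((\<lambda>\<kappa>. C.cylinder_cell (0, \<kappa>)) \<circ> (`) ord) ?U (cw_cells ?core)"
    using C.core_cells_bij by (rule bij_betw_trans)
  then have bij: "\<exists>b. bij_betw b (cw_cells ?core) ?U" using bij_betw_inv_into by blast
  have card: "int (card \<sigma>) \<le> simplicial_dim K + 1" if "\<sigma> \<in> K'" for \<sigma>
  proof -
    obtain \<rho> where \<rho>: "\<rho> \<in> K" "\<sigma> = ord ` \<rho>" using \<open>\<sigma> \<in> K'\<close> by (auto simp: K'_def)
    have "int (card \<rho>) - 1 \<le> Max ((\<lambda>\<sigma>. int (card \<sigma>) - 1) ` K)" using assms(2) \<rho>(1) by (intro Max_ge) auto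
    moreover have "card \<sigma> \<le> card \<rho>" using \<rho> fin by (simp add: card_image_le)
    ultimately show ?thesis using \<rho>(1) by (auto simp: simplicial_dim_def)
  qed
  have "deformation (N' + 1) (realization K) ?core" if "simplicial_dim K = N'" for N'
    using C.core_deformation[OF card iso] that by simp
  then show ?thesis using C.regular_core C.core_homotopy_equivalent[OF iso] bij by blast
qed

end
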